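(* Let $F$ be a field of non-zero characteristic, let $\mathfrak{K}$ be a formation of soluble Lie algebras over $F$, and let $\mathfrak{F} = \mathrm{Loc}(\mathfrak{K})$ be the formation locally defined by $\mathfrak{K}$. Then $\mathfrak{K} = \mathfrak{F}/\mathfrak{N}$.
   Context: All algebras are finite-dimensional over the field $F$. A formation of soluble Lie algebras over $F$ is a non-empty class $\mathfrak{K}$ of soluble Lie algebras over $F$, closed under isomorphism, such that (i) if $L \in \mathfrak{K}$ and $A$ is an ideal of $L$, then $L/A \in \mathfrak{K}$; (ii) if $A_1, A_2$ are ideals of a Lie algebra $L$ with $L/A_1, L/A_2 \in \mathfrak{K}$, then $L/(A_1 \cap A_2) \in \mathfrak{K}$. A chief factor of $L$ is a quotient $H/K$ where $K \subsetneq H$ are ideals of $L$ with no ideal of $L$ strictly between them. Its centraliser is $\mathcal{C}_L(H/K) = \{x \in L \mid [x,H] \subseteq K\}$, an ideal of $L$. The formation locally defined by $\mathfrak{K}$ is the class $\mathrm{Loc}(\mathfrak{K})$ of all soluble Lie algebras $L$ over $F$ such that $L/\mathcal{C}_L(H/K) \in \mathfrak{K}$ for every chief factor $H/K$ of $L$; it is a saturated formation. $N(L)$ denotes the nil radical (largest nilpotent ideal) of $L$, and $\mathfrak{N}$ denotes the formation of nilpotent Lie algebras. For a saturated formation $\mathfrak{F}$, the quotient of $\mathfrak{F}$ by $\mathfrak{N}$ is the class (taken up to isomorphism) $$\mathfrak{F}/\mathfrak{N} = \{L/A \mid L \in \mathfrak{F},\ A \text{ an ideal of } L,\ N(L) \subseteq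 A\}.$$ *)

theory Defs
  imports "HOL-Algebra.QuotRing" "Jordan_Normal_Form.VS_Connect"
begin

text \<open>
  A Lie algebra over a field is a vector space record \<open>('f, 'a) module\<close> of HOL-Algebra, over the
  field \<open>class_ring\<close> given by a type of class \<^class>\<open>field\<close>. The bracket \<open>[x, y]\<close> is the \<open>mult\<close>
  field of the record, written \<open>x \<otimes>\<^bsub>L\<^esub> y\<close> (as in the locale \<^locale>\<open>algebra\<close>); the field \<open>one\<close>
  has no meaning. All Lie algebras are finite-dimensional.
\<close>

locale lie_algebra = vectorspace "class_ring :: ('f::field) ring" L
  for L :: "('f::field, 'a) module" +
  assumes finite_dimensional: "fin_dim"
    and bracket_closed: "\<lbrakk>x \<in> carrier L; y \<in> carrier L\<rbrakk> \<Longrightarrow> x \<otimes>\<^bsub>L\<^esub> y \<in> carrier L"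
    and bracket_add_left: "\<lbrakk>x \<in> carrier L; y \<in> carrier L; z \<in> carrier L\<rbrakk> \<Longrightarrow>
      (x \<oplus>\<^bsub>L\<^esub> y) \<otimes>\<^bsub>L\<^esub> z = (x \<otimes>\<^bsub>L\<^esub> z) \<oplus>\<^bsub>L\<^esub> (y \<otimes>\<^bsub>L\<^esub> z)"
    and bracket_add_right: "\<lbrakk>x \<in> carrier L; y \<in> carrier L; z \<in> carrier L\<rbrakk> \<Longrightarrow>
      x \<otimes>\<^bsub>L\<^esub> (y \<oplus>\<^bsub>L\<^esub> z) = (x \<otimes>\<^bsub>L\<^esub> y) \<oplus>\<^bsub>L\<^esub> (x \<otimes>\<^bsub>L\<^esub> z)"
    and bracket_smult_left: "\<lbrakk>x \<in> carrier L; y \<in> carrier L\<rbrakk> \<Longrightarrow>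
      (c \<odot>\<^bsub>L\<^esub> x) \<otimes>\<^bsub>L\<^esub> y = c \<odot>\<^bsub>L\<^esub> (x \<otimes>\<^bsub>L\<^esub> y)"
    and bracket_smult_right: "\<lbrakk>x \<in> carrier L; y \<in> carrier L\<rbrakk> \<Longrightarrow>
      x \<otimes>\<^bsub>L\<^esub> (c \<odot>\<^bsub>L\<^esub> y) = c \<odot>\<^bsub>L\<^esub> (x \<otimes>\<^bsub>L\<^esub> y)"
    and bracket_self: "x \<in> carrier L \<Longrightarrow> x \<otimes>\<^bsub>L\<^esub> x = \<zero>\<^bsub>L\<^esub>"
    and jacobi: "\<lbrakk>x \<in> carrier L; y \<in> carrier L; z \<in> carrier L\<rbrakk> \<Longrightarrow>
      (x \<otimes>\<^bsub>L\<^esub> (y \<otimes>\<^bsub>L\<^esub> z)) \<oplus>\<^bsub>L\<^esub> (y \<otimes>\<^bsub>L\<^esub> (z \<otimes>\<^bsub>L\<^esub> x)) \<oplus>\<^bsub>L\<^esub> (z \<otimes>\<^bsub>L\<^esub> (x \<otimes>\<^bsub>L\<^esub> y)) = \<zero>\<^bsub>L\<^esub>"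

definition lie_isomorphic :: "('f::field, 'a) module \<Rightarrow> ('f, 'b) module \<Rightarrow> bool" where
  "lie_isomorphic L M \<longleftrightarrow>
     (\<exists>f \<in> LinearCombinations.module_hom class_ring L M. bij_betw f (carrier L) (carrier M) \<and>
        (\<forall>x\<in>carrier L. \<forall>y\<in>carrier L. f (x \<otimes>\<^bsub>L\<^esub> y) = f x \<otimes>\<^bsub>M\<^esub> f y))"

definition lie_ideal :: "('f::field, 'a) module \<Rightarrow> 'a set \<Rightarrow> bool" where
  "lie_ideal L A \<longleftrightarrow> VectorSpace.subspace class_ring A L \<and>
     (\<forall>x\<in>carrier L. \<forall>a\<in>A. x \<otimes>\<^bsub>L\<^esub> a \<in> A)"

text \<open>The elements of \<open>L/A\<close> are the cosets \<open>A + x\<close>, as for \<^const>\<open>FactRing\<close>.\<close>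

definition lie_quotient :: "('f::field, 'a) module \<Rightarrow> 'a set \<Rightarrow> ('f, 'a set) module" where
  "lie_quotient L A =
     \<lparr>carrier = a_rcosets\<^bsub>L\<^esub> A, mult = rcoset_mult L A, one = A, zero = A, add = set_add L,
      smult = (\<lambda>c X. \<Union>x\<in>X. A +>\<^bsub>L\<^esub> (c \<odot>\<^bsub>L\<^esub> x))\<rparr>"

definition bracket_space :: "('f::field, 'a) module \<Rightarrow> 'a set \<Rightarrow> 'a set \<Rightarrow> 'a set" where
  "bracket_space L A B = LinearCombinations.module.span class_ring L {a \<otimes>\<^bsub>L\<^esub> b | a b. a \<in> A \<and> b \<in> B}"

primrec derived_series :: "('f::field, 'a) module \<Rightarrow> nat \<Rightarrow> 'a set" where
  "derived_series L 0 = carrier L"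
| "derived_series L (Suc n) = bracket_space L (derived_series L n) (derived_series L n)"

primrec lower_central_series :: "('f::field, 'a) module \<Rightarrow> nat \<Rightarrow> 'a set" where
  "lower_central_series L 0 = carrier L"
| "lower_central_series L (Suc n) = bracket_space L (carrier L) (lower_central_series L n)"

definition soluble :: "('f::field, 'a) module \<Rightarrow> bool" where
  "soluble L \<longleftrightarrow> (\<exists>n. derived_series L n = {\<zero>\<^bsub>L\<^esub>})"

definition nilpotent :: "('f::field, 'a) module \<Rightarrow> bool" where
  "nilpotent L \<longleftrightarrow> (\<exists>n. lower_central_series L n = {\<zero>\<^bsub>L\<^esub>})"

definition nilpotent_ideal :: "('f::field, 'a) module \<Rightarrow> 'a set \<Rightarrow> bool" where
  "nilpotent_ideal L A \<longleftrightarrow> lie_ideal L A \<and> nilpotent (L\<lparr>carrier := A\<rparr>)"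

definition nil_radical :: "('f::field, 'a) module \<Rightarrow> 'a set" where
  "nil_radical L = (THE N. nilpotent_ideal L N \<and> (\<forall>A. nilpotent_ideal L A \<longrightarrow> A \<subseteq> N))"

definition chief_factor :: "('f::field, 'a) module \<Rightarrow> 'a set \<Rightarrow> 'a set \<Rightarrow> bool" where
  "chief_factor L H K \<longleftrightarrow> lie_ideal L H \<and> lie_ideal L K \<and> K \<subset> H \<and>
     \<not> (\<exists>J. lie_ideal L J \<and> K \<subset> J \<and> J \<subset> H)"

definition factor_centraliser :: "('f::field, 'a) module \<Rightarrow> 'a set \<Rightarrow> 'a set \<Rightarrow> 'a set" where
  "factor_centraliser L H K = {x \<in> carrier L. \<forall>h\<in>H. x \<otimes>\<^bsub>L\<^esub> h \<in> K}"

text \<open>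
  Classes of Lie algebras. Every finite-dimensional Lie algebra over \<open>'f\<close> is isomorphic to one
  whose underlying set lies in the type \<open>'f vec\<close> (lemma \<open>exists_isomorphic_lie_model\<close> below), so
  a class of Lie algebras closed under isomorphism is given by its members in that type. A Lie
  algebra on another type, such as a quotient, belongs to the class iff it is isomorphic to such
  a member.
\<close>

type_synonym 'f lie_class = "('f, 'f vec) module set"

definition in_lie_class :: "('f::field, 'a) module \<Rightarrow> 'f lie_class \<Rightarrow> bool" where
  "in_lie_class L \<KK> \<longleftrightarrow> (\<exists>M\<in>\<KK>. lie_isomorphic L M)"

definition soluble_formation :: "('f::field) lie_class \<Rightarrow> bool" where
  "soluble_formation \<KK> \<longleftrightarrow>
     \<KK> \<noteq> {} \<and>
     (\<forall>L\<in>\<KK>. lie_algebra L \<and> soluble L) \<and>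
     (\<forall>L\<in>\<KK>. \<forall>M. lie_algebra M \<and> lie_isomorphic L M \<longrightarrow> M \<in> \<KK>) \<and>
     (\<forall>L\<in>\<KK>. \<forall>A. lie_ideal L A \<longrightarrow> in_lie_class (lie_quotient L A) \<KK>) \<and>
     (\<forall>(L :: ('f, 'f vec) module) A\<^sub>1 A\<^sub>2.
        lie_algebra L \<and> lie_ideal L A\<^sub>1 \<and> lie_ideal L A\<^sub>2 \<and>
        in_lie_class (lie_quotient L A\<^sub>1) \<KK> \<and> in_lie_class (lie_quotient L A\<^sub>2) \<KK> \<longrightarrow>
        in_lie_class (lie_quotient L (A\<^sub>1 \<inter> A\<^sub>2)) \<KK>)"

definition Loc :: "('f::field) lie_class \<Rightarrow> 'f lie_class" where
  "Loc \<KK> = {L. lie_algebra L \<and> soluble L \<and>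
     (\<forall>H K. chief_factor L H K \<longrightarrow>
        in_lie_class (lie_quotient L (factor_centraliser L H K)) \<KK>)}"

text \<open>The quotient \<open>\<FF>/\<NN>\<close> of a class by the formation \<open>\<NN>\<close> of nilpotent Lie algebras.\<close>

definition quotient_by_nilpotent :: "('f::field) lie_class \<Rightarrow> 'f lie_class" where
  "quotient_by_nilpotent \<FF> = {M. lie_algebra M \<and>
     (\<exists>L\<in>\<FF>. \<exists>A. lie_ideal L A \<and> nil_radical L \<subseteq> A \<and> lie_isomorphic M (lie_quotient L A))}"

lemma lie_algebra_surj_image:
  fixes L :: "('f::field, 'a) module" and M :: "('f, 'b) module"
  assumes L: "lie_algebra L"
    and surj: "carrier M = f ` carrier L"
    and add: "\<And>x y. \<lbrakk>x \<in> carrier L; y \<in> carrier L\<rbrakk> \<Longrightarrow> f (x \<oplus>\<^bsub>L\<^esub> y) = f x \<oplus>\<^bsub>M\<^esub> f y"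
    and smult: "\<And>c x. x \<in> carrier L \<Longrightarrow> f (c \<odot>\<^bsub>L\<^esub> x) = c \<odot>\<^bsub>M\<^esub> f x"
    and bracket: "\<And>x y. \<lbrakk>x \<in> carrier L; y \<in> carrier L\<rbrakk> \<Longrightarrow> f (x \<otimes>\<^bsub>L\<^esub> y) = f x \<otimes>\<^bsub>M\<^esub> f y"
    and zero: "f \<zero>\<^bsub>L\<^esub> = \<zero>\<^bsub>M\<^esub>"
  shows "lie_algebra M"
proof -
  interpret L: lie_algebra L by (rule L)
  have ag: "abelian_group M"
  proof (rule abelian_groupI)
    show "\<exists>y\<in>carrier M. y \<oplus>\<^bsub>M\<^esub> x = \<zero>\<^bsub>M\<^esub>" if "x \<in> carrier M" for x
    proof -
      obtain u where u: "u \<in> carrier L" "x = f u" using \<open>x \<in> carrier M\<close> surj by auto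
      have "f (\<ominus>\<^bsub>L\<^esub> u) \<oplus>\<^bsub>M\<^esub> x = \<zero>\<^bsub>M\<^esub>"
        using u add[of "\<ominus>\<^bsub>L\<^esub> u" u] zero by (simp add: L.l_neg)
      then show ?thesis using surj u by (metis L.a_inv_closed image_eqI)
    qed
  qed (auto simp: surj add[symmetric] zero[symmetric] L.a_ac)
  have mod: "Module.module (class_ring :: 'f ring) M"
    by (rule moduleI[OF class_cring.cring_axioms ag])
       (auto simp: surj add[symmetric] smult[symmetric] L.smult_closed[simplified]
          L.smult_l_distr[simplified] L.smult_r_distr[simplified] L.smult_assoc1[simplified]
          L.smult_one[simplified])
  have vs: "vectorspace (class_ring :: 'f ring) M"
    using mod L.vectorspace_axioms by (simp add: vectorspace_def)
  interpret M: vectorspace "class_ring :: 'f ring" M by (rule vs)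
  show ?thesis
  proof (unfold_locales)
    obtain S where S: "finite S" "S \<subseteq> carrier L" "L.span S = carrier L"
      using L.finite_dimensional unfolding L.fin_dim_def by auto
    have fS: "f ` S \<subseteq> carrier M" using S surj by auto
    define N where "N = {x \<in> carrier L. f x \<in> M.span (f ` S)}"
    interpret P: submodule "class_ring :: 'f ring" "M.span (f ` S)" M
      using M.span_is_submodule[OF fS] .
    have "submodule (class_ring :: 'f ring) N L"
      by unfold_locales (auto simp: N_def add smult zero P.m_closed[simplified]
          P.smult_closed[simplified] L.smult_closed[simplified])
    moreover have "S \<subseteq> N" using S M.in_own_span[OF fS] by (auto simp: N_def)
    ultimately have "carrier L \<subseteq> N" using L.span_is_subset[of S N] unfolding S(3) by blast
    then have "M.span (f ` S) = carrier M"
      using M.span_is_subset2[OF fS] surj by (auto simp: N_def)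
    then show "M.fin_dim" unfolding M.fin_dim_def using S(1) fS by blast
  qed (use L.smult_closed[simplified] in \<open>auto simp: surj add[symmetric] smult[symmetric] bracket[symmetric]
      zero[symmetric] L.bracket_closed L.bracket_add_left L.bracket_add_right L.bracket_smult_left
      L.bracket_smult_right L.bracket_self L.jacobi\<close>)
qed

lemma (in lie_algebra) lie_algebra_lie_quotient:
  assumes A: "lie_ideal L A"
  shows "lie_algebra (lie_quotient L A)"
proof (rule lie_algebra_surj_image[where L = L and f = "\<lambda>x. A +>\<^bsub>L\<^esub> x"])
  interpret A: submodule "class_ring :: 'f ring" A L
    using A by (simp add: lie_ideal_def VectorSpace.subspace_def)
  have AL: "x \<in> carrier L" if "x \<in> A" for x using that A.subset by auto
  have left: "x \<otimes>\<^bsub>L\<^esub> a \<in> A" if "x \<in> carrier L" "a \<in> A" for x a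
    using A that by (simp add: lie_ideal_def)
  have anti: "a \<otimes>\<^bsub>L\<^esub> x = \<ominus>\<^bsub>L\<^esub> (x \<otimes>\<^bsub>L\<^esub> a)" if "a \<in> carrier L" "x \<in> carrier L" for a x
  proof -
    have "(a \<otimes>\<^bsub>L\<^esub> x) \<oplus>\<^bsub>L\<^esub> (x \<otimes>\<^bsub>L\<^esub> a) =
        (a \<otimes>\<^bsub>L\<^esub> (a \<oplus>\<^bsub>L\<^esub> x)) \<oplus>\<^bsub>L\<^esub> (x \<otimes>\<^bsub>L\<^esub> (a \<oplus>\<^bsub>L\<^esub> x))"
      using that by (simp add: bracket_add_right bracket_closed bracket_self)
    also have "\<dots> = (a \<oplus>\<^bsub>L\<^esub> x) \<otimes>\<^bsub>L\<^esub> (a \<oplus>\<^bsub>L\<^esub> x)"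
      using that by (simp only: bracket_add_left M.a_closed)
    also have "\<dots> = \<zero>\<^bsub>L\<^esub>" using that by (simp add: bracket_self)
    finally show ?thesis using that M.minus_equality bracket_closed by metis
  qed
  have neg: "\<ominus>\<^bsub>L\<^esub> a \<in> A" if "a \<in> A" for a
  proof -
    have "(\<ominus>\<^bsub>(class_ring :: 'f ring)\<^esub> \<one>\<^bsub>(class_ring :: 'f ring)\<^esub>) \<odot>\<^bsub>L\<^esub> a \<in> A"
      using that by (intro A.smult_closed) simp_all
    then show ?thesis using smult_minus_1[OF AL[OF that]] by (simp only:)
  qed
  interpret A: abelian_subgroup A L
  proof (intro abelian_subgroupI3 additive_subgroup.intro M.add.subgroupI M.abelian_group_axioms)
    show "A \<subseteq> carrier L" by (rule A.subset)
    show "A \<noteq> {}" using A.zero_closed by blast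
    show "\<ominus>\<^bsub>L\<^esub> a \<in> A" if "a \<in> A" for a using that by (rule neg)
    show "a \<oplus>\<^bsub>L\<^esub> b \<in> A" if "a \<in> A" "b \<in> A" for a b using that by (rule A.m_closed)
  qed
  have coset: "A +>\<^bsub>L\<^esub> u = A +>\<^bsub>L\<^esub> v" if "u = h \<oplus>\<^bsub>L\<^esub> v" "h \<in> A" "v \<in> carrier L" for u v h
    using that by (intro M.a_repr_independence[symmetric] A.a_subgroup) (auto simp: a_r_coset_def')
  show "lie_algebra L" ..
  show "carrier (lie_quotient L A) = (\<lambda>x. A +>\<^bsub>L\<^esub> x) ` carrier L"
    by (auto simp: lie_quotient_def A_RCOSETS_def')
  show "A +>\<^bsub>L\<^esub> (x \<oplus>\<^bsub>L\<^esub> y) = (A +>\<^bsub>L\<^esub> x) \<oplus>\<^bsub>lie_quotient L A\<^esub> (A +>\<^bsub>L\<^esub> y)"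
    if "x \<in> carrier L" "y \<in> carrier L" for x y
    using that by (simp add: lie_quotient_def A.a_rcos_sum)
  show "A +>\<^bsub>L\<^esub> (c \<odot>\<^bsub>L\<^esub> x) = c \<odot>\<^bsub>lie_quotient L A\<^esub> (A +>\<^bsub>L\<^esub> x)"
    if x: "x \<in> carrier L" for c x
  proof -
    have "A +>\<^bsub>L\<^esub> (c \<odot>\<^bsub>L\<^esub> y) = A +>\<^bsub>L\<^esub> (c \<odot>\<^bsub>L\<^esub> x)" if "y \<in> A +>\<^bsub>L\<^esub> x" for y
    proof -
      obtain h where h: "h \<in> A" "y = h \<oplus>\<^bsub>L\<^esub> x" using \<open>y \<in> A +>\<^bsub>L\<^esub> x\<close> by (auto simp: a_r_coset_def')
      show ?thesis
        by (rule coset[of _ "c \<odot>\<^bsub>L\<^esub> h"])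
           (use h x AL in \<open>auto simp: smult_r_distr[simplified] smult_closed[simplified] A.smult_closed[simplified]\<close>)
    qed
    moreover have "A +>\<^bsub>L\<^esub> x \<noteq> {}" using A.a_rcos_self[OF x] by blast
    ultimately have "(\<Union>y\<in>A +>\<^bsub>L\<^esub> x. A +>\<^bsub>L\<^esub> (c \<odot>\<^bsub>L\<^esub> y)) = A +>\<^bsub>L\<^esub> (c \<odot>\<^bsub>L\<^esub> x)"
      by (intro SUP_eq_const)
    then show ?thesis by (simp add: lie_quotient_def)
  qed
  show "A +>\<^bsub>L\<^esub> (x \<otimes>\<^bsub>L\<^esub> y) = (A +>\<^bsub>L\<^esub> x) \<otimes>\<^bsub>lie_quotient L A\<^esub> (A +>\<^bsub>L\<^esub> y)"
    if x: "x \<in> carrier L" and y: "y \<in> carrier L" for x y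
  proof -
    have "A +>\<^bsub>L\<^esub> (u \<otimes>\<^bsub>L\<^esub> v) = A +>\<^bsub>L\<^esub> (x \<otimes>\<^bsub>L\<^esub> y)" if uv: "u \<in> A +>\<^bsub>L\<^esub> x" "v \<in> A +>\<^bsub>L\<^esub> y" for u v
    proof -
      obtain h k where h: "h \<in> A" "u = h \<oplus>\<^bsub>L\<^esub> x" and k: "k \<in> A" "v = k \<oplus>\<^bsub>L\<^esub> y"
        using uv by (auto simp: a_r_coset_def')
      have hL: "h \<in> carrier L" and kL: "k \<in> carrier L" using h k AL by auto
      have "h \<otimes>\<^bsub>L\<^esub> y \<in> A" using anti[OF hL y] left[OF y h(1)] neg by simp
      then have mem: "(h \<otimes>\<^bsub>L\<^esub> k \<oplus>\<^bsub>L\<^esub> x \<otimes>\<^bsub>L\<^esub> k) \<oplus>\<^bsub>L\<^esub> h \<otimes>\<^bsub>L\<^esub> y \<in> A"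
        using left[OF hL k(1)] left[OF x k(1)] by (intro A.m_closed)
      have "u \<otimes>\<^bsub>L\<^esub> v = (h \<otimes>\<^bsub>L\<^esub> k \<oplus>\<^bsub>L\<^esub> x \<otimes>\<^bsub>L\<^esub> k) \<oplus>\<^bsub>L\<^esub> (h \<otimes>\<^bsub>L\<^esub> y \<oplus>\<^bsub>L\<^esub> x \<otimes>\<^bsub>L\<^esub> y)"
        unfolding h(2) k(2) using hL kL x y
        by (simp only: bracket_add_left bracket_add_right bracket_closed M.a_closed)
      also have "\<dots> = ((h \<otimes>\<^bsub>L\<^esub> k \<oplus>\<^bsub>L\<^esub> x \<otimes>\<^bsub>L\<^esub> k) \<oplus>\<^bsub>L\<^esub> h \<otimes>\<^bsub>L\<^esub> y) \<oplus>\<^bsub>L\<^esub> (x \<otimes>\<^bsub>L\<^esub> y)"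
        using hL kL x y by (simp only: M.a_assoc bracket_closed M.a_closed)
      finally show ?thesis using coset mem bracket_closed[OF x y] by blast
    qed
    moreover have "A +>\<^bsub>L\<^esub> x \<noteq> {}" "A +>\<^bsub>L\<^esub> y \<noteq> {}"
      using A.a_rcos_self[OF x] A.a_rcos_self[OF y] by blast+
    ultimately have "(\<Union>u\<in>A +>\<^bsub>L\<^esub> x. \<Union>v\<in>A +>\<^bsub>L\<^esub> y. A +>\<^bsub>L\<^esub> (u \<otimes>\<^bsub>L\<^esub> v)) = A +>\<^bsub>L\<^esub> (x \<otimes>\<^bsub>L\<^esub> y)"
      by (intro SUP_eq_const)
    then show ?thesis by (simp add: lie_quotient_def rcoset_mult_def)
  qed
  show "A +>\<^bsub>L\<^esub> \<zero>\<^bsub>L\<^esub> = \<zero>\<^bsub>lie_quotient L A\<^esub>"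
    using A.subset by (simp add: lie_quotient_def)
qed

lemma (in lie_algebra) exists_isomorphic_lie_model:
  "\<exists>M :: ('f, 'f vec) module. lie_algebra M \<and> lie_isomorphic L M"
proof -
  obtain S where S: "finite S" "S \<subseteq> carrier L" "span S = carrier L"
    using finite_dimensional unfolding fin_dim_def by auto
  obtain bs where bs: "set bs = S" using S(1) finite_list by auto
  have "\<exists>a. x = lincomb a S" if "x \<in> carrier L" for x
    using that S finite_in_span[of S x] by auto
  then obtain a where a: "\<And>x. x \<in> carrier L \<Longrightarrow> x = lincomb (a x) S" by metis
  define g where "g x = vec_of_list (map (a x) bs)" for x
  have inj: "inj_on g (carrier L)"
  proof (rule inj_onI)
    fix x y assume xy: "x \<in> carrier L" "y \<in> carrier L" "g x = g y"
    then have "map (a x) bs = map (a y) bs" by (metis g_def list_vec)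
    then have "\<forall>v\<in>S. a x v = a y v" using bs by auto
    then have "lincomb (a x) S = lincomb (a y) S"
      unfolding lincomb_def using S by (intro finsum_cong') (auto simp: smult_closed[simplified])
    then show "x = y" using a xy by metis
  qed
  define h where "h = inv_into (carrier L) g"
  have hg: "h (g x) = x" if "x \<in> carrier L" for x using inj that by (simp add: h_def)
  define M :: "('f, 'f vec) module" where
    "M = \<lparr>carrier = g ` carrier L, mult = (\<lambda>u v. g (h u \<otimes>\<^bsub>L\<^esub> h v)), one = g \<zero>\<^bsub>L\<^esub>, zero = g \<zero>\<^bsub>L\<^esub>,
       add = (\<lambda>u v. g (h u \<oplus>\<^bsub>L\<^esub> h v)), smult = (\<lambda>c u. g (c \<odot>\<^bsub>L\<^esub> h u))\<rparr>"
  have "lie_algebra M"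
    by (rule lie_algebra_surj_image[where L = L and f = g]) (auto simp: M_def hg lie_algebra_axioms)
  moreover have "lie_isomorphic L M"
    unfolding lie_isomorphic_def
    by (rule bexI[of _ g])
       (auto simp: LinearCombinations.module_hom_def M_def hg bij_betw_def inj)
  ultimately show ?thesis by blast
qed

end

theory Submission
  imports Defs "HOL-Library.Function_Algebras" "HOL-Library.Nat_Bijection"
begin

text \<open>
  The proof of \<open>\<KK> = \<FF>/\<NN>\<close> rests on one description of the nil radical: \<open>N(L)\<close> is the intersection
  of the centralisers of all chief factors of \<open>L\<close> (\<open>nil_radical_eq_chief_centraliser\<close>).

  Let \<open>L \<in> \<FF>\<close>. All quotients \<open>L/C\<^sub>L(H/K)\<close> lie in \<open>\<KK>\<close>, and by finite dimension \<open>N(L)\<close> is already an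
  intersection of finitely many of these centralisers. So \<open>L/N(L)\<close> lies in \<open>\<KK>\<close>, and with it
  every further quotient (\<open>quotient_by_nilpotent_Loc_subset\<close>).

  Conversely, let \<open>K \<in> \<KK>\<close>. Every Lie algebra \<open>L\<close> with an abelian ideal \<open>V\<close> and \<open>L/V \<cong> K\<close> lies in \<open>\<FF>\<close>,
  because \<open>V\<close> is contained in every centraliser \<open>C\<^sub>L(H/K')\<close> (\<open>abelian_extension_in_Loc\<close>). It
  remains to choose such an \<open>L\<close> with \<open>N(L) \<subseteq> V\<close>. If a nonzero \<open>x \<in> K\<close> is still the image of an element
  of \<open>N(L)\<close>, take a \<open>K\<close>-module \<open>W\<close> on which \<open>x\<close> does not act nilpotently and replace \<open>L\<close> by the semidirect
  product of \<open>W\<close> and \<open>L\<close>: the elements of its nil radical act nilpotently on \<open>W\<close>, so the image of the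
  nil radical in \<open>K\<close> has lost \<open>x\<close> (\<open>exists_smaller_extension\<close>). After finitely many steps the image
  is zero.

  The module \<open>W\<close> is where nonzero characteristic \<open>p\<close> enters; in characteristic zero the elements of
  \<open>[K, K]\<close> act nilpotently on every module. Let \<open>x\<close> lie in the term \<open>D\<^sub>i\<close> of the derived series, but not in the
  next one. A linear form on \<open>D\<^sub>i\<close> that vanishes on the next term and takes the value \<open>1\<close> at \<open>x\<close> is a
  one-dimensional representation of \<open>D\<^sub>i\<close>. From there \<open>K\<close> is reached through subalgebras, each of them an
  ideal \<open>B\<close> of codimension one in the next, \<open>B + F y\<close>. At each step a \<open>B\<close>-module \<open>W\<close> is replaced by the
  coinduced module of \<open>B + F y\<close>, which consists of the sequences in \<open>W\<close>, with \<open>y\<close> acting as the shift. It has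
  infinite dimension, but \<open>\<delta> = ad y\<close> satisfies a monic relation between its powers with exponents
  \<open>1, p, p\<^sup>2, \<dots>\<close>, and \<open>[y\<^bsup>q\<^esup>, b] = \<delta>\<^bsup>q\<^esup>(b)\<close> for such exponents \<open>q\<close>. Hence the same polynomial in \<open>y\<close> is
  central in the enveloping algebra. The sequences annihilated by it satisfy a linear recurrence: they form
  a submodule of finite dimension (\<open>exists_coinduced_representation\<close>). This is the argument by
  which Iwasawa and Jacobson constructed faithful modules in nonzero characteristic, carried out
  with explicit sequences in place of the enveloping algebra.
\<close>

section \<open>Finite-dimensional vector spaces\<close>

context vectorspace
begin

text \<open>
  The largest size of a linearly independent subset serves as the rank of a subspace, so that
  dimensions of subspaces can be compared without making each of them a vector space of its own.
  It is the measure for all choices of subspaces and ideals of extremal dimension below.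
\<close>

lemma submodule_rank_strict_mono:
  assumes "fin_dim"
  obtains r :: "'c set \<Rightarrow> nat"
    where "\<And>A B. \<lbrakk>submodule K A V; submodule K B V; A \<subset> B\<rbrakk> \<Longrightarrow> r A < r B"
proof -
  define I where "I A = card ` {S. S \<subseteq> A \<and> lin_indpt S}" for A
  have I: "finite (I A)" "I A \<noteq> {}" if "submodule K A V" for A
  proof -
    have A: "A \<subseteq> carrier V" using that by (simp add: submodule_def)
    have "I A \<subseteq> {..dim}" unfolding I_def using A li_le_dim[OF assms] by auto
    then show "finite (I A)" using finite_subset by blast
    have "lin_indpt {}" by (auto simp: lin_dep_def)
    then show "I A \<noteq> {}" unfolding I_def by blast
  qed
  have "Max (I A) < Max (I B)" if AB: "submodule K A V" "submodule K B V" "A \<subset> B" for A B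
  proof -
    have A: "A \<subseteq> carrier V" and B: "B \<subseteq> carrier V" using AB by (auto simp: submodule_def)
    have "Max (I A) \<in> I A" using I[OF AB(1)] by (intro Max_in)
    then obtain S where S: "S \<subseteq> A" "lin_indpt S" "Max (I A) = card S" unfolding I_def by auto
    obtain v where v: "v \<in> B" "v \<notin> A" using AB(3) by blast
    have SV: "S \<subseteq> carrier V" using S A by blast
    have "span S \<subseteq> A" using S(1) AB(1) by (intro span_is_subset)
    then have "lin_indpt (S \<union> {v})"
      using lin_dep_iff_in_span[of S v] S(1,2) v B SV by blast
    then have "card (S \<union> {v}) \<in> I B" unfolding I_def using S(1) v AB(3) by blast
    moreover have "card (S \<union> {v}) = Suc (card S)"
      using S(1) v(2) li_le_dim(1)[OF assms SV S(2)] by (auto simp: card_insert_if)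
    ultimately show ?thesis using Max_ge[OF I(1)[OF AB(2)]] S(3) by fastforce
  qed
  then show ?thesis using that[of "\<lambda>A. Max (I A)"] by blast
qed

end

lemma CHAR_prime_choose:
  assumes "CHAR('f::field) \<noteq> 0" "0 < j" "j < CHAR('f)"
  shows "of_nat (CHAR('f) choose j) = (0 :: 'f)"
proof -
  have "prime CHAR('f)" using assms(1) prime_CHAR_semidom[where 'a='f] by simp
  then show ?thesis using assms by (simp add: of_nat_eq_0_iff_char_dvd dvd_choose_prime)
qed

text \<open>
  The scalars are those of \<^locale>\<open>lie_algebra\<close>, so that the module laws can be stated with the
  operations of the type \<open>'f\<close> instead of those of a ring record.
\<close>

locale field_vectorspace = vectorspace "class_ring :: ('f::field) ring" V
  for V :: "('f::field, 'a) module"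
begin

lemma smult_mem [simp]: "x \<in> carrier V \<Longrightarrow> c \<odot>\<^bsub>V\<^esub> x \<in> carrier V"
  using smult_closed by simp

lemma smult_add_scalars: "x \<in> carrier V \<Longrightarrow> (a + b) \<odot>\<^bsub>V\<^esub> x = a \<odot>\<^bsub>V\<^esub> x \<oplus>\<^bsub>V\<^esub> b \<odot>\<^bsub>V\<^esub> x"
  using smult_l_distr by simp

lemma smult_add: "\<lbrakk>x \<in> carrier V; y \<in> carrier V\<rbrakk> \<Longrightarrow> a \<odot>\<^bsub>V\<^esub> (x \<oplus>\<^bsub>V\<^esub> y) = a \<odot>\<^bsub>V\<^esub> x \<oplus>\<^bsub>V\<^esub> a \<odot>\<^bsub>V\<^esub> y"
  using smult_r_distr by simp

lemma smult_smult: "x \<in> carrier V \<Longrightarrow> a \<odot>\<^bsub>V\<^esub> (b \<odot>\<^bsub>V\<^esub> x) = (a * b) \<odot>\<^bsub>V\<^esub> x"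
  using smult_assoc1 by simp

lemma one_smult [simp]: "x \<in> carrier V \<Longrightarrow> 1 \<odot>\<^bsub>V\<^esub> x = x"
  using smult_one by simp

lemma zero_smult [simp]: "x \<in> carrier V \<Longrightarrow> 0 \<odot>\<^bsub>V\<^esub> x = \<zero>\<^bsub>V\<^esub>"
  using lmult_0 by simp

lemma smult_zero [simp]: "a \<odot>\<^bsub>V\<^esub> \<zero>\<^bsub>V\<^esub> = \<zero>\<^bsub>V\<^esub>"
  using rmult_0 by simp

lemma minus_eq_smult: "x \<in> carrier V \<Longrightarrow> \<ominus>\<^bsub>V\<^esub> x = (- 1) \<odot>\<^bsub>V\<^esub> x"
  using smult_minus_1[of x] by (simp add: class_ring_simps)

lemma smult_minus_add_eq_zero_iff:
  assumes "x \<in> carrier V" "z \<in> carrier V"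
  shows "(- 1) \<odot>\<^bsub>V\<^esub> x \<oplus>\<^bsub>V\<^esub> z = \<zero>\<^bsub>V\<^esub> \<longleftrightarrow> z = x"
  using assms minus_eq_smult[of x]
  by (metis M.a_comm M.a_inv_closed M.l_neg M.minus_equality M.minus_minus)

lemma submodule_iff:
  "submodule class_ring A V \<longleftrightarrow> A \<subseteq> carrier V \<and> \<zero>\<^bsub>V\<^esub> \<in> A \<and>
     (\<forall>x\<in>A. \<forall>y\<in>A. x \<oplus>\<^bsub>V\<^esub> y \<in> A) \<and> (\<forall>c. \<forall>x\<in>A. c \<odot>\<^bsub>V\<^esub> x \<in> A)"
  by (auto simp: submodule_def module_axioms)

lemma submodule_minus:
  assumes "submodule class_ring A V" "x \<in> A" shows "\<ominus>\<^bsub>V\<^esub> x \<in> A"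
  using assms by (auto simp: submodule_iff minus_eq_smult subset_iff)

lemma submodule_add_cancel_left:
  assumes A: "submodule class_ring A V" and x: "x \<in> A" and y: "y \<in> carrier V"
    and xy: "x \<oplus>\<^bsub>V\<^esub> y \<in> A"
  shows "y \<in> A"
proof -
  have "\<ominus>\<^bsub>V\<^esub> x \<oplus>\<^bsub>V\<^esub> (x \<oplus>\<^bsub>V\<^esub> y) \<in> A"
    using xy submodule_minus[OF A x] A by (simp add: submodule_iff)
  moreover have "x \<in> carrier V" using A x by (auto simp: submodule_iff)
  then have "\<ominus>\<^bsub>V\<^esub> x \<oplus>\<^bsub>V\<^esub> (x \<oplus>\<^bsub>V\<^esub> y) = y" using y by (simp add: M.r_neg1)
  ultimately show ?thesis by simp
qed

lemma submodule_smult_iff: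
  assumes A: "submodule class_ring A V" and x: "x \<in> carrier V" and c: "c \<noteq> 0"
  shows "c \<odot>\<^bsub>V\<^esub> x \<in> A \<longleftrightarrow> x \<in> A"
proof
  assume "c \<odot>\<^bsub>V\<^esub> x \<in> A"
  then have "inverse c \<odot>\<^bsub>V\<^esub> (c \<odot>\<^bsub>V\<^esub> x) \<in> A" using A by (simp add: submodule_iff)
  then show "x \<in> A" using x c by (simp add: smult_smult)
qed (use A in \<open>simp add: submodule_iff\<close>)

lemma submodule_adjoin:
  assumes A: "submodule class_ring A V" and v: "v \<in> carrier V"
  shows "submodule class_ring {a \<oplus>\<^bsub>V\<^esub> c \<odot>\<^bsub>V\<^esub> v | a c. a \<in> A} V" (is "submodule _ ?B _")
  unfolding submodule_iff
proof (intro conjI ballI allI)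
  have AV: "\<And>a. a \<in> A \<Longrightarrow> a \<in> carrier V" using A by (auto simp: submodule_iff)
  show "?B \<subseteq> carrier V" using AV v by auto
  have "\<zero>\<^bsub>V\<^esub> = \<zero>\<^bsub>V\<^esub> \<oplus>\<^bsub>V\<^esub> 0 \<odot>\<^bsub>V\<^esub> v" using v by simp
  moreover have "\<zero>\<^bsub>V\<^esub> \<in> A" using A by (simp add: submodule_iff)
  ultimately show "\<zero>\<^bsub>V\<^esub> \<in> ?B" by blast
  fix x assume "x \<in> ?B"
  then obtain a c where x: "x = a \<oplus>\<^bsub>V\<^esub> c \<odot>\<^bsub>V\<^esub> v" "a \<in> A" by blast
  show "d \<odot>\<^bsub>V\<^esub> x \<in> ?B" for d
  proof -
    have "d \<odot>\<^bsub>V\<^esub> x = d \<odot>\<^bsub>V\<^esub> a \<oplus>\<^bsub>V\<^esub> (d * c) \<odot>\<^bsub>V\<^esub> v"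
      using x v AV by (simp add: smult_add smult_smult)
    moreover have "d \<odot>\<^bsub>V\<^esub> a \<in> A" using A x by (simp add: submodule_iff)
    ultimately show ?thesis by blast
  qed
  fix y assume "y \<in> ?B"
  then obtain b e where y: "y = b \<oplus>\<^bsub>V\<^esub> e \<odot>\<^bsub>V\<^esub> v" "b \<in> A" by blast
  have "x \<oplus>\<^bsub>V\<^esub> y = (a \<oplus>\<^bsub>V\<^esub> b) \<oplus>\<^bsub>V\<^esub> (c + e) \<odot>\<^bsub>V\<^esub> v"
    using x y v AV by (simp add: smult_add_scalars M.a_ac)
  moreover have "a \<oplus>\<^bsub>V\<^esub> b \<in> A" using A x y by (simp add: submodule_iff)
  ultimately show "x \<oplus>\<^bsub>V\<^esub> y \<in> ?B" by blast
qed

end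

definition linear_functional :: "('f::field, 'a) module \<Rightarrow> ('a \<Rightarrow> 'f) \<Rightarrow> bool" where
  "linear_functional V \<phi> \<longleftrightarrow>
     (\<forall>x\<in>carrier V. \<forall>y\<in>carrier V. \<phi> (x \<oplus>\<^bsub>V\<^esub> y) = \<phi> x + \<phi> y) \<and>
     (\<forall>c. \<forall>x\<in>carrier V. \<phi> (c \<odot>\<^bsub>V\<^esub> x) = c * \<phi> x)"

context field_vectorspace
begin

lemma linear_functional_zero: "linear_functional V \<phi> \<Longrightarrow> \<phi> \<zero>\<^bsub>V\<^esub> = 0"
  by (metis M.zero_closed linear_functional_def mult_zero_left zero_smult)

text \<open>
  A subspace \<open>H\<close> of maximal rank among those that contain \<open>U\<close> but not \<open>x\<close> is a complement of the line
  through \<open>x\<close>: adjoining to \<open>H\<close> a vector \<open>v\<close> outside it captures \<open>x\<close>, which puts \<open>v\<close> into \<open>H + F x\<close>. The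
  functional is the coordinate along \<open>x\<close>.
\<close>

lemma exists_separating_functional:
  assumes fd: "fin_dim" and U: "submodule class_ring U V"
    and x: "x \<in> carrier V" "x \<notin> U"
  obtains \<phi> where "linear_functional V \<phi>" "\<And>u. u \<in> U \<Longrightarrow> \<phi> u = 0" "\<phi> x = 1"
proof -
  obtain r :: "'a set \<Rightarrow> nat" where
    r: "\<And>A B. \<lbrakk>submodule class_ring A V; submodule class_ring B V; A \<subset> B\<rbrakk> \<Longrightarrow> r A < r B"
    using submodule_rank_strict_mono[OF fd] by blast
  define P where "P A \<longleftrightarrow> submodule class_ring A V \<and> U \<subseteq> A \<and> x \<notin> A" for A
  have whole: "submodule class_ring (carrier V) V" by (simp add: submodule_iff)
  have "r A \<le> r (carrier V)" if "submodule class_ring A V" for A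
    using r[OF that whole] that by (cases "A = carrier V") (auto simp: submodule_iff psubset_eq)
  then have "\<exists>H. P H \<and> (\<forall>B. P B \<longrightarrow> r B \<le> r H)"
    by (intro ex_has_greatest_nat[of P U r "Suc (r (carrier V))"]) (auto simp: P_def U x less_Suc_eq_le)
  then obtain H where H: "P H" and max: "\<And>B. P B \<Longrightarrow> r B \<le> r H" by blast
  have sH: "submodule class_ring H V" and xH: "x \<notin> H" and UH: "U \<subseteq> H" using H by (auto simp: P_def)
  have HV: "\<And>h. h \<in> H \<Longrightarrow> h \<in> carrier V" using sH by (auto simp: submodule_iff)
  have decomp: "\<exists>c. \<exists>h\<in>H. v = h \<oplus>\<^bsub>V\<^esub> c \<odot>\<^bsub>V\<^esub> x" if v: "v \<in> carrier V" for v
  proof (cases "v \<in> H")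
    case True
    then have "v = v \<oplus>\<^bsub>V\<^esub> 0 \<odot>\<^bsub>V\<^esub> x" using v x by simp
    then show ?thesis using True by blast
  next
    case False
    let ?B = "{h \<oplus>\<^bsub>V\<^esub> c \<odot>\<^bsub>V\<^esub> v | h c. h \<in> H}"
    have sB: "submodule class_ring ?B V" by (rule submodule_adjoin[OF sH v])
    have HB: "H \<subseteq> ?B"
    proof
      fix h assume h: "h \<in> H"
      then have "h = h \<oplus>\<^bsub>V\<^esub> 0 \<odot>\<^bsub>V\<^esub> v" using v HV by simp
      then show "h \<in> ?B" using h by blast
    qed
    have "v = \<zero>\<^bsub>V\<^esub> \<oplus>\<^bsub>V\<^esub> 1 \<odot>\<^bsub>V\<^esub> v" using v by simp
    moreover have "\<zero>\<^bsub>V\<^esub> \<in> H" using sH by (simp add: submodule_iff)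
    ultimately have "v \<in> ?B" by blast
    then have "H \<subset> ?B" using HB False by blast
    then have "\<not> P ?B" using r[OF sH sB] max[of ?B] by linarith
    then have "x \<in> ?B" using sB HB UH by (auto simp: P_def)
    then obtain h c where hc: "x = h \<oplus>\<^bsub>V\<^esub> c \<odot>\<^bsub>V\<^esub> v" "h \<in> H" by blast
    have c: "c \<noteq> 0" using hc v xH HV by auto
    have "(- 1) \<odot>\<^bsub>V\<^esub> h \<oplus>\<^bsub>V\<^esub> x = c \<odot>\<^bsub>V\<^esub> v"
      using hc v HV by (simp add: M.r_neg1 flip: minus_eq_smult)
    then have "inverse c \<odot>\<^bsub>V\<^esub> ((- 1) \<odot>\<^bsub>V\<^esub> h \<oplus>\<^bsub>V\<^esub> x) = v"
      using c v by (simp add: smult_smult)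
    then have "v = (inverse c * (- 1)) \<odot>\<^bsub>V\<^esub> h \<oplus>\<^bsub>V\<^esub> inverse c \<odot>\<^bsub>V\<^esub> x"
      using hc(2) HV x by (simp add: smult_add smult_smult)
    moreover have "(inverse c * (- 1)) \<odot>\<^bsub>V\<^esub> h \<in> H" using sH hc by (simp only: submodule_iff)
    ultimately show ?thesis by blast
  qed
  have unique: "c = d" if "h \<oplus>\<^bsub>V\<^esub> c \<odot>\<^bsub>V\<^esub> x = k \<oplus>\<^bsub>V\<^esub> d \<odot>\<^bsub>V\<^esub> x" "h \<in> H" "k \<in> H" for c d h k
  proof (rule ccontr)
    assume "c \<noteq> d"
    have "h \<oplus>\<^bsub>V\<^esub> (c - d) \<odot>\<^bsub>V\<^esub> x = (h \<oplus>\<^bsub>V\<^esub> c \<odot>\<^bsub>V\<^esub> x) \<oplus>\<^bsub>V\<^esub> (- d) \<odot>\<^bsub>V\<^esub> x"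
      using that(2) x HV smult_add_scalars[of x c "- d"] by (simp add: M.a_assoc)
    also have "\<dots> = (k \<oplus>\<^bsub>V\<^esub> d \<odot>\<^bsub>V\<^esub> x) \<oplus>\<^bsub>V\<^esub> (- d) \<odot>\<^bsub>V\<^esub> x" by (simp only: that(1))
    also have "\<dots> = k \<oplus>\<^bsub>V\<^esub> (d + (- d)) \<odot>\<^bsub>V\<^esub> x"
      using that(3) x HV smult_add_scalars[of x d "- d"] by (simp add: M.a_assoc del: add.right_inverse)
    also have "\<dots> = k" using that x HV by simp
    finally have "h \<oplus>\<^bsub>V\<^esub> (c - d) \<odot>\<^bsub>V\<^esub> x \<in> H" using that by simp
    then have "(c - d) \<odot>\<^bsub>V\<^esub> x \<in> H"
      using submodule_add_cancel_left[OF sH that(2)] x by simp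
    then show False using xH \<open>c \<noteq> d\<close> x sH by (simp add: submodule_smult_iff)
  qed
  define \<phi> where "\<phi> v = (SOME c. \<exists>h\<in>H. v = h \<oplus>\<^bsub>V\<^esub> c \<odot>\<^bsub>V\<^esub> x)" for v
  have \<phi>: "\<phi> (h \<oplus>\<^bsub>V\<^esub> c \<odot>\<^bsub>V\<^esub> x) = c" if "h \<in> H" for h c
    unfolding \<phi>_def using that unique by (intro some_equality) blast+
  show ?thesis
  proof
    show "linear_functional V \<phi>"
      unfolding linear_functional_def
    proof (intro conjI ballI allI)
      fix v w assume v: "v \<in> carrier V" and w: "w \<in> carrier V"
      obtain h c where h: "h \<in> H" "v = h \<oplus>\<^bsub>V\<^esub> c \<odot>\<^bsub>V\<^esub> x" using decomp[OF v] by blast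
      obtain k d where k: "k \<in> H" "w = k \<oplus>\<^bsub>V\<^esub> d \<odot>\<^bsub>V\<^esub> x" using decomp[OF w] by blast
      have "v \<oplus>\<^bsub>V\<^esub> w = (h \<oplus>\<^bsub>V\<^esub> k) \<oplus>\<^bsub>V\<^esub> (c + d) \<odot>\<^bsub>V\<^esub> x"
        using h k HV x by (simp add: smult_add_scalars M.a_ac)
      then show "\<phi> (v \<oplus>\<^bsub>V\<^esub> w) = \<phi> v + \<phi> w" using h k sH \<phi> by (simp add: submodule_iff)
    next
      fix c v assume v: "v \<in> carrier V"
      obtain h d where h: "h \<in> H" "v = h \<oplus>\<^bsub>V\<^esub> d \<odot>\<^bsub>V\<^esub> x" using decomp[OF v] by blast
      have "c \<odot>\<^bsub>V\<^esub> v = c \<odot>\<^bsub>V\<^esub> h \<oplus>\<^bsub>V\<^esub> (c * d) \<odot>\<^bsub>V\<^esub> x"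
        using h HV x by (simp add: smult_add smult_smult)
      then show "\<phi> (c \<odot>\<^bsub>V\<^esub> v) = c * \<phi> v" using h sH \<phi> by (simp add: submodule_iff)
    qed
    show "\<phi> u = 0" if "u \<in> U" for u using \<phi>[of u 0] that UH HV x by auto
    have "\<zero>\<^bsub>V\<^esub> \<in> H" using sH by (simp add: submodule_iff)
    then show "\<phi> x = 1" using \<phi>[of "\<zero>\<^bsub>V\<^esub>" 1] x by simp
  qed
qed

text \<open>
  Adding to a finite set of functionals one that does not vanish at some \<open>x\<close> of their common kernel lowers
  the rank of that kernel. A set whose common kernel has least rank therefore has kernel zero.
\<close>

lemma finite_separating_functionals:
  assumes fd: "fin_dim"
  obtains \<Phi> where "finite \<Phi>" "\<And>\<phi>. \<phi> \<in> \<Phi> \<Longrightarrow> linear_functional V \<phi>"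
    "\<And>x. \<lbrakk>x \<in> carrier V; \<And>\<phi>. \<phi> \<in> \<Phi> \<Longrightarrow> \<phi> x = 0\<rbrakk> \<Longrightarrow> x = \<zero>\<^bsub>V\<^esub>"
proof -
  obtain r :: "'a set \<Rightarrow> nat" where
    r: "\<And>A B. \<lbrakk>submodule class_ring A V; submodule class_ring B V; A \<subset> B\<rbrakk> \<Longrightarrow> r A < r B"
    using submodule_rank_strict_mono[OF fd] by blast
  define Ker where "Ker \<Phi> = {x \<in> carrier V. \<forall>\<phi>\<in>\<Phi>. \<phi> x = 0}" for \<Phi> :: "('a \<Rightarrow> 'f) set"
  define P where "P \<Phi> \<longleftrightarrow> finite \<Phi> \<and> (\<forall>\<phi>\<in>\<Phi>. linear_functional V \<phi>)" for \<Phi>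
  have sub: "submodule class_ring (Ker \<Phi>) V" if "P \<Phi>" for \<Phi>
  proof -
    have \<Phi>: "\<And>\<phi>. \<phi> \<in> \<Phi> \<Longrightarrow> linear_functional V \<phi>" using that by (simp add: P_def)
    have "\<phi> (x \<oplus>\<^bsub>V\<^esub> y) = 0" if "x \<in> Ker \<Phi>" "y \<in> Ker \<Phi>" "\<phi> \<in> \<Phi>" for x y \<phi>
      using that \<Phi>[OF that(3)] unfolding Ker_def linear_functional_def by fastforce
    moreover have "\<phi> (c \<odot>\<^bsub>V\<^esub> x) = 0" if "x \<in> Ker \<Phi>" "\<phi> \<in> \<Phi>" for c x \<phi>
      using that \<Phi>[OF that(2)] unfolding Ker_def linear_functional_def by fastforce
    moreover have "\<phi> \<zero>\<^bsub>V\<^esub> = 0" if "\<phi> \<in> \<Phi>" for \<phi>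
      using linear_functional_zero[OF \<Phi>[OF that]] .
    ultimately show ?thesis unfolding submodule_iff by (auto simp: Ker_def)
  qed
  have "P {}" by (simp add: P_def)
  then obtain \<Phi> where \<Phi>: "P \<Phi>" and min: "\<And>\<Psi>. P \<Psi> \<Longrightarrow> r (Ker \<Phi>) \<le> r (Ker \<Psi>)"
    using ex_has_least_nat[of P "{}" "\<lambda>\<Psi>. r (Ker \<Psi>)"] by blast
  have "x = \<zero>\<^bsub>V\<^esub>" if x: "x \<in> carrier V" "\<And>\<phi>. \<phi> \<in> \<Phi> \<Longrightarrow> \<phi> x = 0" for x
  proof (rule ccontr)
    assume "x \<noteq> \<zero>\<^bsub>V\<^esub>"
    moreover have "submodule class_ring {\<zero>\<^bsub>V\<^esub>} V" by (simp add: submodule_iff)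
    ultimately obtain \<psi> where \<psi>: "linear_functional V \<psi>" "\<psi> x = 1"
      using exists_separating_functional[OF fd, of "{\<zero>\<^bsub>V\<^esub>}" x] x by blast
    have P: "P (insert \<psi> \<Phi>)" using \<Phi> \<psi> by (simp add: P_def)
    have "x \<in> Ker \<Phi>" "x \<notin> Ker (insert \<psi> \<Phi>)" using x \<psi> by (auto simp: Ker_def)
    then have "Ker (insert \<psi> \<Phi>) \<subset> Ker \<Phi>" by (auto simp: Ker_def)
    then show False using r[OF sub[OF P] sub[OF \<Phi>]] min[OF P] by simp
  qed
  then show ?thesis using that \<Phi> by (auto simp: P_def)
qed

text \<open>
  A functional is either zero on \<open>A\<close>, and can be dropped, or its kernel in \<open>A\<close> together with one more vector
  spans \<open>A\<close>.
\<close>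

lemma finite_span_if_separating:
  assumes "finite \<Phi>" "\<And>\<phi>. \<phi> \<in> \<Phi> \<Longrightarrow> linear_functional V \<phi>" "submodule class_ring A V"
    and "\<And>x. \<lbrakk>x \<in> A; \<And>\<phi>. \<phi> \<in> \<Phi> \<Longrightarrow> \<phi> x = 0\<rbrakk> \<Longrightarrow> x = \<zero>\<^bsub>V\<^esub>"
  shows "\<exists>T. finite T \<and> T \<subseteq> A \<and> A \<subseteq> span T"
  using assms
proof (induction \<Phi> arbitrary: A rule: finite_induct)
  case empty
  then have "A \<subseteq> {\<zero>\<^bsub>V\<^esub>}" by blast
  then have "A \<subseteq> span {}" by (simp add: span_empty)
  then show ?case by blast
next
  case (insert \<phi> \<Phi>)
  have \<phi>: "linear_functional V \<phi>" using insert.prems by blast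
  have AV: "\<And>a. a \<in> A \<Longrightarrow> a \<in> carrier V" using insert.prems(2) by (auto simp: submodule_iff)
  let ?B = "{x \<in> A. \<phi> x = 0}"
  have "submodule class_ring ?B V"
    using insert.prems(2) \<phi> linear_functional_zero[OF \<phi>] AV
    by (auto simp: submodule_iff linear_functional_def)
  then have "\<exists>T. finite T \<and> T \<subseteq> ?B \<and> ?B \<subseteq> span T"
    using insert.prems by (intro insert.IH) auto
  then obtain T where T: "finite T" "T \<subseteq> ?B" "?B \<subseteq> span T" by blast
  show ?case
  proof (cases "?B = A")
    case True
    then show ?thesis using T by auto
  next
    case False
    then obtain v where v: "v \<in> A" "\<phi> v \<noteq> 0" by blast
    have TV: "insert v T \<subseteq> carrier V" using T v AV by blast
    then have sp: "submodule class_ring (span (insert v T)) V" by (rule span_is_submodule)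
    have sub: "insert v T \<subseteq> span (insert v T)" by (rule in_own_span[OF TV])
    have mono: "span T \<subseteq> span (insert v T)" by (rule span_is_monotone) blast
    have "x \<in> span (insert v T)" if x: "x \<in> A" for x
    proof -
      define c where "c = \<phi> x / \<phi> v"
      have "(- c) \<odot>\<^bsub>V\<^esub> v \<oplus>\<^bsub>V\<^esub> x \<in> ?B"
        using x v \<phi> AV insert.prems(2) by (auto simp: linear_functional_def submodule_iff c_def)
      then have "(- c) \<odot>\<^bsub>V\<^esub> v \<oplus>\<^bsub>V\<^esub> x \<in> span (insert v T)" using T mono by blast
      moreover have "(- c) \<odot>\<^bsub>V\<^esub> v \<in> span (insert v T)" using sub sp by (simp add: submodule_iff)
      ultimately show ?thesis using submodule_add_cancel_left[OF sp] x AV by blast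
    qed
    then show ?thesis using T v by (intro exI[of _ "insert v T"]) auto
  qed
qed

text \<open>
  The criterion by which spaces of functions, subalgebras and semidirect products are recognised as
  finite-dimensional: finitely many coordinates determine each element.
\<close>

lemma fin_dim_if_separating:
  assumes "finite \<Phi>" "\<And>\<phi>. \<phi> \<in> \<Phi> \<Longrightarrow> linear_functional V \<phi>"
    and "\<And>x. \<lbrakk>x \<in> carrier V; \<And>\<phi>. \<phi> \<in> \<Phi> \<Longrightarrow> \<phi> x = 0\<rbrakk> \<Longrightarrow> x = \<zero>\<^bsub>V\<^esub>"
  shows "fin_dim"
proof -
  obtain T where T: "finite T" "T \<subseteq> carrier V" "carrier V \<subseteq> span T"
    using finite_span_if_separating[of \<Phi> "carrier V"] assms by (auto simp: submodule_iff)
  then have "span T = carrier V" using span_is_subset2 by blast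
  then show ?thesis using T by (auto simp: fin_dim_def)
qed

end

text \<open>
  The vectors \<open>u 0, u 1, \<dots>\<close> of the finite-dimensional space of functions on \<open>S\<close> cannot be independent; the
  first one that depends on its predecessors gives a relation with leading coefficient one. The
  induction eliminates one coordinate \<open>s\<close> at a time.
\<close>

lemma monic_linear_relation:
  fixes u :: "nat \<Rightarrow> 's \<Rightarrow> 'f::field"
  assumes "finite S"
  shows "\<exists>m a. \<forall>s\<in>S. u m s = (\<Sum>l<m. a l * u l s)"
  using assms
proof (induction S arbitrary: u rule: finite_induct)
  case empty
  show ?case by simp
next
  case (insert s S)
  show ?case
  proof (cases "\<forall>k. u k s = 0")
    case True
    then show ?thesis using insert.IH[of u] by auto
  next
    case False
    define k where "k = (LEAST k. u k s \<noteq> 0)"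
    have k: "u k s \<noteq> 0" unfolding k_def using False by (metis (mono_tags) LeastI)
    have less: "u j s = 0" if "j < k" for j using that not_less_Least unfolding k_def by blast
    \<comment> \<open>Subtracting multiples of \<open>u k\<close>, the first vector with a nonzero coordinate \<open>s\<close>, removes that
      coordinate from all others; \<open>c\<close> enumerates the indices different from \<open>k\<close>.\<close>
    define q where "q l = u l s / u k s" for l
    define c where "c l = (if l < k then l else Suc l)" for l
    define w where "w l t = u (c l) t - q (c l) * u k t" for l t
    obtain m a where m: "\<And>t. t \<in> S \<Longrightarrow> w m t = (\<Sum>l<m. a l * w l t)" using insert.IH[of w] by blast
    have w0: "w l s = 0" for l using k by (simp add: w_def q_def)
    have eq: "w m t = (\<Sum>l<m. a l * w l t)" if "t \<in> insert s S" for t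
      using that m w0 by auto
    have q0: "q l = 0" if "l < k" for l using less that by (simp add: q_def)
    show ?thesis
    proof (cases "m < k")
      case True
      then have "w l t = u l t" if "l \<le> m" for l t
        using that q0 by (simp add: w_def c_def)
      then show ?thesis using eq by (intro exI[of _ m] exI[of _ a]) simp
    next
      case False
      \<comment> \<open>The relation for \<open>w\<close> rewritten in terms of \<open>u\<close>; all multiples of \<open>u k\<close> are collected in \<open>b k\<close>.\<close>
      define b where "b l = (if l < k then a l else if l = k
        then q (Suc m) - (\<Sum>i<m. a i * q (c i)) else a (l - 1))" for l
      have "u (Suc m) t = (\<Sum>l<Suc m. b l * u l t)" if t: "t \<in> insert s S" for t
      proof -
        have "u (Suc m) t = w m t + q (Suc m) * u k t"
          using False by (simp add: w_def c_def)
        also have "w m t = (\<Sum>l<m. a l * u (c l) t) - (\<Sum>l<m. a l * q (c l)) * u k t"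
          using eq[OF t] by (simp add: w_def algebra_simps sum_subtractf sum_distrib_left sum_distrib_right)
        finally have 1: "u (Suc m) t = (\<Sum>l<m. a l * u (c l) t) + b k * u k t"
          by (simp add: b_def algebra_simps)
        have "inj_on c {..<m}" by (auto simp: inj_on_def c_def split: if_splits)
        moreover have "c ` {..<m} = {..<Suc m} - {k}"
        proof (intro equalityI subsetI)
          fix x assume x: "x \<in> {..<Suc m} - {k}"
          then have "x = c (if x < k then x else x - 1)" "(if x < k then x else x - 1) < m"
            using False by (auto simp: c_def)
          then show "x \<in> c ` {..<m}" by blast
        qed (auto simp: c_def split: if_splits)
        ultimately have "(\<Sum>l\<in>{..<Suc m} - {k}. b l * u l t) = (\<Sum>l<m. b (c l) * u (c l) t)"
          by (metis (mono_tags, lifting) sum.reindex_cong)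
        also have "\<dots> = (\<Sum>l<m. a l * u (c l) t)"
          by (intro sum.cong) (auto simp: b_def c_def)
        finally show ?thesis
          using 1 False sum.remove[of "{..<Suc m}" k "\<lambda>l. b l * u l t"] by simp
      qed
      then show ?thesis by blast
    qed
  qed
qed

section \<open>Ideals, homomorphisms and quotients\<close>

sublocale lie_algebra \<subseteq> field_vectorspace L ..

context lie_algebra
begin

lemma bracket_zero_right [simp]: "x \<in> carrier L \<Longrightarrow> x \<otimes>\<^bsub>L\<^esub> \<zero>\<^bsub>L\<^esub> = \<zero>\<^bsub>L\<^esub>"
  using bracket_smult_right[of x "\<zero>\<^bsub>L\<^esub>" 0] bracket_closed by simp

lemma bracket_zero_left [simp]: "x \<in> carrier L \<Longrightarrow> \<zero>\<^bsub>L\<^esub> \<otimes>\<^bsub>L\<^esub> x = \<zero>\<^bsub>L\<^esub>"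
  using bracket_smult_left[of "\<zero>\<^bsub>L\<^esub>" x 0] bracket_closed by simp

lemma bracket_anticommute:
  assumes x: "x \<in> carrier L" and y: "y \<in> carrier L"
  shows "y \<otimes>\<^bsub>L\<^esub> x = \<ominus>\<^bsub>L\<^esub> (x \<otimes>\<^bsub>L\<^esub> y)"
proof -
  have "(y \<otimes>\<^bsub>L\<^esub> x) \<oplus>\<^bsub>L\<^esub> (x \<otimes>\<^bsub>L\<^esub> y) =
      (y \<otimes>\<^bsub>L\<^esub> (y \<oplus>\<^bsub>L\<^esub> x)) \<oplus>\<^bsub>L\<^esub> (x \<otimes>\<^bsub>L\<^esub> (y \<oplus>\<^bsub>L\<^esub> x))"
    using assms by (simp add: bracket_add_right bracket_closed bracket_self)
  also have "\<dots> = (y \<oplus>\<^bsub>L\<^esub> x) \<otimes>\<^bsub>L\<^esub> (y \<oplus>\<^bsub>L\<^esub> x)"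
    using assms by (simp only: bracket_add_left M.a_closed)
  also have "\<dots> = \<zero>\<^bsub>L\<^esub>" using assms by (simp add: bracket_self)
  finally show ?thesis using assms M.minus_equality bracket_closed by metis
qed

text \<open>The Jacobi identity, read as the Leibniz rule for the bracket with \<open>x\<close>.\<close>

lemma bracket_derivation:
  assumes x: "x \<in> carrier L" and y: "y \<in> carrier L" and z: "z \<in> carrier L"
  shows "x \<otimes>\<^bsub>L\<^esub> (y \<otimes>\<^bsub>L\<^esub> z) = ((x \<otimes>\<^bsub>L\<^esub> y) \<otimes>\<^bsub>L\<^esub> z) \<oplus>\<^bsub>L\<^esub> (y \<otimes>\<^bsub>L\<^esub> (x \<otimes>\<^bsub>L\<^esub> z))"
proof -
  have "y \<otimes>\<^bsub>L\<^esub> (z \<otimes>\<^bsub>L\<^esub> x) = \<ominus>\<^bsub>L\<^esub> (y \<otimes>\<^bsub>L\<^esub> (x \<otimes>\<^bsub>L\<^esub> z))"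
    using assms bracket_closed bracket_anticommute[of x z]
    by (simp add: minus_eq_smult bracket_smult_right)
  moreover have "z \<otimes>\<^bsub>L\<^esub> (x \<otimes>\<^bsub>L\<^esub> y) = \<ominus>\<^bsub>L\<^esub> ((x \<otimes>\<^bsub>L\<^esub> y) \<otimes>\<^bsub>L\<^esub> z)"
    using assms bracket_closed by (intro bracket_anticommute)
  ultimately have *: "x \<otimes>\<^bsub>L\<^esub> (y \<otimes>\<^bsub>L\<^esub> z) \<oplus>\<^bsub>L\<^esub> \<ominus>\<^bsub>L\<^esub> (y \<otimes>\<^bsub>L\<^esub> (x \<otimes>\<^bsub>L\<^esub> z)) \<oplus>\<^bsub>L\<^esub> \<ominus>\<^bsub>L\<^esub> ((x \<otimes>\<^bsub>L\<^esub> y) \<otimes>\<^bsub>L\<^esub> z) = \<zero>\<^bsub>L\<^esub>"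
    using jacobi[OF assms] by simp
  have "x \<otimes>\<^bsub>L\<^esub> (y \<otimes>\<^bsub>L\<^esub> z) = x \<otimes>\<^bsub>L\<^esub> (y \<otimes>\<^bsub>L\<^esub> z) \<oplus>\<^bsub>L\<^esub> \<ominus>\<^bsub>L\<^esub> (y \<otimes>\<^bsub>L\<^esub> (x \<otimes>\<^bsub>L\<^esub> z)) \<oplus>\<^bsub>L\<^esub> \<ominus>\<^bsub>L\<^esub> ((x \<otimes>\<^bsub>L\<^esub> y) \<otimes>\<^bsub>L\<^esub> z)
      \<oplus>\<^bsub>L\<^esub> ((x \<otimes>\<^bsub>L\<^esub> y) \<otimes>\<^bsub>L\<^esub> z \<oplus>\<^bsub>L\<^esub> y \<otimes>\<^bsub>L\<^esub> (x \<otimes>\<^bsub>L\<^esub> z))"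
    using assms bracket_closed by (simp add: M.a_assoc M.r_neg1 M.l_neg)
  then show ?thesis unfolding * using assms bracket_closed by simp
qed

lemma subspace_iff: "VectorSpace.subspace class_ring A L \<longleftrightarrow> submodule class_ring A L"
  by (auto simp: VectorSpace.subspace_def vectorspace_axioms)

lemma lie_ideal_iff:
  "lie_ideal L A \<longleftrightarrow> A \<subseteq> carrier L \<and> \<zero>\<^bsub>L\<^esub> \<in> A \<and>
     (\<forall>x\<in>A. \<forall>y\<in>A. x \<oplus>\<^bsub>L\<^esub> y \<in> A) \<and> (\<forall>c. \<forall>x\<in>A. c \<odot>\<^bsub>L\<^esub> x \<in> A) \<and>
     (\<forall>x\<in>carrier L. \<forall>a\<in>A. x \<otimes>\<^bsub>L\<^esub> a \<in> A)"
  by (auto simp: lie_ideal_def subspace_iff submodule_iff)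

lemma lie_ideal_submodule: "lie_ideal L A \<Longrightarrow> submodule class_ring A L"
  by (simp add: lie_ideal_def subspace_iff)

lemma lie_ideal_right:
  assumes "lie_ideal L A" "a \<in> A" "x \<in> carrier L"
  shows "a \<otimes>\<^bsub>L\<^esub> x \<in> A"
proof -
  have "a \<in> carrier L" "x \<otimes>\<^bsub>L\<^esub> a \<in> A" using assms by (auto simp: lie_ideal_iff)
  then show ?thesis
    using submodule_minus[OF lie_ideal_submodule[OF assms(1)]] bracket_anticommute[of x a] assms by simp
qed

lemma lie_ideal_carrier: "lie_ideal L (carrier L)"
  by (simp add: lie_ideal_iff bracket_closed)

lemma lie_ideal_zero: "lie_ideal L {\<zero>\<^bsub>L\<^esub>}"
  by (simp add: lie_ideal_iff)

lemma lie_ideal_Int: "\<lbrakk>lie_ideal L A; lie_ideal L B\<rbrakk> \<Longrightarrow> lie_ideal L (A \<inter> B)"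
  by (auto simp: lie_ideal_iff)

lemma lie_ideal_rank:
  obtains r :: "'a set \<Rightarrow> nat"
    where "\<And>A B. \<lbrakk>lie_ideal L A; lie_ideal L B; A \<subset> B\<rbrakk> \<Longrightarrow> r A < r B"
  using submodule_rank_strict_mono[OF finite_dimensional] lie_ideal_submodule by metis

end

definition lie_hom :: "('f::field, 'a) module \<Rightarrow> ('f, 'b) module \<Rightarrow> ('a \<Rightarrow> 'b) \<Rightarrow> bool" where
  "lie_hom L M f \<longleftrightarrow> f \<in> LinearCombinations.module_hom class_ring L M \<and>
     (\<forall>x\<in>carrier L. \<forall>y\<in>carrier L. f (x \<otimes>\<^bsub>L\<^esub> y) = f x \<otimes>\<^bsub>M\<^esub> f y)"

lemma lie_hom_iff:
  "lie_hom L M f \<longleftrightarrow> f \<in> carrier L \<rightarrow> carrier M \<and>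
     (\<forall>x\<in>carrier L. \<forall>y\<in>carrier L. f (x \<oplus>\<^bsub>L\<^esub> y) = f x \<oplus>\<^bsub>M\<^esub> f y) \<and>
     (\<forall>c. \<forall>x\<in>carrier L. f (c \<odot>\<^bsub>L\<^esub> x) = c \<odot>\<^bsub>M\<^esub> f x) \<and>
     (\<forall>x\<in>carrier L. \<forall>y\<in>carrier L. f (x \<otimes>\<^bsub>L\<^esub> y) = f x \<otimes>\<^bsub>M\<^esub> f y)"
  by (auto simp: lie_hom_def LinearCombinations.module_hom_def)

lemma lie_isomorphic_iff_hom:
  "lie_isomorphic L M \<longleftrightarrow> (\<exists>f. lie_hom L M f \<and> bij_betw f (carrier L) (carrier M))"
  by (auto simp: lie_isomorphic_def lie_hom_def)

lemma lie_hom_id: "lie_hom L L id"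
  by (simp add: lie_hom_iff)

lemma lie_hom_comp: "\<lbrakk>lie_hom L M f; lie_hom M P g\<rbrakk> \<Longrightarrow> lie_hom L P (g \<circ> f)"
  by (auto simp: lie_hom_iff Pi_iff)

definition lie_kernel :: "('f::field, 'a) module \<Rightarrow> ('f, 'b) module \<Rightarrow> ('a \<Rightarrow> 'b) \<Rightarrow> 'a set" where
  "lie_kernel L M f = {x \<in> carrier L. f x = \<zero>\<^bsub>M\<^esub>}"

lemma lie_hom_zero:
  assumes "lie_algebra L" "lie_algebra M" "lie_hom L M f"
  shows "f \<zero>\<^bsub>L\<^esub> = \<zero>\<^bsub>M\<^esub>"
proof -
  interpret L: lie_algebra L by fact
  interpret M: lie_algebra M by fact
  have "f (0 \<odot>\<^bsub>L\<^esub> \<zero>\<^bsub>L\<^esub>) = 0 \<odot>\<^bsub>M\<^esub> f \<zero>\<^bsub>L\<^esub>"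
    using assms(3) L.M.zero_closed unfolding lie_hom_iff by blast
  moreover have "f \<zero>\<^bsub>L\<^esub> \<in> carrier M" using assms(3) by (auto simp: lie_hom_iff)
  ultimately show ?thesis by simp
qed

lemma lie_ideal_vimage:
  assumes L: "lie_algebra L" and M: "lie_algebra M" and f: "lie_hom L M f" and B: "lie_ideal M B"
  shows "lie_ideal L {x \<in> carrier L. f x \<in> B}"
proof -
  interpret L: lie_algebra L by fact
  interpret M: lie_algebra M by fact
  show ?thesis using f B lie_hom_zero[OF L M f]
    by (auto simp: L.lie_ideal_iff M.lie_ideal_iff lie_hom_iff L.bracket_closed Pi_iff)
qed

lemma lie_ideal_image:
  assumes L: "lie_algebra L" and M: "lie_algebra M" and f: "lie_hom L M f"
    and surj: "f ` carrier L = carrier M" and A: "lie_ideal L A"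
  shows "lie_ideal M (f ` A)"
proof -
  interpret L: lie_algebra L by fact
  interpret M: lie_algebra M by fact
  have AL: "A \<subseteq> carrier L" using A by (simp add: L.lie_ideal_iff)
  have fs: "\<And>x y. x \<in> carrier L \<Longrightarrow> y \<in> carrier L \<Longrightarrow> f x \<oplus>\<^bsub>M\<^esub> f y = f (x \<oplus>\<^bsub>L\<^esub> y)"
    "\<And>c x. x \<in> carrier L \<Longrightarrow> c \<odot>\<^bsub>M\<^esub> f x = f (c \<odot>\<^bsub>L\<^esub> x)"
    "\<And>x y. x \<in> carrier L \<Longrightarrow> y \<in> carrier L \<Longrightarrow> f x \<otimes>\<^bsub>M\<^esub> f y = f (x \<otimes>\<^bsub>L\<^esub> y)"
    using f by (auto simp: lie_hom_iff)
  show ?thesis unfolding M.lie_ideal_iff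
  proof (intro conjI ballI allI)
    show "f ` A \<subseteq> carrier M" using AL surj by blast
    have "\<zero>\<^bsub>L\<^esub> \<in> A" using A by (simp add: L.lie_ideal_iff)
    then show "\<zero>\<^bsub>M\<^esub> \<in> f ` A" using lie_hom_zero[OF L M f] by (metis image_eqI)
    fix x assume "x \<in> f ` A"
    then obtain a where a: "a \<in> A" "x = f a" by blast
    show "c \<odot>\<^bsub>M\<^esub> x \<in> f ` A" for c using a A fs(2)[of a c] AL by (auto simp: L.lie_ideal_iff)
    show "x \<oplus>\<^bsub>M\<^esub> y \<in> f ` A" if y: "y \<in> f ` A" for y
    proof -
      obtain b where b: "b \<in> A" "y = f b" using y by blast
      then have "x \<oplus>\<^bsub>M\<^esub> y = f (a \<oplus>\<^bsub>L\<^esub> b)" using a AL fs(1) by blast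
      moreover have "a \<oplus>\<^bsub>L\<^esub> b \<in> A" using A a b by (simp add: L.lie_ideal_iff)
      ultimately show ?thesis by blast
    qed
  next
    fix y x assume "x \<in> f ` A" "y \<in> carrier M"
    then obtain a z where a: "a \<in> A" "x = f a" "z \<in> carrier L" "y = f z" using surj by blast
    then show "y \<otimes>\<^bsub>M\<^esub> x \<in> f ` A" using A fs(3)[of z a] AL by (auto simp: L.lie_ideal_iff)
  qed
qed

lemma lie_ideal_kernel:
  assumes L: "lie_algebra L" and M: "lie_algebra M" and f: "lie_hom L M f"
  shows "lie_ideal L (lie_kernel L M f)"
proof -
  interpret M: lie_algebra M by fact
  have "lie_ideal L {x \<in> carrier L. f x \<in> {\<zero>\<^bsub>M\<^esub>}}"
    by (rule lie_ideal_vimage[OF L M f M.lie_ideal_zero])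
  then show ?thesis by (simp add: lie_kernel_def)
qed

lemma lie_hom_eq_iff:
  assumes L: "lie_algebra L" and M: "lie_algebra M" and f: "lie_hom L M f"
    and x: "x \<in> carrier L" and y: "y \<in> carrier L"
  shows "f x = f y \<longleftrightarrow> (- 1) \<odot>\<^bsub>L\<^esub> y \<oplus>\<^bsub>L\<^esub> x \<in> lie_kernel L M f"
proof -
  interpret L: lie_algebra L by fact
  interpret M: lie_algebra M by fact
  have "f x \<in> carrier M" "f y \<in> carrier M"
    and "f ((- 1) \<odot>\<^bsub>L\<^esub> y \<oplus>\<^bsub>L\<^esub> x) = (- 1) \<odot>\<^bsub>M\<^esub> f y \<oplus>\<^bsub>M\<^esub> f x"
    using f x y by (auto simp: lie_hom_iff)
  then have "f ((- 1) \<odot>\<^bsub>L\<^esub> y \<oplus>\<^bsub>L\<^esub> x) = \<zero>\<^bsub>M\<^esub> \<longleftrightarrow> f x = f y"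
    by (simp add: M.smult_minus_add_eq_zero_iff)
  then show ?thesis using x y by (simp add: lie_kernel_def)
qed

lemma vimage_image_lie_ideal:
  assumes L: "lie_algebra L" and M: "lie_algebra M" and f: "lie_hom L M f"
    and A: "lie_ideal L A" and ker: "lie_kernel L M f \<subseteq> A"
  shows "{x \<in> carrier L. f x \<in> f ` A} = A"
proof -
  interpret L: lie_algebra L by fact
  have AL: "A \<subseteq> carrier L" using A by (simp add: L.lie_ideal_iff)
  have "x \<in> A" if x: "x \<in> carrier L" and a: "a \<in> A" "f x = f a" for x a
  proof -
    have "(- 1) \<odot>\<^bsub>L\<^esub> a \<oplus>\<^bsub>L\<^esub> x \<in> A"
      using lie_hom_eq_iff[OF L M f x] a AL ker by blast
    moreover have "(- 1) \<odot>\<^bsub>L\<^esub> a \<in> A" using A a(1) by (simp only: L.lie_ideal_iff)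
    ultimately show ?thesis
      using L.submodule_add_cancel_left[OF L.lie_ideal_submodule[OF A]] x by blast
  qed
  then show ?thesis using AL by auto
qed

text \<open>
  Both images are the quotient of \<open>L\<close> by the common kernel. Stated for two surjections, this makes
  \<open>lie_quotient\<close> one model among others: isomorphisms between quotients follow by comparing
  kernels, without any further computation with cosets.
\<close>

lemma lie_isomorphic_if_same_kernel:
  assumes L: "lie_algebra L" and M: "lie_algebra M" and P: "lie_algebra P"
    and f: "lie_hom L M f" and surj_f: "f ` carrier L = carrier M"
    and g: "lie_hom L P g" and surj_g: "g ` carrier L = carrier P"
    and ker: "lie_kernel L M f = lie_kernel L P g"
  shows "lie_isomorphic M P"
proof -
  interpret L: lie_algebra L by fact
  have eq: "f x = f y \<longleftrightarrow> g x = g y" if "x \<in> carrier L" "y \<in> carrier L" for x y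
    using that by (simp add: lie_hom_eq_iff[OF L M f] lie_hom_eq_iff[OF L P g] ker)
  define h where "h m = g (inv_into (carrier L) f m)" for m
  have h: "h (f x) = g x" if "x \<in> carrier L" for x
    unfolding h_def using that eq inv_into_into[of "f x" f "carrier L"] f_inv_into_f[of "f x" f "carrier L"]
    by blast
  have "lie_hom M P h"
    unfolding lie_hom_iff surj_f[symmetric]
  proof (intro conjI ballI allI)
    show "h \<in> f ` carrier L \<rightarrow> carrier P" using h surj_g by auto
    fix u assume "u \<in> f ` carrier L"
    then obtain x where x: "x \<in> carrier L" "u = f x" by blast
    show "h (c \<odot>\<^bsub>M\<^esub> u) = c \<odot>\<^bsub>P\<^esub> h u" for c
      using x f g h[of "c \<odot>\<^bsub>L\<^esub> x"] h[of x] by (simp add: lie_hom_iff)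
    fix v assume "v \<in> f ` carrier L"
    then obtain y where y: "y \<in> carrier L" "v = f y" by blast
    show "h (u \<oplus>\<^bsub>M\<^esub> v) = h u \<oplus>\<^bsub>P\<^esub> h v"
      using x y f g h[of "x \<oplus>\<^bsub>L\<^esub> y"] h[of x] h[of y] by (simp add: lie_hom_iff)
    show "h (u \<otimes>\<^bsub>M\<^esub> v) = h u \<otimes>\<^bsub>P\<^esub> h v"
      using x y f g h[of "x \<otimes>\<^bsub>L\<^esub> y"] h[of x] h[of y] L.bracket_closed by (simp add: lie_hom_iff)
  qed
  moreover have "bij_betw h (carrier M) (carrier P)"
    unfolding bij_betw_def surj_f[symmetric] surj_g[symmetric]
    using h eq by (auto simp: inj_on_def image_image)
  ultimately show ?thesis by (auto simp: lie_isomorphic_iff_hom)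
qed

lemma lie_isomorphic_refl: "lie_isomorphic L L"
  using lie_hom_id by (auto simp: lie_isomorphic_iff_hom)

lemma lie_isomorphic_trans:
  assumes LM: "lie_isomorphic L M" and MP: "lie_isomorphic M P" shows "lie_isomorphic L P"
proof -
  obtain f g where "lie_hom L M f" "bij_betw f (carrier L) (carrier M)"
      "lie_hom M P g" "bij_betw g (carrier M) (carrier P)"
    using LM MP by (auto simp: lie_isomorphic_iff_hom)
  then have "lie_hom L P (g \<circ> f)" "bij_betw (g \<circ> f) (carrier L) (carrier P)"
    by (auto intro: lie_hom_comp bij_betw_trans)
  then show ?thesis by (auto simp: lie_isomorphic_iff_hom)
qed

lemma lie_isomorphic_sym:
  assumes L: "lie_algebra L" and M: "lie_algebra M" and iso: "lie_isomorphic L M"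
  shows "lie_isomorphic M L"
proof -
  obtain f where f: "lie_hom L M f" "bij_betw f (carrier L) (carrier M)"
    using iso by (auto simp: lie_isomorphic_iff_hom)
  interpret L: lie_algebra L by fact
  have "lie_kernel L M f = lie_kernel L L id"
    using inj_on_eq_iff[of f "carrier L" _ "\<zero>\<^bsub>L\<^esub>"] f(2)
    by (auto simp: lie_kernel_def bij_betw_def simp flip: lie_hom_zero[OF L M f(1)])
  then show ?thesis
    using lie_isomorphic_if_same_kernel[OF L M L f(1) _ lie_hom_id] f(2) by (simp add: bij_betw_def)
qed

text \<open>
  The operations of \<open>lie_quotient\<close> are unions over representatives. As \<open>A\<close> is an ideal, all
  members of such a union are the same coset.
\<close>

lemma (in lie_algebra) lie_quotient_projection:
  assumes A: "lie_ideal L A"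
  shows "lie_hom L (lie_quotient L A) (\<lambda>x. A +>\<^bsub>L\<^esub> x)"
    and "(\<lambda>x. A +>\<^bsub>L\<^esub> x) ` carrier L = carrier (lie_quotient L A)"
    and "lie_kernel L (lie_quotient L A) (\<lambda>x. A +>\<^bsub>L\<^esub> x) = A"
proof -
  have AL: "\<And>a. a \<in> A \<Longrightarrow> a \<in> carrier L" using A by (auto simp: lie_ideal_iff)
  interpret A: abelian_subgroup A L
  proof (intro abelian_subgroupI3 additive_subgroup.intro M.add.subgroupI M.abelian_group_axioms)
    show "\<ominus>\<^bsub>L\<^esub> a \<in> A" if "a \<in> A" for a using submodule_minus[OF lie_ideal_submodule[OF A] that] .
  qed (use A in \<open>auto simp: lie_ideal_iff\<close>)
  have coset_mem: "u \<in> A +>\<^bsub>L\<^esub> x \<longleftrightarrow> (\<exists>a\<in>A. u = a \<oplus>\<^bsub>L\<^esub> x)" for u x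
    by (auto simp: a_r_coset_def')
  have coset: "A +>\<^bsub>L\<^esub> (a \<oplus>\<^bsub>L\<^esub> x) = A +>\<^bsub>L\<^esub> x" if "a \<in> A" "x \<in> carrier L" for a x
    using that by (intro M.a_repr_independence[symmetric] A.a_subgroup) (auto simp: coset_mem)
  have nonempty: "A +>\<^bsub>L\<^esub> x \<noteq> {}" if "x \<in> carrier L" for x using A.a_rcos_self[OF that] by blast
  show "(\<lambda>x. A +>\<^bsub>L\<^esub> x) ` carrier L = carrier (lie_quotient L A)"
    by (auto simp: lie_quotient_def A_RCOSETS_def')
  show "lie_hom L (lie_quotient L A) (\<lambda>x. A +>\<^bsub>L\<^esub> x)"
    unfolding lie_hom_iff
  proof (intro conjI ballI allI)
    show "(+>\<^bsub>L\<^esub>) A \<in> carrier L \<rightarrow> carrier (lie_quotient L A)"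
      by (auto simp: lie_quotient_def A_RCOSETS_def')
    fix x assume x: "x \<in> carrier L"
    show "A +>\<^bsub>L\<^esub> (c \<odot>\<^bsub>L\<^esub> x) = c \<odot>\<^bsub>lie_quotient L A\<^esub> (A +>\<^bsub>L\<^esub> x)" for c
    proof -
      have "A +>\<^bsub>L\<^esub> (c \<odot>\<^bsub>L\<^esub> u) = A +>\<^bsub>L\<^esub> (c \<odot>\<^bsub>L\<^esub> x)" if "u \<in> A +>\<^bsub>L\<^esub> x" for u
        using that x A AL coset by (auto simp: coset_mem smult_add lie_ideal_iff)
      then have "(\<Union>u\<in>A +>\<^bsub>L\<^esub> x. A +>\<^bsub>L\<^esub> (c \<odot>\<^bsub>L\<^esub> u)) = A +>\<^bsub>L\<^esub> (c \<odot>\<^bsub>L\<^esub> x)"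
        using nonempty[OF x] by (intro SUP_eq_const)
      then show ?thesis by (simp add: lie_quotient_def)
    qed
    fix y assume y: "y \<in> carrier L"
    show "A +>\<^bsub>L\<^esub> (x \<oplus>\<^bsub>L\<^esub> y) = (A +>\<^bsub>L\<^esub> x) \<oplus>\<^bsub>lie_quotient L A\<^esub> (A +>\<^bsub>L\<^esub> y)"
      using x y by (simp add: lie_quotient_def A.a_rcos_sum)
    have "A +>\<^bsub>L\<^esub> (u \<otimes>\<^bsub>L\<^esub> v) = A +>\<^bsub>L\<^esub> (x \<otimes>\<^bsub>L\<^esub> y)"
      if uv: "u \<in> A +>\<^bsub>L\<^esub> x" "v \<in> A +>\<^bsub>L\<^esub> y" for u v
    proof -
      obtain a b where a: "a \<in> A" "u = a \<oplus>\<^bsub>L\<^esub> x" and b: "b \<in> A" "v = b \<oplus>\<^bsub>L\<^esub> y"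
        using uv by (auto simp: coset_mem)
      have v: "v \<in> carrier L" using b y AL by simp
      have "u \<otimes>\<^bsub>L\<^esub> v = a \<otimes>\<^bsub>L\<^esub> v \<oplus>\<^bsub>L\<^esub> (x \<otimes>\<^bsub>L\<^esub> b \<oplus>\<^bsub>L\<^esub> x \<otimes>\<^bsub>L\<^esub> y)"
        using a b x y v AL by (simp add: bracket_add_left flip: bracket_add_right)
      moreover have "a \<otimes>\<^bsub>L\<^esub> v \<in> A" "x \<otimes>\<^bsub>L\<^esub> b \<in> A"
        using lie_ideal_right[OF A a(1) v] A b x by (auto simp: lie_ideal_iff)
      ultimately show ?thesis using coset bracket_closed[OF x y] AL by simp
    qed
    then have "(\<Union>u\<in>A +>\<^bsub>L\<^esub> x. \<Union>v\<in>A +>\<^bsub>L\<^esub> y. A +>\<^bsub>L\<^esub> (u \<otimes>\<^bsub>L\<^esub> v)) = A +>\<^bsub>L\<^esub> (x \<otimes>\<^bsub>L\<^esub> y)"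
      using nonempty[OF x] nonempty[OF y] by (intro SUP_eq_const) auto
    then show "A +>\<^bsub>L\<^esub> (x \<otimes>\<^bsub>L\<^esub> y) = (A +>\<^bsub>L\<^esub> x) \<otimes>\<^bsub>lie_quotient L A\<^esub> (A +>\<^bsub>L\<^esub> y)"
      by (simp add: lie_quotient_def rcoset_mult_def)
  qed
  have "A +>\<^bsub>L\<^esub> x = A \<longleftrightarrow> x \<in> A" if "x \<in> carrier L" for x
    using that A.a_rcos_self[of x] A.a_rcos_const[of x] by auto
  then show "lie_kernel L (lie_quotient L A) (\<lambda>x. A +>\<^bsub>L\<^esub> x) = A"
    using AL unfolding lie_kernel_def lie_quotient_def by (simp, blast)
qed

lemma lie_isomorphic_quotient_kernel:
  assumes L: "lie_algebra L" and M: "lie_algebra M"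
    and f: "lie_hom L M f" and surj: "f ` carrier L = carrier M"
  shows "lie_isomorphic (lie_quotient L (lie_kernel L M f)) M"
proof -
  interpret L: lie_algebra L by fact
  have A: "lie_ideal L (lie_kernel L M f)" by (rule lie_ideal_kernel[OF L M f])
  show ?thesis
    using lie_isomorphic_if_same_kernel[OF L L.lie_algebra_lie_quotient[OF A] M _ _ f surj]
      L.lie_quotient_projection[OF A] by blast
qed

section \<open>Chief factors and the nil radical\<close>

context lie_algebra
begin

lemma lie_algebra_restrict:
  assumes A: "submodule class_ring A L" and closed: "\<And>x y. \<lbrakk>x \<in> A; y \<in> A\<rbrakk> \<Longrightarrow> x \<otimes>\<^bsub>L\<^esub> y \<in> A"
  shows "lie_algebra (L\<lparr>carrier := A\<rparr>)"
proof -
  have AL: "\<And>a. a \<in> A \<Longrightarrow> a \<in> carrier L" using A by (auto simp: submodule_iff)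
  have "vectorspace class_ring (L\<lparr>carrier := A\<rparr>)"
    using subspace_is_vs A by (simp add: subspace_iff)
  then interpret A: field_vectorspace "L\<lparr>carrier := A\<rparr>" by (simp add: field_vectorspace_def)
  obtain \<Phi> where \<Phi>: "finite \<Phi>" "\<And>\<phi>. \<phi> \<in> \<Phi> \<Longrightarrow> linear_functional L \<phi>"
    "\<And>x. \<lbrakk>x \<in> carrier L; \<And>\<phi>. \<phi> \<in> \<Phi> \<Longrightarrow> \<phi> x = 0\<rbrakk> \<Longrightarrow> x = \<zero>\<^bsub>L\<^esub>"
    using finite_separating_functionals[OF finite_dimensional] by blast
  have "A.fin_dim"
    using \<Phi> AL by (intro A.fin_dim_if_separating[of \<Phi>]) (auto simp: linear_functional_def)
  then show ?thesis
    by unfold_locales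
       (use AL closed in \<open>auto simp: bracket_add_left bracket_add_right bracket_smult_left
          bracket_smult_right bracket_self jacobi\<close>)
qed

lemma bracket_in_bracket_space:
  assumes "A \<subseteq> carrier L" "B \<subseteq> carrier L" "a \<in> A" "b \<in> B"
  shows "a \<otimes>\<^bsub>L\<^esub> b \<in> bracket_space L A B"
proof -
  have "{a \<otimes>\<^bsub>L\<^esub> b | a b. a \<in> A \<and> b \<in> B} \<subseteq> carrier L" using assms bracket_closed by blast
  from in_own_span[OF this] show ?thesis using assms by (auto simp: bracket_space_def)
qed

lemma bracket_space_submodule:
  assumes "A \<subseteq> carrier L" "B \<subseteq> carrier L"
  shows "submodule class_ring (bracket_space L A B) L"
proof -
  have "{a \<otimes>\<^bsub>L\<^esub> b | a b. a \<in> A \<and> b \<in> B} \<subseteq> carrier L" using assms bracket_closed by blast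
  from span_is_submodule[OF this] show ?thesis by (simp add: bracket_space_def)
qed

lemma bracket_space_least:
  assumes "submodule class_ring N L" "\<And>a b. \<lbrakk>a \<in> A; b \<in> B\<rbrakk> \<Longrightarrow> a \<otimes>\<^bsub>L\<^esub> b \<in> N"
  shows "bracket_space L A B \<subseteq> N"
  unfolding bracket_space_def using assms by (intro span_is_subset) auto

lemma lower_central_series_submodule: "submodule class_ring (lower_central_series L n) L"
proof (induction n)
  case 0
  then show ?case by (simp add: submodule_iff)
next
  case (Suc n)
  then have "lower_central_series L n \<subseteq> carrier L" by (simp add: submodule_iff)
  then show ?case by (simp add: bracket_space_submodule)
qed

lemma lie_ideal_factor_centraliser:
  assumes H: "lie_ideal L H" and K: "lie_ideal L K"
  shows "lie_ideal L (factor_centraliser L H K)"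
  unfolding lie_ideal_iff
proof (intro conjI ballI allI)
  have HL: "\<And>h. h \<in> H \<Longrightarrow> h \<in> carrier L" and KL: "\<And>k. k \<in> K \<Longrightarrow> k \<in> carrier L"
    using H K by (auto simp: lie_ideal_iff)
  show "factor_centraliser L H K \<subseteq> carrier L" by (auto simp: factor_centraliser_def)
  show "\<zero>\<^bsub>L\<^esub> \<in> factor_centraliser L H K" using HL K by (auto simp: factor_centraliser_def lie_ideal_iff)
  fix x assume x: "x \<in> factor_centraliser L H K"
  show "c \<odot>\<^bsub>L\<^esub> x \<in> factor_centraliser L H K" for c
    using x K HL by (auto simp: factor_centraliser_def bracket_smult_left lie_ideal_iff)
  show "x \<oplus>\<^bsub>L\<^esub> y \<in> factor_centraliser L H K" if "y \<in> factor_centraliser L H K" for y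
    using x that K HL by (auto simp: factor_centraliser_def bracket_add_left lie_ideal_iff)
next
  have HL: "\<And>h. h \<in> H \<Longrightarrow> h \<in> carrier L" using H by (auto simp: lie_ideal_iff)
  fix z x assume z: "z \<in> carrier L" and x: "x \<in> factor_centraliser L H K"
  have xL: "x \<in> carrier L" and xh: "\<And>h. h \<in> H \<Longrightarrow> x \<otimes>\<^bsub>L\<^esub> h \<in> K"
    using x by (auto simp: factor_centraliser_def)
  have "(z \<otimes>\<^bsub>L\<^esub> x) \<otimes>\<^bsub>L\<^esub> h \<in> K" if h: "h \<in> H" for h
  proof (rule submodule_add_cancel_left[OF lie_ideal_submodule[OF K]])
    show "x \<otimes>\<^bsub>L\<^esub> (z \<otimes>\<^bsub>L\<^esub> h) \<in> K" using xh H z h by (simp add: lie_ideal_iff)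
    have "x \<otimes>\<^bsub>L\<^esub> (z \<otimes>\<^bsub>L\<^esub> h) \<oplus>\<^bsub>L\<^esub> (z \<otimes>\<^bsub>L\<^esub> x) \<otimes>\<^bsub>L\<^esub> h = z \<otimes>\<^bsub>L\<^esub> (x \<otimes>\<^bsub>L\<^esub> h)"
      using bracket_derivation[OF z xL HL[OF h]] z xL h HL by (simp add: M.a_comm bracket_closed)
    then show "x \<otimes>\<^bsub>L\<^esub> (z \<otimes>\<^bsub>L\<^esub> h) \<oplus>\<^bsub>L\<^esub> (z \<otimes>\<^bsub>L\<^esub> x) \<otimes>\<^bsub>L\<^esub> h \<in> K"
      using xh h K z by (simp add: lie_ideal_iff)
  qed (use z xL HL h bracket_closed in auto)
  then show "z \<otimes>\<^bsub>L\<^esub> x \<in> factor_centraliser L H K"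
    using z xL by (simp add: factor_centraliser_def bracket_closed)
qed

end

definition chief_centraliser :: "('f::field, 'a) module \<Rightarrow> 'a set" where
  "chief_centraliser L =
     {x \<in> carrier L. \<forall>H K. chief_factor L H K \<longrightarrow> x \<in> factor_centraliser L H K}"

context lie_algebra
begin

lemma lie_ideal_chief_centraliser: "lie_ideal L (chief_centraliser L)"
proof -
  have "lie_ideal L (factor_centraliser L H K)" if "chief_factor L H K" for H K
    using that by (simp add: chief_factor_def lie_ideal_factor_centraliser)
  then show ?thesis
    unfolding lie_ideal_iff chief_centraliser_def by (auto simp: bracket_closed)
qed

text \<open>
  Below a nonzero ideal \<open>H\<close>, an ideal \<open>K\<close> maximal among those properly contained in \<open>H\<close> gives a chief factor
  \<open>H/K\<close>. Induction on the rank thus climbs a chief series step by step, without constructing the series.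
\<close>

lemma lie_ideal_chief_induct [consumes 1, case_names zero chief]:
  assumes "lie_ideal L H" and zero: "P {\<zero>\<^bsub>L\<^esub>}"
    and chief: "\<And>H K. \<lbrakk>chief_factor L H K; P K\<rbrakk> \<Longrightarrow> P H"
  shows "P H"
proof -
  obtain r :: "'a set \<Rightarrow> nat" where
    r: "\<And>A B. \<lbrakk>lie_ideal L A; lie_ideal L B; A \<subset> B\<rbrakk> \<Longrightarrow> r A < r B"
    using lie_ideal_rank by blast
  from assms(1) show ?thesis
  proof (induction "r H" arbitrary: H rule: less_induct)
    case less
    show ?case
    proof (cases "H = {\<zero>\<^bsub>L\<^esub>}")
      case True
      then show ?thesis using zero by simp
    next
      case False
      define Q where "Q K \<longleftrightarrow> lie_ideal L K \<and> K \<subset> H" for K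
      have "Q {\<zero>\<^bsub>L\<^esub>}" using False less.prems by (auto simp: Q_def lie_ideal_zero lie_ideal_iff)
      moreover have "\<forall>K. Q K \<longrightarrow> r K < r H" using r less.prems by (simp add: Q_def)
      ultimately obtain K where K: "Q K" and max: "\<And>K'. Q K' \<Longrightarrow> r K' \<le> r K"
        using ex_has_greatest_nat[of Q _ r "r H"] by blast
      have "False" if "lie_ideal L J" "K \<subset> J" "J \<subset> H" for J
        using max[of J] r[of K J] K that by (simp add: Q_def)
      then have "chief_factor L H K"
        unfolding chief_factor_def using K less.prems by (auto simp: Q_def)
      moreover have "P K" using less.hyps[of K] K r less.prems by (simp add: Q_def)
      ultimately show ?thesis by (rule chief)
    qed
  qed
qed

text \<open>
  The part \<open>Z/K\<close> of \<open>H/K\<close> that is annihilated by \<open>A\<close> is an ideal of \<open>L/K\<close>, hence everything or zero. In the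
  second case no element of \<open>H\<close> outside \<open>K\<close> is annihilated modulo \<open>K\<close>. As the lower central series of \<open>A\<close> ends in
  zero, its terms then meet \<open>H\<close> inside \<open>K\<close>, one after the other from the last up to \<open>A\<close> itself. So \<open>[A, H]\<close>
  lies in \<open>A \<inter> H \<subseteq> K\<close>, and \<open>Z\<close> is everything after all.
\<close>

lemma nilpotent_ideal_subset_factor_centraliser:
  assumes A: "nilpotent_ideal L A" and HK: "chief_factor L H K"
  shows "A \<subseteq> factor_centraliser L H K"
proof -
  have H: "lie_ideal L H" and K: "lie_ideal L K" and KH: "K \<subseteq> H"
    and none: "\<And>J. \<lbrakk>lie_ideal L J; K \<subseteq> J; J \<subseteq> H\<rbrakk> \<Longrightarrow> J = K \<or> J = H"
    using HK by (auto simp: chief_factor_def)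
  have iA: "lie_ideal L A" using A by (simp add: nilpotent_ideal_def)
  have AL: "\<And>a. a \<in> A \<Longrightarrow> a \<in> carrier L" and HL: "\<And>h. h \<in> H \<Longrightarrow> h \<in> carrier L"
    using iA H by (auto simp: lie_ideal_iff)
  let ?A = "L\<lparr>carrier := A\<rparr>"
  interpret A: lie_algebra ?A
    using lie_ideal_submodule[OF iA] iA AL by (intro lie_algebra_restrict) (auto simp: lie_ideal_iff)
  obtain n where n: "lower_central_series ?A n = {\<zero>\<^bsub>L\<^esub>}"
    using A by (auto simp: nilpotent_ideal_def nilpotent_def)
  define Z where "Z = {h \<in> H. \<forall>a\<in>A. a \<otimes>\<^bsub>L\<^esub> h \<in> K}"
  have "lie_ideal L Z"
    unfolding lie_ideal_iff
  proof (intro conjI ballI allI)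
    show "Z \<subseteq> carrier L" using HL by (auto simp: Z_def)
    show "\<zero>\<^bsub>L\<^esub> \<in> Z" using H K AL by (auto simp: Z_def lie_ideal_iff)
    fix h assume h: "h \<in> Z"
    show "c \<odot>\<^bsub>L\<^esub> h \<in> Z" for c
      using h H K AL HL by (auto simp: Z_def lie_ideal_iff bracket_smult_right)
    show "h \<oplus>\<^bsub>L\<^esub> k \<in> Z" if "k \<in> Z" for k
      using h that H K AL HL by (auto simp: Z_def lie_ideal_iff bracket_add_right)
  next
    fix x h assume x: "x \<in> carrier L" and h: "h \<in> Z"
    have hH: "h \<in> H" and hZ: "\<And>a. a \<in> A \<Longrightarrow> a \<otimes>\<^bsub>L\<^esub> h \<in> K" using h by (auto simp: Z_def)
    have "a \<otimes>\<^bsub>L\<^esub> (x \<otimes>\<^bsub>L\<^esub> h) \<in> K" if a: "a \<in> A" for a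
    proof -
      have "(a \<otimes>\<^bsub>L\<^esub> x) \<otimes>\<^bsub>L\<^esub> h \<in> K" using hZ lie_ideal_right[OF iA a x] by blast
      moreover have "x \<otimes>\<^bsub>L\<^esub> (a \<otimes>\<^bsub>L\<^esub> h) \<in> K" using hZ[OF a] K x by (simp add: lie_ideal_iff)
      ultimately show ?thesis
        using bracket_derivation[OF AL[OF a] x HL[OF hH]] K by (simp add: lie_ideal_iff)
    qed
    then show "x \<otimes>\<^bsub>L\<^esub> h \<in> Z" using H x hH by (simp add: Z_def lie_ideal_iff)
  qed
  moreover have "K \<subseteq> Z" using K KH AL by (auto simp: Z_def lie_ideal_iff)
  moreover have "Z \<subseteq> H" by (auto simp: Z_def)
  ultimately have "Z = K \<or> Z = H" by (intro none)
  moreover have "Z = H" if ZK: "Z = K"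
  proof -
    have down: "lower_central_series ?A m \<inter> H \<subseteq> K"
      if suc: "lower_central_series ?A (Suc m) \<inter> H \<subseteq> K" for m
    proof
      fix h assume h: "h \<in> lower_central_series ?A m \<inter> H"
      have lcs: "lower_central_series ?A m \<subseteq> A"
        using A.lower_central_series_submodule[of m] by (simp add: A.submodule_iff)
      have "a \<otimes>\<^bsub>L\<^esub> h \<in> K" if a: "a \<in> A" for a
      proof -
        have "a \<otimes>\<^bsub>L\<^esub> h \<in> lower_central_series ?A (Suc m)"
          using A.bracket_in_bracket_space[of A "lower_central_series ?A m" a h] a h lcs by simp
        moreover have "a \<otimes>\<^bsub>L\<^esub> h \<in> H" using H a AL h by (auto simp: lie_ideal_iff)
        ultimately show ?thesis using suc by blast
      qed
      then have "h \<in> Z" using h by (auto simp: Z_def)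
      then show "h \<in> K" using ZK by simp
    qed
    have "lower_central_series ?A n \<inter> H \<subseteq> K" using n K by (auto simp: lie_ideal_iff)
    then have "lower_central_series ?A 0 \<inter> H \<subseteq> K"
      using down by (induction n) blast+
    then have AH: "A \<inter> H \<subseteq> K" by simp
    have "a \<otimes>\<^bsub>L\<^esub> h \<in> K" if "a \<in> A" "h \<in> H" for a h
      using AH that lie_ideal_right[OF iA, of a h] HL H AL by (auto simp: lie_ideal_iff)
    then show ?thesis by (auto simp: Z_def)
  qed
  ultimately have "Z = H" by blast
  then show ?thesis using AL by (auto simp: factor_centraliser_def Z_def)
qed

text \<open>
  Bracketing with \<open>J\<close> maps the top \<open>H\<close> of a chief factor into its bottom \<open>K\<close>. So each step of the lower central
  series of \<open>J\<close> descends at least one step in a chief series of \<open>L\<close>.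
\<close>

lemma nilpotent_ideal_chief_centraliser: "nilpotent_ideal L (chief_centraliser L)"
proof -
  let ?J = "chief_centraliser L"
  let ?LJ = "L\<lparr>carrier := ?J\<rparr>"
  have J: "lie_ideal L ?J" by (rule lie_ideal_chief_centraliser)
  have JL: "\<And>x. x \<in> ?J \<Longrightarrow> x \<in> carrier L" by (simp add: chief_centraliser_def)
  interpret J: lie_algebra ?LJ
    using lie_ideal_submodule[OF J] J JL by (intro lie_algebra_restrict) (auto simp: lie_ideal_iff)
  have "\<forall>n. lower_central_series ?LJ n \<subseteq> H \<longrightarrow> (\<exists>m. lower_central_series ?LJ m = {\<zero>\<^bsub>L\<^esub>})"
    if "lie_ideal L H" for H
    using that
  proof (induction rule: lie_ideal_chief_induct)
    case zero
    have "\<zero>\<^bsub>L\<^esub> \<in> lower_central_series ?LJ n" for n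
      using J.lower_central_series_submodule[of n] by (simp add: J.submodule_iff)
    then show ?case by blast
  next
    case (chief H K)
    have HK: "lie_ideal L H" "lie_ideal L K" using chief by (auto simp: chief_factor_def)
    have "lower_central_series ?LJ (Suc n) \<subseteq> K" if n: "lower_central_series ?LJ n \<subseteq> H" for n
    proof -
      have "submodule class_ring (K \<inter> ?J) ?LJ"
        using HK J by (auto simp: J.submodule_iff lie_ideal_iff)
      moreover have "a \<otimes>\<^bsub>L\<^esub> b \<in> K \<inter> ?J" if "a \<in> ?J" "b \<in> lower_central_series ?LJ n" for a b
      proof -
        have "a \<in> factor_centraliser L H K" using that chief by (auto simp: chief_centraliser_def)
        moreover have "b \<in> ?J"
          using that J.lower_central_series_submodule[of n] by (auto simp: J.submodule_iff)
        ultimately show ?thesis using that n J.bracket_closed[of a b] by (auto simp: factor_centraliser_def)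
      qed
      ultimately show ?thesis
        using J.bracket_space_least[of "K \<inter> ?J" ?J "lower_central_series ?LJ n"] by simp
    qed
    then show ?case using chief.IH by blast
  qed
  moreover have "lower_central_series ?LJ 0 \<subseteq> carrier L" using JL by auto
  ultimately obtain m where "lower_central_series ?LJ m = {\<zero>\<^bsub>L\<^esub>}"
    using lie_ideal_carrier by blast
  then have "nilpotent ?LJ" unfolding nilpotent_def by (intro exI[of _ m]) simp
  then show ?thesis using J by (simp add: nilpotent_ideal_def)
qed

text \<open>
  The two preceding lemmas say that \<open>chief_centraliser L\<close> is a nilpotent ideal and contains
  every other one. In particular a largest nilpotent ideal exists, as the definite description
  in \<open>nil_radical\<close> presupposes.
\<close>

theorem nil_radical_eq_chief_centraliser: "nil_radical L = chief_centraliser L"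
proof -
  have "A \<subseteq> chief_centraliser L" if "nilpotent_ideal L A" for A
    using that nilpotent_ideal_subset_factor_centraliser[OF that]
    by (auto simp: chief_centraliser_def nilpotent_ideal_def lie_ideal_iff)
  then show ?thesis
    unfolding nil_radical_def using nilpotent_ideal_chief_centraliser by (intro the_equality) auto
qed

lemma nilpotent_ideal_if_abelian:
  assumes A: "lie_ideal L A" and abelian: "\<And>a b. \<lbrakk>a \<in> A; b \<in> A\<rbrakk> \<Longrightarrow> a \<otimes>\<^bsub>L\<^esub> b = \<zero>\<^bsub>L\<^esub>"
  shows "nilpotent_ideal L A"
proof -
  let ?A = "L\<lparr>carrier := A\<rparr>"
  interpret A: lie_algebra ?A
    using lie_ideal_submodule[OF A] A by (intro lie_algebra_restrict) (auto simp: lie_ideal_iff)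
  have "lower_central_series ?A 1 \<subseteq> {\<zero>\<^bsub>L\<^esub>}"
    using A.bracket_space_least[of "{\<zero>\<^bsub>L\<^esub>}" A A] abelian A.lie_ideal_submodule[OF A.lie_ideal_zero] by simp
  moreover have "\<zero>\<^bsub>L\<^esub> \<in> lower_central_series ?A 1"
    using A.lower_central_series_submodule[of 1] by (simp add: A.submodule_iff)
  ultimately have "lower_central_series ?A 1 = {\<zero>\<^bsub>?A\<^esub>}" by auto
  then have "nilpotent ?A" unfolding nilpotent_def by blast
  then show ?thesis using A by (simp add: nilpotent_ideal_def)
qed

end

text \<open>
  Along a surjection the ideals of the image correspond to the ideals that contain the kernel, and the
  preimage of the lower ideal \<open>K\<close> contains it.
\<close>

lemma chief_factor_vimage:
  assumes L: "lie_algebra L" and M: "lie_algebra M" and f: "lie_hom L M f"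
    and surj: "f ` carrier L = carrier M" and HK: "chief_factor M H K"
  shows "chief_factor L {x \<in> carrier L. f x \<in> H} {x \<in> carrier L. f x \<in> K}"
proof -
  interpret L: lie_algebra L by fact
  interpret M: lie_algebra M by fact
  let ?pre = "\<lambda>B. {x \<in> carrier L. f x \<in> B}"
  have H: "lie_ideal M H" and K: "lie_ideal M K" and KH: "K \<subset> H"
    and none: "\<And>J. \<lbrakk>lie_ideal M J; K \<subseteq> J; J \<subseteq> H\<rbrakk> \<Longrightarrow> J = K \<or> J = H"
    using HK by (auto simp: chief_factor_def)
  have image: "f ` ?pre B = B" if "lie_ideal M B" for B
  proof (intro equalityI subsetI)
    fix b assume b: "b \<in> B"
    then have "b \<in> f ` carrier L" using that unfolding surj M.lie_ideal_iff by blast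
    then show "b \<in> f ` ?pre B" using b by blast
  qed auto
  have False if J: "lie_ideal L J" "?pre K \<subset> J" "J \<subset> ?pre H" for J
  proof -
    have "lie_ideal M (f ` J)" by (rule lie_ideal_image[OF L M f surj J(1)])
    moreover have "K \<subseteq> f ` J" "f ` J \<subseteq> H" using J image[OF K] by blast+
    ultimately have "f ` J = K \<or> f ` J = H" by (intro none)
    moreover have "lie_kernel L M f \<subseteq> ?pre K" using K by (auto simp: lie_kernel_def M.lie_ideal_iff)
    then have "?pre (f ` J) = J" using J by (intro vimage_image_lie_ideal[OF L M f]) auto
    ultimately show False using J by auto
  qed
  moreover have "?pre K \<subset> ?pre H" using KH image[OF H] image[OF K] by blast
  ultimately show ?thesis
    unfolding chief_factor_def using lie_ideal_vimage[OF L M f] H K by blast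
qed

lemma chief_centraliser_image:
  assumes L: "lie_algebra L" and M: "lie_algebra M" and f: "lie_hom L M f"
    and surj: "f ` carrier L = carrier M"
  shows "f ` chief_centraliser L \<subseteq> chief_centraliser M"
proof (intro image_subsetI)
  interpret M: lie_algebra M by fact
  fix x assume x: "x \<in> chief_centraliser L"
  have "f x \<in> factor_centraliser M H K" if HK: "chief_factor M H K" for H K
  proof -
    have HM: "H \<subseteq> carrier M" using HK by (auto simp: chief_factor_def M.lie_ideal_iff)
    have "x \<in> factor_centraliser L {x \<in> carrier L. f x \<in> H} {x \<in> carrier L. f x \<in> K}"
      using x chief_factor_vimage[OF L M f surj HK] by (simp add: chief_centraliser_def)
    then have *: "x \<in> carrier L" "\<And>y. y \<in> carrier L \<Longrightarrow> f y \<in> H \<Longrightarrow> f x \<otimes>\<^bsub>M\<^esub> f y \<in> K"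
      using f by (auto simp: factor_centraliser_def lie_hom_iff)
    have "f x \<otimes>\<^bsub>M\<^esub> h \<in> K" if h: "h \<in> H" for h
    proof -
      obtain y where "y \<in> carrier L" "h = f y" using h HM surj by blast
      then show ?thesis using * h by blast
    qed
    then show ?thesis using * surj by (auto simp: factor_centraliser_def)
  qed
  then show "f x \<in> chief_centraliser M"
    using x surj by (auto simp: chief_centraliser_def)
qed

section \<open>Coinduced representations in nonzero characteristic\<close>

definition scale_fun :: "'f::field \<Rightarrow> ('x \<Rightarrow> 'f) \<Rightarrow> 'x \<Rightarrow> 'f" where
  "scale_fun c w = (\<lambda>s. c * w s)"

lemma scale_fun_apply [simp]: "scale_fun c w s = c * w s"
  by (simp add: scale_fun_def)

lemma scale_fun_add: "scale_fun c (v + w) = scale_fun c v + scale_fun c w"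
  by (rule ext) (simp add: algebra_simps)

text \<open>
  A finite-dimensional representation of a subalgebra \<open>B\<close> of \<open>L\<close>. The representation space consists of functions
  on \<open>nat\<close>, so that it keeps the same type when a space of sequences is formed; \<open>W_finite\<close>
  expresses its finite dimension by finitely many coordinates that determine each element.
\<close>

locale lie_representation = lie_algebra L
  for L :: "('f::field, 'a) module" +
  fixes B :: "'a set" and W :: "(nat \<Rightarrow> 'f) set" and \<rho> :: "'a \<Rightarrow> (nat \<Rightarrow> 'f) \<Rightarrow> nat \<Rightarrow> 'f"
  assumes B: "submodule class_ring B L"
    and B_bracket: "\<lbrakk>x \<in> B; y \<in> B\<rbrakk> \<Longrightarrow> x \<otimes>\<^bsub>L\<^esub> y \<in> B"
    and W_zero: "0 \<in> W"
    and W_add: "\<lbrakk>v \<in> W; w \<in> W\<rbrakk> \<Longrightarrow> v + w \<in> W"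
    and W_scale: "w \<in> W \<Longrightarrow> scale_fun c w \<in> W"
    and W_finite: "\<exists>S. finite S \<and> (\<forall>w\<in>W. (\<forall>s\<in>S. w s = 0) \<longrightarrow> w = 0)"
    and act_mem: "\<lbrakk>x \<in> B; w \<in> W\<rbrakk> \<Longrightarrow> \<rho> x w \<in> W"
    and act_add: "\<lbrakk>x \<in> B; v \<in> W; w \<in> W\<rbrakk> \<Longrightarrow> \<rho> x (v + w) = \<rho> x v + \<rho> x w"
    and act_scale: "\<lbrakk>x \<in> B; w \<in> W\<rbrakk> \<Longrightarrow> \<rho> x (scale_fun c w) = scale_fun c (\<rho> x w)"
    and add_act: "\<lbrakk>x \<in> B; y \<in> B; w \<in> W\<rbrakk> \<Longrightarrow> \<rho> (x \<oplus>\<^bsub>L\<^esub> y) w = \<rho> x w + \<rho> y w"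
    and smult_act: "\<lbrakk>x \<in> B; w \<in> W\<rbrakk> \<Longrightarrow> \<rho> (c \<odot>\<^bsub>L\<^esub> x) w = scale_fun c (\<rho> x w)"
    and bracket_act: "\<lbrakk>x \<in> B; y \<in> B; w \<in> W\<rbrakk> \<Longrightarrow>
      \<rho> (x \<otimes>\<^bsub>L\<^esub> y) w = \<rho> x (\<rho> y w) - \<rho> y (\<rho> x w)"

text \<open>
  Pascal's rule, in the shape of the Leibniz formula for moving \<open>n\<close> factors \<open>y\<close> past an element of \<open>B\<close>: each
  factor either passes, which raises \<open>b\<close>, or is absorbed by \<open>ad y\<close>, which raises \<open>a\<close>.
\<close>

lemma binomial_of_recurrence:
  fixes X :: "nat \<Rightarrow> nat \<Rightarrow> nat \<Rightarrow> 'f::comm_ring_1"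
  assumes "\<And>n a b. X (Suc n) a b = X n a (Suc b) + X n (Suc a) b"
  shows "X n a b = (\<Sum>j\<le>n. of_nat (n choose j) * X 0 (a + j) (b + (n - j)))"
proof (induction n arbitrary: a b)
  case 0
  then show ?case by simp
next
  case (Suc n)
  let ?T = "\<lambda>j. X 0 (a + j) (b + (Suc n - j))"
  have "X (Suc n) a b = (\<Sum>j\<le>n. of_nat (n choose j) * ?T j) + (\<Sum>j\<le>n. of_nat (n choose j) * ?T (Suc j))"
    unfolding assms Suc by (intro arg_cong2[of _ _ _ _ "(+)"] sum.cong) (simp_all add: Suc_diff_le)
  also have "(\<Sum>j\<le>n. of_nat (n choose j) * ?T j) = (\<Sum>j\<le>Suc n. of_nat (n choose j) * ?T j)"
    by (simp add: binomial_eq_0)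
  also have "\<dots> = ?T 0 + (\<Sum>j\<le>n. of_nat (n choose Suc j) * ?T (Suc j))"
    by (subst sum.atMost_Suc_shift) simp
  also have "\<dots> + (\<Sum>j\<le>n. of_nat (n choose j) * ?T (Suc j)) =
      ?T 0 + (\<Sum>j\<le>n. of_nat (Suc n choose Suc j) * ?T (Suc j))"
    by (simp add: sum.distrib algebra_simps)
  also have "\<dots> = (\<Sum>j\<le>Suc n. of_nat (Suc n choose j) * ?T j)"
    by (subst sum.atMost_Suc_shift) simp
  finally show ?case .
qed

lemma binomial_of_recurrence_CHAR:
  fixes X :: "nat \<Rightarrow> nat \<Rightarrow> nat \<Rightarrow> 'f::field"
  assumes "CHAR('f) \<noteq> 0" and rec: "\<And>n a b. X (Suc n) a b = X n a (Suc b) + X n (Suc a) b"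
  shows "X CHAR('f) a b = X 0 a (b + CHAR('f)) + X 0 (a + CHAR('f)) b"
proof -
  let ?p = "CHAR('f)"
  let ?t = "\<lambda>j. of_nat (?p choose j) * X 0 (a + j) (b + (?p - j))"
  have "X ?p a b = (\<Sum>j\<le>?p. ?t j)" by (rule binomial_of_recurrence[of X, OF rec])
  also have "\<dots> = (\<Sum>j\<in>{0, ?p}. ?t j)"
    using CHAR_prime_choose[OF assms(1)] by (intro sum.mono_neutral_right) auto
  also have "\<dots> = ?t 0 + ?t ?p" using assms(1) by simp
  finally show ?thesis by simp
qed

text \<open>
  A sequence \<open>F\<close> stands for the \<open>B\<close>-linear map from the enveloping algebra of \<open>B + F y\<close> to \<open>W\<close> that takes \<open>y\<^bsup>i\<^esup>\<close>
  to \<open>F i\<close>. An element \<open>x\<close> of \<open>B\<close> acts on such maps by right multiplication of the argument, and \<open>\<delta>\<close> is \<open>ad y\<close>.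
  The two equations evaluate the result at \<open>y\<^bsup>i\<^esup>\<close> and express \<open>y\<^bsup>i+1\<^esup>x = y\<^bsup>i\<^esup>x y + y\<^bsup>i\<^esup>\<delta>(x)\<close>.
\<close>

primrec coinduced_action :: "('a \<Rightarrow> (nat \<Rightarrow> 'f::field) \<Rightarrow> nat \<Rightarrow> 'f) \<Rightarrow> ('a \<Rightarrow> 'a) \<Rightarrow>
    nat \<Rightarrow> 'a \<Rightarrow> (nat \<Rightarrow> nat \<Rightarrow> 'f) \<Rightarrow> nat \<Rightarrow> 'f" where
  "coinduced_action \<rho> \<delta> 0 x F = \<rho> x (F 0)"
| "coinduced_action \<rho> \<delta> (Suc i) x F =
     coinduced_action \<rho> \<delta> i x (\<lambda>j. F (Suc j)) + coinduced_action \<rho> \<delta> i (\<delta> x) F"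

locale coinduction = lie_representation L B W \<rho>
  for L :: "('f::field, 'a) module" and B W \<rho> +
  fixes y :: 'a
  assumes y: "y \<in> carrier L" and y_bracket: "x \<in> B \<Longrightarrow> y \<otimes>\<^bsub>L\<^esub> x \<in> B"
begin

definition \<delta> :: "'a \<Rightarrow> 'a" where "\<delta> x = y \<otimes>\<^bsub>L\<^esub> x"

abbreviation co :: "nat \<Rightarrow> 'a \<Rightarrow> (nat \<Rightarrow> nat \<Rightarrow> 'f) \<Rightarrow> nat \<Rightarrow> 'f" where
  "co \<equiv> coinduced_action \<rho> \<delta>"

lemma BL: "x \<in> B \<Longrightarrow> x \<in> carrier L" using B by (auto simp: submodule_iff)

lemma B_add: "\<lbrakk>x \<in> B; z \<in> B\<rbrakk> \<Longrightarrow> x \<oplus>\<^bsub>L\<^esub> z \<in> B" using B by (simp add: submodule_iff)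

lemma B_smult: "x \<in> B \<Longrightarrow> c \<odot>\<^bsub>L\<^esub> x \<in> B" using B by (simp add: submodule_iff)

lemma \<delta>_mem: "x \<in> B \<Longrightarrow> \<delta> x \<in> B"
  by (simp add: \<delta>_def y_bracket)

lemma \<delta>_add: "\<lbrakk>x \<in> carrier L; z \<in> carrier L\<rbrakk> \<Longrightarrow> \<delta> (x \<oplus>\<^bsub>L\<^esub> z) = \<delta> x \<oplus>\<^bsub>L\<^esub> \<delta> z"
  by (simp add: \<delta>_def bracket_add_right y)

lemma \<delta>_smult: "x \<in> carrier L \<Longrightarrow> \<delta> (c \<odot>\<^bsub>L\<^esub> x) = c \<odot>\<^bsub>L\<^esub> \<delta> x"
  by (simp add: \<delta>_def bracket_smult_right y)

lemma \<delta>_bracket: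
  "\<lbrakk>x \<in> carrier L; z \<in> carrier L\<rbrakk> \<Longrightarrow> \<delta> (x \<otimes>\<^bsub>L\<^esub> z) = \<delta> x \<otimes>\<^bsub>L\<^esub> z \<oplus>\<^bsub>L\<^esub> x \<otimes>\<^bsub>L\<^esub> \<delta> z"
  unfolding \<delta>_def by (rule bracket_derivation[OF y])

lemma \<delta>_pow_mem: "x \<in> B \<Longrightarrow> (\<delta> ^^ n) x \<in> B"
  by (induction n) (simp_all add: \<delta>_mem)

lemma \<delta>_pow_add: "\<lbrakk>x \<in> B; z \<in> B\<rbrakk> \<Longrightarrow> (\<delta> ^^ n) (x \<oplus>\<^bsub>L\<^esub> z) = (\<delta> ^^ n) x \<oplus>\<^bsub>L\<^esub> (\<delta> ^^ n) z"
  by (induction n) (simp_all add: \<delta>_add BL \<delta>_pow_mem)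

lemma \<delta>_pow_smult: "x \<in> B \<Longrightarrow> (\<delta> ^^ n) (c \<odot>\<^bsub>L\<^esub> x) = c \<odot>\<^bsub>L\<^esub> (\<delta> ^^ n) x"
  by (induction n) (simp_all add: \<delta>_smult BL \<delta>_pow_mem)

text \<open>
  In the next lemmas vectors are added as elements of an abelian group. Pointwise evaluation would keep
  the induction hypotheses from matching.
\<close>

declare plus_fun_apply [simp del] minus_apply [simp del] scale_fun_apply [simp del]

lemma co_mem: "\<lbrakk>x \<in> B; \<And>j. F j \<in> W\<rbrakk> \<Longrightarrow> co i x F \<in> W"
  by (induction i arbitrary: x F) (simp_all add: act_mem W_add \<delta>_mem)

lemma co_add:
  "\<lbrakk>x \<in> B; \<And>j. F j \<in> W; \<And>j. G j \<in> W\<rbrakk> \<Longrightarrow> co i x (\<lambda>j. F j + G j) = co i x F + co i x G"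
  by (induction i arbitrary: x F G) (simp_all add: act_add \<delta>_mem algebra_simps)

lemma co_scale:
  "\<lbrakk>x \<in> B; \<And>j. F j \<in> W\<rbrakk> \<Longrightarrow> co i x (\<lambda>j. scale_fun c (F j)) = scale_fun c (co i x F)"
  by (induction i arbitrary: x F) (simp_all add: act_scale \<delta>_mem scale_fun_add)

lemma add_co:
  "\<lbrakk>x \<in> B; z \<in> B; \<And>j. F j \<in> W\<rbrakk> \<Longrightarrow> co i (x \<oplus>\<^bsub>L\<^esub> z) F = co i x F + co i z F"
  by (induction i arbitrary: x z F)
     (simp_all add: add_act \<delta>_mem \<delta>_add BL algebra_simps)

lemma smult_co:
  "\<lbrakk>x \<in> B; \<And>j. F j \<in> W\<rbrakk> \<Longrightarrow> co i (c \<odot>\<^bsub>L\<^esub> x) F = scale_fun c (co i x F)"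
  by (induction i arbitrary: x F)
     (simp_all add: smult_act \<delta>_mem \<delta>_smult BL scale_fun_add)

text \<open>
  The elements of \<open>B\<close> act compatibly with the bracket because \<open>\<delta>\<close> is a derivation: one step of the recursion
  turns the claim for \<open>x\<close>, \<open>z\<close> into the claims for \<open>x\<close>, \<open>z\<close>, for \<open>\<delta> x\<close>, \<open>z\<close> and for \<open>x\<close>, \<open>\<delta> z\<close>.
\<close>

lemma bracket_co:
  "\<lbrakk>x \<in> B; z \<in> B; \<And>j. F j \<in> W\<rbrakk> \<Longrightarrow>
     co i (x \<otimes>\<^bsub>L\<^esub> z) F = co i x (\<lambda>j. co j z F) - co i z (\<lambda>j. co j x F)"
proof (induction i arbitrary: x z F)
  case 0
  then show ?case by (simp add: bracket_act)
next
  case (Suc i)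
  let ?E = "\<lambda>j. F (Suc j)"
  have "\<delta> (x \<otimes>\<^bsub>L\<^esub> z) = \<delta> x \<otimes>\<^bsub>L\<^esub> z \<oplus>\<^bsub>L\<^esub> x \<otimes>\<^bsub>L\<^esub> \<delta> z"
    using Suc.prems by (intro \<delta>_bracket) (auto simp: BL)
  then have "co (Suc i) (x \<otimes>\<^bsub>L\<^esub> z) F =
      co i (x \<otimes>\<^bsub>L\<^esub> z) ?E + co i (\<delta> x \<otimes>\<^bsub>L\<^esub> z) F + co i (x \<otimes>\<^bsub>L\<^esub> \<delta> z) F"
    using Suc.prems by (simp add: add_co B_bracket \<delta>_mem)
  moreover have "co i (x \<otimes>\<^bsub>L\<^esub> z) ?E = co i x (\<lambda>j. co j z ?E) - co i z (\<lambda>j. co j x ?E)"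
    using Suc.prems by (intro Suc.IH) auto
  moreover have "co i (\<delta> x \<otimes>\<^bsub>L\<^esub> z) F = co i (\<delta> x) (\<lambda>j. co j z F) - co i z (\<lambda>j. co j (\<delta> x) F)"
    using Suc.prems by (intro Suc.IH) (auto simp: \<delta>_mem)
  moreover have "co i (x \<otimes>\<^bsub>L\<^esub> \<delta> z) F = co i x (\<lambda>j. co j (\<delta> z) F) - co i (\<delta> z) (\<lambda>j. co j x F)"
    using Suc.prems by (intro Suc.IH) (auto simp: \<delta>_mem)
  ultimately show ?case
    using Suc.prems by (simp add: co_add co_mem \<delta>_mem algebra_simps)
qed

text \<open>
  This is \<open>y\<^bsup>q\<^esup>x = x y\<^bsup>q\<^esup> + \<delta>\<^bsup>q\<^esup>(x)\<close> for \<open>q\<close> a power of the characteristic \<open>p\<close>. The case of \<open>p q\<close> follows from that of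
  \<open>q\<close> by moving \<open>p\<close> factors \<open>y\<^bsup>q\<^esup>\<close> past \<open>x\<close>, as the inner binomial coefficients vanish.
\<close>

lemma co_shift_CHAR_power:
  assumes p: "CHAR('f) \<noteq> 0" and x: "x \<in> B" and F: "\<And>j. F j \<in> W"
  shows "co (i + CHAR('f) ^ l) x F =
    co i x (\<lambda>j. F (j + CHAR('f) ^ l)) + co i ((\<delta> ^^ (CHAR('f) ^ l)) x) F"
  using x F
proof (induction l arbitrary: i x F)
  case 0
  then show ?case by simp
next
  case (Suc l)
  let ?p = "CHAR('f)"
  define q where "q = ?p ^ l"
  have IH: "co (i + q) x F = co i x (\<lambda>j. F (j + q)) + co i ((\<delta> ^^ q) x) F"
    if "x \<in> B" "\<And>j. F j \<in> W" for i x F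
    using Suc.IH[of x F i] that by (simp add: q_def)
  show ?case
  proof (rule ext)
    fix s
    define X where "X n a b = co (i + n * q) ((\<delta> ^^ (a * q)) x) (\<lambda>j. F (j + b * q)) s" for n a b
    have "X (Suc n) a b = X n a (Suc b) + X n (Suc a) b" for n a b
    proof -
      have "co (i + Suc n * q) ((\<delta> ^^ (a * q)) x) (\<lambda>j. F (j + b * q)) =
          co (i + n * q) ((\<delta> ^^ (a * q)) x) (\<lambda>j. F (j + q + b * q)) +
          co (i + n * q) ((\<delta> ^^ q) ((\<delta> ^^ (a * q)) x)) (\<lambda>j. F (j + b * q))"
        using IH[of "(\<delta> ^^ (a * q)) x" "\<lambda>j. F (j + b * q)" "i + n * q"] Suc.prems
        by (simp add: \<delta>_pow_mem add.assoc add.commute[of q])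
      then show ?thesis by (simp add: X_def funpow_add add.assoc plus_fun_apply)
    qed
    from binomial_of_recurrence_CHAR[of X 0 0, OF p this]
    show "co (i + ?p ^ Suc l) x F s =
        (co i x (\<lambda>j. F (j + ?p ^ Suc l)) + co i ((\<delta> ^^ (?p ^ Suc l)) x) F) s"
      by (simp add: X_def q_def plus_fun_apply)
  qed
qed

declare plus_fun_apply [simp] minus_apply [simp] scale_fun_apply [simp]

lemma linear_finsum:
  fixes m :: nat
  assumes \<psi>_add: "\<And>u v. \<lbrakk>u \<in> B; v \<in> B\<rbrakk> \<Longrightarrow> \<psi> (u \<oplus>\<^bsub>L\<^esub> v) = \<psi> u + \<psi> v"
    and \<psi>_smult: "\<And>c u. u \<in> B \<Longrightarrow> \<psi> (c \<odot>\<^bsub>L\<^esub> u) = c * \<psi> u"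
    and "\<And>l. u l \<in> B"
  shows "(\<Oplus>\<^bsub>L\<^esub>l\<in>{..<m}. a l \<odot>\<^bsub>L\<^esub> u l) \<in> B \<and>
    \<psi> (\<Oplus>\<^bsub>L\<^esub>l\<in>{..<m}. a l \<odot>\<^bsub>L\<^esub> u l) = (\<Sum>l<m. a l * \<psi> (u l))"
proof (induction m)
  case 0
  have "\<zero>\<^bsub>L\<^esub> \<in> B" using B by (simp add: submodule_iff)
  moreover from this have "\<psi> \<zero>\<^bsub>L\<^esub> = 0" using \<psi>_smult[of "\<zero>\<^bsub>L\<^esub>" 0] by simp
  ultimately show ?case by simp
next
  case (Suc m)
  have "(\<Oplus>\<^bsub>L\<^esub>l\<in>{..<Suc m}. a l \<odot>\<^bsub>L\<^esub> u l) = a m \<odot>\<^bsub>L\<^esub> u m \<oplus>\<^bsub>L\<^esub> (\<Oplus>\<^bsub>L\<^esub>l\<in>{..<m}. a l \<odot>\<^bsub>L\<^esub> u l)"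
    using assms(3) by (simp add: lessThan_Suc BL)
  then show ?case
    using Suc \<psi>_add[of "a m \<odot>\<^bsub>L\<^esub> u m"] \<psi>_smult assms(3) by (simp add: B_add B_smult)
qed

text \<open>
  The powers of \<open>\<delta>\<close> lie in the finite-dimensional space of linear maps on \<open>B\<close>, so one of them depends on the
  preceding ones. The relation is stated after applying a linear form \<open>\<psi>\<close> on \<open>B\<close>; the forms that occur later
  are the coordinates of \<open>co i x F\<close> as functions of \<open>x\<close>.
\<close>

lemma \<delta>_monic_relation:
  fixes q :: "nat \<Rightarrow> nat"
  obtains m a where "\<And>\<psi> x. \<lbrakk>\<And>u v. \<lbrakk>u \<in> B; v \<in> B\<rbrakk> \<Longrightarrow> \<psi> (u \<oplus>\<^bsub>L\<^esub> v) = \<psi> u + \<psi> v;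
      \<And>c u. u \<in> B \<Longrightarrow> \<psi> (c \<odot>\<^bsub>L\<^esub> u) = c * \<psi> u; x \<in> B\<rbrakk> \<Longrightarrow>
    \<psi> ((\<delta> ^^ q m) x) = (\<Sum>l<m. a l * (\<psi> ((\<delta> ^^ q l) x) :: 'f))"
proof -
  obtain \<Phi> where \<Phi>: "finite \<Phi>" "\<And>\<phi>. \<phi> \<in> \<Phi> \<Longrightarrow> linear_functional L \<phi>"
    "\<And>x. \<lbrakk>x \<in> carrier L; \<And>\<phi>. \<phi> \<in> \<Phi> \<Longrightarrow> \<phi> x = 0\<rbrakk> \<Longrightarrow> x = \<zero>\<^bsub>L\<^esub>"
    using finite_separating_functionals[OF finite_dimensional] by blast
  then obtain T where T: "finite T" "T \<subseteq> B" "B \<subseteq> span T"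
    using finite_span_if_separating[of \<Phi> B] B BL by blast
  obtain m a where ma: "\<And>\<phi> t. \<lbrakk>\<phi> \<in> \<Phi>; t \<in> T\<rbrakk> \<Longrightarrow>
      \<phi> ((\<delta> ^^ q m) t) = (\<Sum>l<m. a l * \<phi> ((\<delta> ^^ q l) t))"
    using monic_linear_relation[of "\<Phi> \<times> T" "\<lambda>l (\<phi>, t). \<phi> ((\<delta> ^^ q l) t)"] \<Phi>(1) T(1) by auto
  let ?R = "\<lambda>t. \<Oplus>\<^bsub>L\<^esub>l\<in>{..<m}. a l \<odot>\<^bsub>L\<^esub> (\<delta> ^^ q l) t"
  have rel: "(\<delta> ^^ q m) t = ?R t" if t: "t \<in> T" for t
  proof -
    have tB: "\<And>l. (\<delta> ^^ q l) t \<in> B" using t T \<delta>_pow_mem by blast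
    have R: "?R t \<in> B" using linear_finsum[of "\<lambda>_. 0"] tB by simp
    have "(- 1) \<odot>\<^bsub>L\<^esub> ?R t \<oplus>\<^bsub>L\<^esub> (\<delta> ^^ q m) t = \<zero>\<^bsub>L\<^esub>"
    proof (rule \<Phi>(3))
      fix \<phi> assume \<phi>: "\<phi> \<in> \<Phi>"
      then have lin: "linear_functional L \<phi>" by (rule \<Phi>)
      have "\<phi> (?R t) = (\<Sum>l<m. a l * \<phi> ((\<delta> ^^ q l) t))"
        using linear_finsum[of \<phi>] lin BL tB by (simp add: linear_functional_def)
      then have "\<phi> (?R t) = \<phi> ((\<delta> ^^ q m) t)" using ma[OF \<phi> t] by simp
      then show "\<phi> ((- 1) \<odot>\<^bsub>L\<^esub> ?R t \<oplus>\<^bsub>L\<^esub> (\<delta> ^^ q m) t) = 0"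
        using lin R tB BL by (simp add: linear_functional_def)
    qed (use R tB BL in simp)
    then show ?thesis
      using R tB BL by (simp add: smult_minus_add_eq_zero_iff)
  qed
  show ?thesis
  proof (rule that[of m a])
    fix \<psi> :: "'a \<Rightarrow> 'f" and x
    assume \<psi>_add: "\<And>u v. \<lbrakk>u \<in> B; v \<in> B\<rbrakk> \<Longrightarrow> \<psi> (u \<oplus>\<^bsub>L\<^esub> v) = \<psi> u + \<psi> v"
      and \<psi>_smult: "\<And>c u. u \<in> B \<Longrightarrow> \<psi> (c \<odot>\<^bsub>L\<^esub> u) = c * \<psi> u" and x: "x \<in> B"
    let ?N = "{x \<in> B. \<psi> ((\<delta> ^^ q m) x) = (\<Sum>l<m. a l * \<psi> ((\<delta> ^^ q l) x))}"
    have zB: "\<zero>\<^bsub>L\<^esub> \<in> B" using B by (simp add: submodule_iff)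
    have \<psi>0: "\<psi> \<zero>\<^bsub>L\<^esub> = 0" using \<psi>_smult[of "\<zero>\<^bsub>L\<^esub>" 0] zB by simp
    have \<delta>0: "(\<delta> ^^ n) \<zero>\<^bsub>L\<^esub> = \<zero>\<^bsub>L\<^esub>" for n
      by (induction n) (simp_all add: \<delta>_def y)
    have "submodule class_ring ?N L"
      unfolding submodule_iff
    proof (intro conjI ballI allI)
      fix u v assume "u \<in> ?N" "v \<in> ?N"
      then show "u \<oplus>\<^bsub>L\<^esub> v \<in> ?N"
        by (simp add: B_add \<delta>_pow_add \<delta>_pow_mem \<psi>_add sum.distrib algebra_simps)
    next
      fix c u assume "u \<in> ?N"
      then show "c \<odot>\<^bsub>L\<^esub> u \<in> ?N"
        by (simp add: B_smult \<delta>_pow_smult \<delta>_pow_mem \<psi>_smult sum_distrib_left algebra_simps)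
    qed (use BL zB \<psi>0 \<delta>0 in auto)
    moreover have "T \<subseteq> ?N"
    proof
      fix t assume t: "t \<in> T"
      have "\<psi> (?R t) = (\<Sum>l<m. a l * \<psi> ((\<delta> ^^ q l) t))"
        using t T \<delta>_pow_mem by (intro conjunct2[OF linear_finsum[OF \<psi>_add \<psi>_smult]]) auto
      then show "t \<in> ?N" using rel[OF t] t T by auto
    qed
    ultimately have "span T \<subseteq> ?N" by (intro span_is_subset)
    then have "x \<in> ?N" using subsetD[OF T(3) x] by (rule subsetD)
    then show "\<psi> ((\<delta> ^^ q m) x) = (\<Sum>l<m. a l * \<psi> ((\<delta> ^^ q l) x))" by simp
  qed
qed

end

text \<open>
  The pairing function identifies sequences of functions on \<open>nat\<close> with functions on \<open>nat\<close>; so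
  coinduction can be repeated within one type.
\<close>

definition seq_of :: "(nat \<Rightarrow> 'f) \<Rightarrow> nat \<Rightarrow> nat \<Rightarrow> 'f" where
  "seq_of f i s = f (prod_encode (i, s))"

definition of_seq :: "(nat \<Rightarrow> nat \<Rightarrow> 'f) \<Rightarrow> nat \<Rightarrow> 'f" where
  "of_seq F n = (case prod_decode n of (i, s) \<Rightarrow> F i s)"

lemma seq_of_of_seq [simp]: "seq_of (of_seq F) = F"
  by (intro ext) (simp add: seq_of_def of_seq_def)

lemma of_seq_seq_of [simp]: "of_seq (seq_of f) = f"
  by (intro ext) (simp add: seq_of_def of_seq_def case_prod_unfold)

lemma seq_of_simps [simp]:
  fixes f g :: "nat \<Rightarrow> 'f::field"
  shows "seq_of 0 = (0 :: nat \<Rightarrow> nat \<Rightarrow> 'f)" "seq_of (f + g) = seq_of f + seq_of g"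
    "seq_of (f - g) = seq_of f - seq_of g" "seq_of (scale_fun c f) = (\<lambda>i. scale_fun c (seq_of f i))"
  by (auto simp: seq_of_def fun_eq_iff)

lemma seq_of_inject: "seq_of f = seq_of g \<longleftrightarrow> f = g"
  by (metis of_seq_seq_of)

text \<open>
  The solution of a linear recurrence of order \<open>q m\<close> with initial terms \<open>1, 0, \<dots>, 0\<close>. The condition \<open>q l < q m\<close> guarantees
  termination; it selects all \<open>l < m\<close> when \<open>q\<close> is strictly increasing.
\<close>

fun linear_recurrence :: "nat \<Rightarrow> (nat \<Rightarrow> nat) \<Rightarrow> (nat \<Rightarrow> 'f::field) \<Rightarrow> nat \<Rightarrow> 'f" where
  "linear_recurrence m q a i =
     (if i < q m then if i = 0 then 1 else 0
      else \<Sum>l\<in>{l. l < m \<and> q l < q m}. a l * linear_recurrence m q a (i - q m + q l))"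

declare linear_recurrence.simps [simp del]

context coinduction
begin

lemma co_sum:
  assumes x: "x \<in> B" and F: "\<And>l j. F l j \<in> W"
  shows "co i x (\<lambda>j s. \<Sum>l<(m::nat). a l * F l j s) = (\<lambda>s. \<Sum>l<m. a l * co i x (F l) s)"
proof -
  have "co i x (\<lambda>j s. \<Sum>l<m. a l * F l j s) = (\<lambda>s. \<Sum>l<m. a l * co i x (F l) s) \<and>
      (\<forall>j. (\<lambda>s. \<Sum>l<m. a l * F l j s) \<in> W)"
  proof (induction m)
    case 0
    have "co i x (\<lambda>j. scale_fun 0 0) = scale_fun 0 (co i x (\<lambda>j. 0))"
      using x W_zero by (intro co_scale)
    moreover have "scale_fun 0 v = (\<lambda>s. 0)" for v :: "nat \<Rightarrow> 'f" by (simp add: scale_fun_def)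
    ultimately show ?case using W_zero by (simp add: zero_fun_def)
  next
    case (Suc m)
    have split: "(\<lambda>s. \<Sum>l<Suc m. a l * F l j s) = (\<lambda>s. \<Sum>l<m. a l * F l j s) + scale_fun (a m) (F m j)" for j
      by (simp add: fun_eq_iff)
    have "co i x (\<lambda>j. (\<lambda>s. \<Sum>l<m. a l * F l j s) + scale_fun (a m) (F m j)) =
        (\<lambda>s. \<Sum>l<m. a l * co i x (F l) s) + scale_fun (a m) (co i x (F m))"
      using Suc x F by (subst co_add) (auto simp: co_scale W_scale)
    then show ?case unfolding split using Suc F by (simp add: fun_eq_iff W_add W_scale)
  qed
  then show ?thesis by blast
qed

text \<open>
  The representation space is the part of the coinduced module that is annihilated by the polynomial
  \<open>t\<^bsup>p\<^sup>m\<^esup> - \<Sum>l<m. a\<^sub>l t\<^bsup>p\<^sup>l\<^esup>\<close> in the shift. By \<open>co_shift_CHAR_power\<close> and the monic relation of \<open>\<delta>\<close> this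
  polynomial commutes with the action of \<open>B\<close>. A sequence in the space is determined by its first \<open>p\<^sup>m\<close> terms.
  The evaluation \<open>F \<mapsto> F 0\<close> is a \<open>B\<close>-homomorphism onto \<open>W\<close>, so that \<open>x\<close> still fixes the
  coordinate \<open>s\<^sub>0\<close> of the initial term.
\<close>

theorem exists_coinduced_representation:
  assumes p: "CHAR('f) \<noteq> 0"
    and \<kappa>: "linear_functional L \<kappa>" "\<And>b. b \<in> B \<Longrightarrow> \<kappa> b = 0" "\<kappa> y = 1"
    and C: "submodule class_ring C L" "\<And>k. k \<in> C \<Longrightarrow> k \<oplus>\<^bsub>L\<^esub> (- \<kappa> k) \<odot>\<^bsub>L\<^esub> y \<in> B"
      "\<And>k k'. \<lbrakk>k \<in> C; k' \<in> C\<rbrakk> \<Longrightarrow> k \<otimes>\<^bsub>L\<^esub> k' \<in> B" "B \<subseteq> C"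
    and x: "x \<in> B" and fixes_s: "\<And>w. w \<in> W \<Longrightarrow> \<rho> x w s\<^sub>0 = w s\<^sub>0"
    and w\<^sub>0: "w\<^sub>0 \<in> W" "w\<^sub>0 s\<^sub>0 \<noteq> 0"
  shows "\<exists>W' \<rho>' s. lie_representation L C W' \<rho>' \<and> (\<forall>w\<in>W'. \<rho>' x w s = w s) \<and> (\<exists>w\<in>W'. w s \<noteq> 0)"
proof -
  let ?p = "CHAR('f)"
  have p2: "2 \<le> ?p" using p CHAR_not_1'[where 'a='f] by linarith
  obtain m a where rel: "\<And>\<psi> x. \<lbrakk>\<And>u v. \<lbrakk>u \<in> B; v \<in> B\<rbrakk> \<Longrightarrow> \<psi> (u \<oplus>\<^bsub>L\<^esub> v) = \<psi> u + \<psi> v;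
      \<And>c u. u \<in> B \<Longrightarrow> \<psi> (c \<odot>\<^bsub>L\<^esub> u) = c * \<psi> u; x \<in> B\<rbrakk> \<Longrightarrow>
    \<psi> ((\<delta> ^^ (?p ^ m)) x) = (\<Sum>l<m. a l * (\<psi> ((\<delta> ^^ (?p ^ l)) x) :: 'f))"
    using \<delta>_monic_relation[of "\<lambda>l. ?p ^ l"] by blast
  define R where "R = {F :: nat \<Rightarrow> nat \<Rightarrow> 'f. (\<forall>i. F i \<in> W) \<and>
    (\<forall>i s. F (i + ?p ^ m) s = (\<Sum>l<m. a l * F (i + ?p ^ l) s))}"
  have RW: "F i \<in> W" if "F \<in> R" for F i using that by (simp add: R_def)
  have R_zero: "0 \<in> R" using W_zero by (simp add: R_def)
  have R_add: "F + G \<in> R" if "F \<in> R" "G \<in> R" for F G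
    using that by (simp add: R_def W_add sum.distrib algebra_simps)
  have R_scale: "(\<lambda>i. scale_fun c (F i)) \<in> R" if "F \<in> R" for c F
    using that by (simp add: R_def W_scale sum_distrib_left algebra_simps)
  have R_shift: "(\<lambda>i. F (Suc i)) \<in> R" if "F \<in> R" for F
    using that unfolding R_def by (auto simp flip: add_Suc)
  have R_co: "(\<lambda>i. co i b F) \<in> R" if b: "b \<in> B" and F: "F \<in> R" for b F
  proof -
    have "co (i + ?p ^ m) b F s = (\<Sum>l<m. a l * co (i + ?p ^ l) b F s)" for i s
    proof -
      have "co (i + ?p ^ m) b F = co i b (\<lambda>j. F (j + ?p ^ m)) + co i ((\<delta> ^^ (?p ^ m)) b) F"
        using b F RW by (intro co_shift_CHAR_power[OF p])
      moreover have "(\<lambda>j. F (j + ?p ^ m)) = (\<lambda>j s. \<Sum>l<m. a l * F (j + ?p ^ l) s)"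
        using F by (simp add: R_def fun_eq_iff)
      then have "co i b (\<lambda>j. F (j + ?p ^ m)) s = (\<Sum>l<m. a l * co i b (\<lambda>j. F (j + ?p ^ l)) s)"
        using co_sum[of b "\<lambda>l j. F (j + ?p ^ l)"] b F RW by simp
      moreover have "co i ((\<delta> ^^ (?p ^ m)) b) F s = (\<Sum>l<m. a l * co i ((\<delta> ^^ (?p ^ l)) b) F s)"
        using b F RW by (intro rel[of "\<lambda>b. co i b F s"]) (simp_all add: add_co smult_co)
      moreover have "co (i + ?p ^ l) b F = co i b (\<lambda>j. F (j + ?p ^ l)) + co i ((\<delta> ^^ (?p ^ l)) b) F" for l
        using b F RW by (intro co_shift_CHAR_power[OF p])
      ultimately show ?thesis by (simp add: sum.distrib algebra_simps)
    qed
    moreover have "co i b F \<in> W" for i using b F RW by (intro co_mem)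
    ultimately show ?thesis unfolding R_def by blast
  qed
  \<comment> \<open>An element \<open>k\<close> of \<open>C\<close> is the sum of its component \<open>\<beta> k\<close> in \<open>B\<close> and of \<open>\<kappa> k\<close> times \<open>y\<close>; the latter acts as
    a multiple of the shift.\<close>
  define \<beta> where "\<beta> k = k \<oplus>\<^bsub>L\<^esub> (- \<kappa> k) \<odot>\<^bsub>L\<^esub> y" for k
  define G where "G k F i = co i (\<beta> k) F + scale_fun (\<kappa> k) (F (Suc i))" for k i and F :: "nat \<Rightarrow> nat \<Rightarrow> 'f"
  define W' where "W' = {f. seq_of f \<in> R}"
  define \<rho>' where "\<rho>' k f = of_seq (G k (seq_of f))" for k f
  have CL: "k \<in> carrier L" if "k \<in> C" for k using that C(1) by (auto simp: submodule_iff)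
  have \<beta>B: "\<beta> k \<in> B" if "k \<in> C" for k using that C(2) by (simp add: \<beta>_def)
  have \<beta>_add: "\<beta> (k \<oplus>\<^bsub>L\<^esub> k') = \<beta> k \<oplus>\<^bsub>L\<^esub> \<beta> k'" and \<kappa>_add: "\<kappa> (k \<oplus>\<^bsub>L\<^esub> k') = \<kappa> k + \<kappa> k'"
    if "k \<in> C" "k' \<in> C" for k k'
  proof -
    show l: "\<kappa> (k \<oplus>\<^bsub>L\<^esub> k') = \<kappa> k + \<kappa> k'" using that CL \<kappa>(1) by (simp add: linear_functional_def)
    show "\<beta> (k \<oplus>\<^bsub>L\<^esub> k') = \<beta> k \<oplus>\<^bsub>L\<^esub> \<beta> k'"
      unfolding \<beta>_def l
      using that CL y smult_add_scalars[of y "- \<kappa> k" "- \<kappa> k'"] by (simp add: M.a_ac)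
  qed
  have \<beta>_smult: "\<beta> (c \<odot>\<^bsub>L\<^esub> k) = c \<odot>\<^bsub>L\<^esub> \<beta> k" and \<kappa>_smult: "\<kappa> (c \<odot>\<^bsub>L\<^esub> k) = c * \<kappa> k"
    if "k \<in> C" for k c
  proof -
    show l: "\<kappa> (c \<odot>\<^bsub>L\<^esub> k) = c * \<kappa> k" using that CL \<kappa>(1) by (simp add: linear_functional_def)
    show "\<beta> (c \<odot>\<^bsub>L\<^esub> k) = c \<odot>\<^bsub>L\<^esub> \<beta> k"
      using that CL y by (simp add: \<beta>_def l smult_add smult_smult)
  qed
  have GR: "G k F \<in> R" if "k \<in> C" "F \<in> R" for k F
    using R_add[OF R_co[OF \<beta>B[OF that(1)] that(2)] R_scale[OF R_shift[OF that(2)], of "\<kappa> k"]]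
    by (simp add: G_def[abs_def] plus_fun_def)
  have co_add': "co i b (F + H) = co i b F + co i b H"
    if "b \<in> B" "\<And>j. F j \<in> W" "\<And>j. H j \<in> W" for i b F H
    using co_add[OF that] by (simp add: plus_fun_def)
  have G_add: "G k (F + H) = G k F + G k H" if "k \<in> C" "F \<in> R" "H \<in> R" for k F H
    using that RW \<beta>B by (intro ext) (simp add: G_def co_add' algebra_simps)
  have G_scale: "G k (\<lambda>i. scale_fun c (F i)) = (\<lambda>i. scale_fun c (G k F i))"
    if "k \<in> C" "F \<in> R" for k c F
    using that RW \<beta>B by (intro ext) (simp add: G_def co_scale algebra_simps)
  have add_G: "G (k \<oplus>\<^bsub>L\<^esub> k') F = G k F + G k' F" if "k \<in> C" "k' \<in> C" "F \<in> R" for k k' F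
    using that RW \<beta>B by (intro ext) (simp add: G_def \<beta>_add \<kappa>_add add_co algebra_simps)
  have smult_G: "G (c \<odot>\<^bsub>L\<^esub> k) F = (\<lambda>i. scale_fun c (G k F i))" if "k \<in> C" "F \<in> R" for k c F
    using that RW \<beta>B by (intro ext) (simp add: G_def \<beta>_smult \<kappa>_smult smult_co algebra_simps)
  have bracket_G: "G (k \<otimes>\<^bsub>L\<^esub> k') F = G k (G k' F) - G k' (G k F)"
    if k: "k \<in> C" "k' \<in> C" and F: "F \<in> R" for k k' F
  proof (rule ext)
    fix i
    let ?b = "\<beta> k" and ?b' = "\<beta> k'" and ?c = "\<kappa> k" and ?c' = "\<kappa> k'"
    have bB: "?b \<in> B" "?b' \<in> B" using k \<beta>B by auto
    then have bL: "?b \<in> carrier L" "?b' \<in> carrier L" using BL by auto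
    have decomp: "k = \<beta> k \<oplus>\<^bsub>L\<^esub> \<kappa> k \<odot>\<^bsub>L\<^esub> y" if "k \<in> C" for k
    proof -
      have "\<beta> k \<oplus>\<^bsub>L\<^esub> \<kappa> k \<odot>\<^bsub>L\<^esub> y = k \<oplus>\<^bsub>L\<^esub> (- \<kappa> k + \<kappa> k) \<odot>\<^bsub>L\<^esub> y"
        using that CL y smult_add_scalars[of y "- \<kappa> k" "\<kappa> k"]
        by (simp add: \<beta>_def M.a_assoc del: add.left_inverse)
      then show ?thesis using that CL y by simp
    qed
    have b_y: "?b \<otimes>\<^bsub>L\<^esub> y = (- 1) \<odot>\<^bsub>L\<^esub> \<delta> ?b"
      using bracket_anticommute[of y ?b] bL y bracket_closed by (simp add: minus_eq_smult \<delta>_def)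
    have "k \<otimes>\<^bsub>L\<^esub> k' = (?b \<oplus>\<^bsub>L\<^esub> ?c \<odot>\<^bsub>L\<^esub> y) \<otimes>\<^bsub>L\<^esub> (?b' \<oplus>\<^bsub>L\<^esub> ?c' \<odot>\<^bsub>L\<^esub> y)"
      using decomp k by simp
    also have "\<dots> = ?b \<otimes>\<^bsub>L\<^esub> ?b' \<oplus>\<^bsub>L\<^esub> (- ?c') \<odot>\<^bsub>L\<^esub> \<delta> ?b \<oplus>\<^bsub>L\<^esub> ?c \<odot>\<^bsub>L\<^esub> \<delta> ?b'"
      using bL y by (simp add: bracket_add_left bracket_add_right bracket_smult_left bracket_smult_right
          bracket_closed bracket_self b_y \<delta>_def smult_smult M.a_ac)
    finally have kk': "k \<otimes>\<^bsub>L\<^esub> k' = \<dots>" .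
    have kB: "k \<otimes>\<^bsub>L\<^esub> k' \<in> B" using k by (rule C(3))
    then have "\<beta> (k \<otimes>\<^bsub>L\<^esub> k') = k \<otimes>\<^bsub>L\<^esub> k'" "\<kappa> (k \<otimes>\<^bsub>L\<^esub> k') = 0"
      using \<kappa>(2) BL y by (auto simp: \<beta>_def)
    then have "G (k \<otimes>\<^bsub>L\<^esub> k') F i = co i (?b \<otimes>\<^bsub>L\<^esub> ?b' \<oplus>\<^bsub>L\<^esub> (- ?c') \<odot>\<^bsub>L\<^esub> \<delta> ?b \<oplus>\<^bsub>L\<^esub> ?c \<odot>\<^bsub>L\<^esub> \<delta> ?b') F"
      by (simp add: G_def kk' fun_eq_iff)
    also have "\<dots> = co i ?b (\<lambda>j. co j ?b' F) - co i ?b' (\<lambda>j. co j ?b F)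
        - scale_fun ?c' (co i (\<delta> ?b) F) + scale_fun ?c (co i (\<delta> ?b') F)"
      using bB F RW
      by (simp add: add_co smult_co bracket_co B_bracket B_add B_smult \<delta>_mem fun_eq_iff)
    finally have lhs: "G (k \<otimes>\<^bsub>L\<^esub> k') F i = \<dots>" .
    have expand: "G k (G k' F) i = co i (\<beta> k) (\<lambda>j. co j (\<beta> k') F)
        + scale_fun (\<kappa> k') (co i (\<beta> k) (\<lambda>j. F (Suc j)))
        + scale_fun (\<kappa> k) (co i (\<beta> k') (\<lambda>j. F (Suc j)) + co i (\<delta> (\<beta> k')) F
            + scale_fun (\<kappa> k') (F (Suc (Suc i))))"
      if k: "k \<in> C" "k' \<in> C" for k k'
    proof -
      have "co i (\<beta> k) (G k' F) = co i (\<beta> k) (\<lambda>j. co j (\<beta> k') F)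
          + co i (\<beta> k) (\<lambda>j. scale_fun (\<kappa> k') (F (Suc j)))"
        unfolding G_def[abs_def] using k F RW \<beta>B by (intro co_add) (auto simp: co_mem W_scale)
      also have "co i (\<beta> k) (\<lambda>j. scale_fun (\<kappa> k') (F (Suc j))) = scale_fun (\<kappa> k') (co i (\<beta> k) (\<lambda>j. F (Suc j)))"
        using k F RW \<beta>B by (intro co_scale)
      finally have "co i (\<beta> k) (G k' F) = co i (\<beta> k) (\<lambda>j. co j (\<beta> k') F)
          + scale_fun (\<kappa> k') (co i (\<beta> k) (\<lambda>j. F (Suc j)))" .
      then show ?thesis
        by (simp only: G_def[of k "G k' F"] G_def[of k' F "Suc i"] coinduced_action.simps)
    qed
    show "G (k \<otimes>\<^bsub>L\<^esub> k') F i = (G k (G k' F) - G k' (G k F)) i"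
      unfolding lhs using expand[OF k] expand[OF k(2) k(1)] by (simp add: fun_eq_iff algebra_simps)
  qed
  have "lie_representation L C W' \<rho>'"
  proof (intro lie_representation.intro lie_algebra_axioms lie_representation_axioms.intro)
    show "submodule class_ring C L" by fact
    show "k \<otimes>\<^bsub>L\<^esub> k' \<in> C" if "k \<in> C" "k' \<in> C" for k k' using C(3)[OF that] C(4) by blast
    obtain S where S: "finite S" "\<forall>w\<in>W. (\<forall>s\<in>S. w s = 0) \<longrightarrow> w = 0"
      using W_finite by (elim exE conjE)
    have "w = 0" if w: "w \<in> W'" and zero: "\<And>i s. \<lbrakk>i < ?p ^ m; s \<in> S\<rbrakk> \<Longrightarrow> w (prod_encode (i, s)) = 0" for w
    proof -
      have F: "seq_of w \<in> R" using w by (simp add: W'_def)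
      have "seq_of w i = 0" for i
      proof (induction i rule: less_induct)
        case (less i)
        show ?case
        proof (cases "i < ?p ^ m")
          case True
          then have "\<forall>s\<in>S. seq_of w i s = 0" using zero by (simp add: seq_of_def)
          then show ?thesis using S(2) RW[OF F] by blast
        next
          case False
          have "seq_of w (i - ?p ^ m + ?p ^ l) = 0" if "l < m" for l
          proof (rule less.IH)
            have "?p ^ l < ?p ^ m" using p2 that by (intro power_strict_increasing) auto
            then show "i - ?p ^ m + ?p ^ l < i" using False by simp
          qed
          moreover have "seq_of w (i - ?p ^ m + ?p ^ m) s = (\<Sum>l<m. a l * seq_of w (i - ?p ^ m + ?p ^ l) s)" for s
            using F unfolding R_def by blast
          ultimately show ?thesis using False by (simp add: fun_eq_iff)
        qed
      qed
      then have "seq_of w = seq_of 0" by (simp add: fun_eq_iff)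
      then show "w = 0" by (simp only: seq_of_inject)
    qed
    then show "\<exists>S. finite S \<and> (\<forall>w\<in>W'. (\<forall>s\<in>S. w s = 0) \<longrightarrow> w = 0)"
      using S(1) by (intro exI[of _ "prod_encode ` ({..<?p ^ m} \<times> S)"]) auto
  qed (auto simp: W'_def \<rho>'_def R_zero R_add R_scale GR G_add G_scale add_G smult_G bracket_G
        simp flip: seq_of_inject)
  moreover have "\<rho>' x w (prod_encode (0, s\<^sub>0)) = w (prod_encode (0, s\<^sub>0))" if "w \<in> W'" for w
  proof -
    have "\<beta> x = x" "\<kappa> x = 0" using x \<kappa>(2) BL y by (auto simp: \<beta>_def)
    moreover have "seq_of w 0 \<in> W" using that RW by (simp add: W'_def)
    ultimately show ?thesis using fixes_s by (simp add: \<rho>'_def of_seq_def G_def seq_of_def)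
  qed
  moreover have "\<exists>w\<in>W'. w (prod_encode (0, s\<^sub>0)) \<noteq> 0"
  proof -
    let ?c = "linear_recurrence m (\<lambda>l. ?p ^ l) a"
    have c: "?c (i + ?p ^ m) = (\<Sum>l<m. a l * ?c (i + ?p ^ l))" for i
    proof -
      have "{l. l < m \<and> ?p ^ l < ?p ^ m} = {..<m}"
        using p2 by (auto intro: power_strict_increasing)
      then show ?thesis by (subst linear_recurrence.simps) simp
    qed
    \<comment> \<open>Multiplying \<open>w\<^sub>0\<close> by a scalar solution of the recurrence extends it to a sequence in \<open>R\<close>.\<close>
    have "(\<lambda>i. scale_fun (?c i) w\<^sub>0) \<in> R"
      using w\<^sub>0 by (simp add: R_def W_scale c sum_distrib_left sum_distrib_right algebra_simps)
    then have "of_seq (\<lambda>i. scale_fun (?c i) w\<^sub>0) \<in> W'" by (simp add: W'_def)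
    moreover have "of_seq (\<lambda>i. scale_fun (?c i) w\<^sub>0) (prod_encode (0, s\<^sub>0)) \<noteq> 0"
      using w\<^sub>0(2) p2 by (simp add: of_seq_def linear_recurrence.simps)
    ultimately show ?thesis by blast
  qed
  ultimately show ?thesis by blast
qed

end

section \<open>Representations of soluble Lie algebras\<close>

declare derived_series.simps(2) [simp del]

context lie_algebra
begin

lemma derived_series_submodule: "submodule class_ring (derived_series L n) L"
proof (induction n)
  case 0
  then show ?case by (simp add: submodule_iff)
next
  case (Suc n)
  then have "derived_series L n \<subseteq> carrier L" by (simp add: submodule_iff)
  then show ?case by (simp add: derived_series.simps bracket_space_submodule)
qed

lemma derived_series_carrier: "derived_series L n \<subseteq> carrier L"
  using derived_series_submodule[of n] by (simp add: submodule_iff)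

lemma derived_series_bracket:
  "\<lbrakk>a \<in> derived_series L n; b \<in> derived_series L n\<rbrakk> \<Longrightarrow> a \<otimes>\<^bsub>L\<^esub> b \<in> derived_series L (Suc n)"
  using bracket_in_bracket_space derived_series_carrier by (simp add: derived_series.simps)

lemma derived_series_Suc_subset: "derived_series L (Suc n) \<subseteq> derived_series L n"
proof (induction n)
  case 0
  then show ?case using derived_series_carrier[of 1] by simp
next
  case (Suc n)
  have "bracket_space L (derived_series L (Suc n)) (derived_series L (Suc n)) \<subseteq> derived_series L (Suc n)"
    using Suc derived_series_bracket by (intro bracket_space_least derived_series_submodule) blast
  then show ?case by (simp only: derived_series.simps)
qed

lemma derived_series_antimono: "m \<le> n \<Longrightarrow> derived_series L n \<subseteq> derived_series L m"
  by (rule lift_Suc_antimono_le[where f = "derived_series L"]) (rule derived_series_Suc_subset)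

lemma one_dim_representation:
  assumes B: "submodule class_ring B L" and \<kappa>: "linear_functional L \<kappa>"
    and bracket: "\<And>a b. \<lbrakk>a \<in> B; b \<in> B\<rbrakk> \<Longrightarrow> a \<otimes>\<^bsub>L\<^esub> b \<in> B \<and> \<kappa> (a \<otimes>\<^bsub>L\<^esub> b) = 0"
  shows "lie_representation L B {w. \<forall>n\<noteq>0. w n = 0} (\<lambda>x. scale_fun (\<kappa> x))"
proof (intro lie_representation.intro lie_algebra_axioms lie_representation_axioms.intro)
  have BL: "\<And>b. b \<in> B \<Longrightarrow> b \<in> carrier L" using B by (auto simp: submodule_iff)
  show "scale_fun (\<kappa> (x \<oplus>\<^bsub>L\<^esub> y)) w = scale_fun (\<kappa> x) w + scale_fun (\<kappa> y) w"
    if "x \<in> B" "y \<in> B" for x y and w :: "nat \<Rightarrow> 'f"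
    using \<kappa> BL[OF that(1)] BL[OF that(2)] by (simp add: linear_functional_def fun_eq_iff algebra_simps)
  show "scale_fun (\<kappa> (c \<odot>\<^bsub>L\<^esub> x)) w = scale_fun c (scale_fun (\<kappa> x) w)"
    if "x \<in> B" for c x and w :: "nat \<Rightarrow> 'f"
    using \<kappa> BL[OF that] by (simp add: linear_functional_def fun_eq_iff)
  show "\<exists>S. finite S \<and> (\<forall>w\<in>{w :: nat \<Rightarrow> 'f. \<forall>n\<noteq>0. w n = 0}. (\<forall>s\<in>S. w s = 0) \<longrightarrow> w = 0)"
  proof (intro exI[of _ "{0}"] conjI ballI impI ext)
    fix w :: "nat \<Rightarrow> 'f" and n
    assume "w \<in> {w. \<forall>n\<noteq>0. w n = 0}" "\<forall>s\<in>{0}. w s = 0"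
    then show "w n = 0 n" by (cases n) auto
  qed simp
qed (use bracket B in \<open>auto simp: fun_eq_iff algebra_simps\<close>)

text \<open>
  That \<open>x\<close> fixes a coordinate which is not identically zero on \<open>W\<close> gives \<open>x\<close> the eigenvalue one on the dual of
  \<open>W\<close>; in particular \<open>x\<close> does not act nilpotently. A coordinate is easier to carry along than an
  eigenvector, since coinduction maps onto the given module. The subalgebras \<open>B\<close> that occur lie between two
  consecutive terms of the derived series, and so does \<open>B + F y\<close>. One of maximal rank that has such a
  representation is the whole algebra.
\<close>

theorem exists_representation_with_eigenvalue_one:
  assumes p: "CHAR('f) \<noteq> 0" and soluble: "soluble L" and x: "x \<in> carrier L" "x \<noteq> \<zero>\<^bsub>L\<^esub>"
  shows "\<exists>W \<rho> s. lie_representation L (carrier L) W \<rho> \<and>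
    (\<forall>w\<in>W. \<rho> x w s = w s) \<and> (\<exists>w\<in>W. w s \<noteq> 0)"
proof -
  let ?D = "derived_series L"
  define R where "R B \<longleftrightarrow> (\<exists>W \<rho> s. lie_representation L B W \<rho> \<and>
    (\<forall>w\<in>W. \<rho> x w s = w s) \<and> (\<exists>w\<in>W. w s \<noteq> 0))" for B
  define P where "P B \<longleftrightarrow> submodule class_ring B L \<and> x \<in> B \<and>
    (\<exists>i. ?D (Suc i) \<subseteq> B \<and> B \<subseteq> ?D i) \<and> R B" for B
  obtain n where "?D n = {\<zero>\<^bsub>L\<^esub>}" using soluble by (auto simp: soluble_def)
  then have n: "x \<notin> ?D n" using x by simp
  define k where "k = (LEAST n. x \<notin> ?D n)"
  have k: "x \<notin> ?D k" unfolding k_def using n by (rule LeastI)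
  then obtain i where i: "k = Suc i" using x by (cases k) auto
  have xi: "x \<in> ?D i" using not_less_Least[of i "\<lambda>n. x \<notin> ?D n"] i unfolding k_def by simp
  obtain \<kappa> where \<kappa>: "linear_functional L \<kappa>" "\<And>u. u \<in> ?D k \<Longrightarrow> \<kappa> u = 0" "\<kappa> x = 1"
    using exists_separating_functional[OF finite_dimensional derived_series_submodule x(1) k] by blast
  have "P (?D i)"
  proof -
    have "lie_representation L (?D i) {w. \<forall>n\<noteq>0. w n = 0} (\<lambda>x. scale_fun (\<kappa> x))"
      using \<kappa> derived_series_bracket derived_series_Suc_subset[of i] i
      by (intro one_dim_representation derived_series_submodule) blast+
    moreover have "(\<lambda>n. if n = 0 then 1 else 0) \<in> {w :: nat \<Rightarrow> 'f. \<forall>n\<noteq>0. w n = 0}" by simp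
    moreover have "(\<lambda>n. if n = 0 then 1 else 0 :: 'f) (0::nat) \<noteq> 0" by simp
    ultimately have "R (?D i)" unfolding R_def using \<kappa>(3)
      by (intro exI[of _ "{w. \<forall>n\<noteq>0. w n = 0}"] exI[of _ "\<lambda>x. scale_fun (\<kappa> x)"] exI[of _ 0])
         (metis (mono_tags, lifting) mult_1 scale_fun_apply)
    then show ?thesis
      using xi derived_series_submodule derived_series_Suc_subset by (auto simp: P_def)
  qed
  moreover obtain r :: "'a set \<Rightarrow> nat" where
    r: "\<And>A B. \<lbrakk>submodule class_ring A L; submodule class_ring B L; A \<subset> B\<rbrakk> \<Longrightarrow> r A < r B"
    using submodule_rank_strict_mono[OF finite_dimensional] by blast
  have "submodule class_ring (carrier L) L" by (simp add: submodule_iff)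
  then have "\<forall>B. P B \<longrightarrow> r B < Suc (r (carrier L))"
    using r derived_series_carrier unfolding P_def less_Suc_eq_le
    by (metis less_imp_le order.refl psubsetI submodule.subset)
  ultimately obtain B where B: "P B" and max: "\<And>C. P C \<Longrightarrow> r C \<le> r B"
    using ex_has_greatest_nat[of P _ r] by blast
  have "B = carrier L"
  proof (rule ccontr)
    assume ne: "B \<noteq> carrier L"
    have sB: "submodule class_ring B L" and xB: "x \<in> B" using B by (auto simp: P_def)
    have BL: "B \<subseteq> carrier L" using sB by (simp add: submodule_iff)
    obtain l where l: "?D (Suc l) \<subseteq> B" "B \<subseteq> ?D l" using B by (auto simp: P_def)
    \<comment> \<open>If \<open>B\<close> is itself a term of the derived series, the next \<open>y\<close> has to come from an earlier term. So
      \<open>j\<close> is chosen afresh: the last index whose term is not contained in \<open>B\<close>.\<close>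
    define m where "m = (LEAST n. ?D n \<subseteq> B)"
    have m: "?D m \<subseteq> B" unfolding m_def using l(1) by (rule LeastI)
    then obtain j where j: "m = Suc j" using ne BL by (cases m) auto
    have "m \<le> Suc l" unfolding m_def using l(1) by (rule Least_le)
    then have Bj: "B \<subseteq> ?D j" using l(2) j derived_series_antimono[of j l] by auto
    have "\<not> ?D j \<subseteq> B" using not_less_Least[of j "\<lambda>n. ?D n \<subseteq> B"] j unfolding m_def by simp
    then obtain y where y: "y \<in> ?D j" "y \<notin> B" by blast
    have yL: "y \<in> carrier L" using y derived_series_carrier by blast
    have into_B: "a \<otimes>\<^bsub>L\<^esub> b \<in> B" if "a \<in> ?D j" "b \<in> ?D j" for a b
      using derived_series_bracket[OF that] m j by blast
    obtain \<kappa> where \<kappa>: "linear_functional L \<kappa>" "\<And>b. b \<in> B \<Longrightarrow> \<kappa> b = 0" "\<kappa> y = 1"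
      using exists_separating_functional[OF finite_dimensional sB yL y(2)] by blast
    obtain W \<rho> s w\<^sub>0 where rep: "lie_representation L B W \<rho>"
      and s: "\<And>w. w \<in> W \<Longrightarrow> \<rho> x w s = w s" and w\<^sub>0: "w\<^sub>0 \<in> W" "w\<^sub>0 s \<noteq> 0"
      using B unfolding P_def R_def by blast
    interpret co: coinduction L B W \<rho> y
      using rep yL y into_B Bj by (intro coinduction.intro coinduction_axioms.intro) auto
    \<comment> \<open>The subalgebra \<open>B + F y\<close>.\<close>
    define C where "C = {k \<in> ?D j. k \<oplus>\<^bsub>L\<^esub> (- \<kappa> k) \<odot>\<^bsub>L\<^esub> y \<in> B}"
    have Dj: "\<And>d. d \<in> ?D j \<Longrightarrow> d \<in> carrier L" using derived_series_carrier by blast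
    have BC: "B \<subseteq> C" using Bj \<kappa>(2) BL yL by (auto simp: C_def)
    have yC: "y \<in> C"
      using y yL \<kappa>(3) sB by (simp add: C_def submodule_iff M.r_neg flip: minus_eq_smult)
    have sC: "submodule class_ring C L"
      unfolding submodule_iff
    proof (intro conjI ballI allI)
      show "C \<subseteq> carrier L" using Dj by (auto simp: C_def)
      show "\<zero>\<^bsub>L\<^esub> \<in> C" using BC sB by (auto simp: submodule_iff)
      fix u assume u: "u \<in> C"
      then have uD: "u \<in> ?D j" and uB: "u \<oplus>\<^bsub>L\<^esub> (- \<kappa> u) \<odot>\<^bsub>L\<^esub> y \<in> B" by (auto simp: C_def)
      show "c \<odot>\<^bsub>L\<^esub> u \<in> C" for c
      proof -
        have "c \<odot>\<^bsub>L\<^esub> (u \<oplus>\<^bsub>L\<^esub> (- \<kappa> u) \<odot>\<^bsub>L\<^esub> y) \<in> B" using uB sB by (simp add: submodule_iff)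
        moreover have "c \<odot>\<^bsub>L\<^esub> (u \<oplus>\<^bsub>L\<^esub> (- \<kappa> u) \<odot>\<^bsub>L\<^esub> y) = c \<odot>\<^bsub>L\<^esub> u \<oplus>\<^bsub>L\<^esub> (- \<kappa> (c \<odot>\<^bsub>L\<^esub> u)) \<odot>\<^bsub>L\<^esub> y"
          using Dj[OF uD] yL \<kappa>(1) by (simp add: smult_add smult_smult linear_functional_def)
        moreover have "c \<odot>\<^bsub>L\<^esub> u \<in> ?D j" using uD derived_series_submodule by (simp add: submodule_iff)
        ultimately show ?thesis by (simp add: C_def)
      qed
      fix v assume v: "v \<in> C"
      then have vD: "v \<in> ?D j" and vB: "v \<oplus>\<^bsub>L\<^esub> (- \<kappa> v) \<odot>\<^bsub>L\<^esub> y \<in> B" by (auto simp: C_def)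
      have "(u \<oplus>\<^bsub>L\<^esub> (- \<kappa> u) \<odot>\<^bsub>L\<^esub> y) \<oplus>\<^bsub>L\<^esub> (v \<oplus>\<^bsub>L\<^esub> (- \<kappa> v) \<odot>\<^bsub>L\<^esub> y) \<in> B"
        using uB vB sB by (simp add: submodule_iff)
      moreover have "(u \<oplus>\<^bsub>L\<^esub> (- \<kappa> u) \<odot>\<^bsub>L\<^esub> y) \<oplus>\<^bsub>L\<^esub> (v \<oplus>\<^bsub>L\<^esub> (- \<kappa> v) \<odot>\<^bsub>L\<^esub> y) =
          (u \<oplus>\<^bsub>L\<^esub> v) \<oplus>\<^bsub>L\<^esub> (- \<kappa> u + - \<kappa> v) \<odot>\<^bsub>L\<^esub> y"
        using Dj[OF uD] Dj[OF vD] yL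
        by (simp only: smult_add_scalars M.a_ac smult_mem M.a_closed)
      moreover have "- \<kappa> u + - \<kappa> v = - \<kappa> (u \<oplus>\<^bsub>L\<^esub> v)"
        using Dj[OF uD] Dj[OF vD] \<kappa>(1) by (simp add: linear_functional_def)
      moreover have "u \<oplus>\<^bsub>L\<^esub> v \<in> ?D j" using uD vD derived_series_submodule by (simp add: submodule_iff)
      ultimately show "u \<oplus>\<^bsub>L\<^esub> v \<in> C" by (simp add: C_def)
    qed
    have "R C"
      unfolding R_def
      using into_B BC
      by (intro co.exists_coinduced_representation[OF p \<kappa> sC _ _ _ xB s w\<^sub>0]) (auto simp: C_def)
    moreover have "?D (Suc j) \<subseteq> C" using m j BC by blast
    moreover have "C \<subseteq> ?D j" by (auto simp: C_def)
    ultimately have "P C" using sC xB BC by (auto simp: P_def)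
    moreover have "B \<subset> C" using BC yC y(2) by blast
    ultimately show False using max r[OF sB sC] by fastforce
  qed
  then show ?thesis using B by (simp add: P_def R_def)
qed

end

section \<open>Semidirect products\<close>

lemma lie_representation_pullback:
  assumes K: "lie_representation K (carrier K) W \<rho>" and L: "lie_algebra L" and \<pi>: "lie_hom L K \<pi>"
  shows "lie_representation L (carrier L) W (\<lambda>l. \<rho> (\<pi> l))"
proof -
  interpret K: lie_representation K "carrier K" W \<rho> by fact
  interpret L: lie_algebra L by fact
  have \<pi>K: "\<And>l. l \<in> carrier L \<Longrightarrow> \<pi> l \<in> carrier K" using \<pi> by (auto simp: lie_hom_iff)
  have hom: "\<And>x y. \<lbrakk>x \<in> carrier L; y \<in> carrier L\<rbrakk> \<Longrightarrow> \<pi> (x \<oplus>\<^bsub>L\<^esub> y) = \<pi> x \<oplus>\<^bsub>K\<^esub> \<pi> y"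
    "\<And>c x. x \<in> carrier L \<Longrightarrow> \<pi> (c \<odot>\<^bsub>L\<^esub> x) = c \<odot>\<^bsub>K\<^esub> \<pi> x"
    "\<And>x y. \<lbrakk>x \<in> carrier L; y \<in> carrier L\<rbrakk> \<Longrightarrow> \<pi> (x \<otimes>\<^bsub>L\<^esub> y) = \<pi> x \<otimes>\<^bsub>K\<^esub> \<pi> y"
    using \<pi> by (auto simp: lie_hom_iff)
  show ?thesis
    by (intro lie_representation.intro L lie_representation_axioms.intro K.W_finite)
       (auto simp: hom \<pi>K L.submodule_iff L.bracket_closed K.W_zero K.W_add K.W_scale
         K.act_mem K.act_add K.act_scale K.add_act K.smult_act K.bracket_act)
qed

text \<open>
  The module \<open>W\<close> is an abelian ideal, on which \<open>L\<close> acts through \<open>\<tau>\<close>.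
\<close>

definition semidirect_product :: "('f::field, 'a) module \<Rightarrow> (nat \<Rightarrow> 'f) set \<Rightarrow>
    ('a \<Rightarrow> (nat \<Rightarrow> 'f) \<Rightarrow> nat \<Rightarrow> 'f) \<Rightarrow> ('f, (nat \<Rightarrow> 'f) \<times> 'a) module" where
  "semidirect_product L W \<tau> =
     \<lparr>carrier = W \<times> carrier L,
      mult = (\<lambda>(v, x) (w, y). (\<tau> x w - \<tau> y v, x \<otimes>\<^bsub>L\<^esub> y)),
      one = (0, \<zero>\<^bsub>L\<^esub>), zero = (0, \<zero>\<^bsub>L\<^esub>),
      add = (\<lambda>(v, x) (w, y). (v + w, x \<oplus>\<^bsub>L\<^esub> y)),
      smult = (\<lambda>c (v, x). (scale_fun c v, c \<odot>\<^bsub>L\<^esub> x))\<rparr>"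

locale lie_module = lie_representation L "carrier L" W \<tau>
  for L :: "('f::field, 'a) module" and W \<tau>
begin

abbreviation "SD \<equiv> semidirect_product L W \<tau>"

lemma SD_simps [simp]:
  "carrier SD = W \<times> carrier L" "\<zero>\<^bsub>SD\<^esub> = (0, \<zero>\<^bsub>L\<^esub>)"
  "(v, x) \<otimes>\<^bsub>SD\<^esub> (w, y) = (\<tau> x w - \<tau> y v, x \<otimes>\<^bsub>L\<^esub> y)"
  "(v, x) \<oplus>\<^bsub>SD\<^esub> (w, y) = (v + w, x \<oplus>\<^bsub>L\<^esub> y)"
  "c \<odot>\<^bsub>SD\<^esub> (v, x) = (scale_fun c v, c \<odot>\<^bsub>L\<^esub> x)"
  by (simp_all add: semidirect_product_def)

lemma W_uminus: "w \<in> W \<Longrightarrow> - w \<in> W"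
proof -
  have "scale_fun (- 1) w = - w" by (simp add: fun_eq_iff)
  then show "w \<in> W \<Longrightarrow> - w \<in> W" using W_scale[of w "- 1"] by simp
qed

lemma W_minus: "\<lbrakk>v \<in> W; w \<in> W\<rbrakk> \<Longrightarrow> v - w \<in> W"
  using W_add[of v "- w"] W_uminus[of w] by simp

lemma act_minus: "\<lbrakk>x \<in> carrier L; v \<in> W; w \<in> W\<rbrakk> \<Longrightarrow> \<tau> x (v - w) = \<tau> x v - \<tau> x w"
  using act_add[of x "v - w" w] W_minus by (simp add: algebra_simps)

lemma zero_act: "w \<in> W \<Longrightarrow> \<tau> \<zero>\<^bsub>L\<^esub> w = 0"
  using smult_act[of "\<zero>\<^bsub>L\<^esub>" w 0] by (simp add: fun_eq_iff)

lemma vectorspace_SD: "vectorspace (class_ring :: 'f ring) SD"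
proof -
  have "abelian_group SD"
  proof (rule abelian_groupI)
    fix X assume "X \<in> carrier SD"
    then obtain v x where X: "X = (v, x)" "v \<in> W" "x \<in> carrier L" by auto
    then have "(- v, \<ominus>\<^bsub>L\<^esub> x) \<in> carrier SD" "(- v, \<ominus>\<^bsub>L\<^esub> x) \<oplus>\<^bsub>SD\<^esub> X = \<zero>\<^bsub>SD\<^esub>"
      by (simp_all add: W_uminus M.l_neg)
    then show "\<exists>Y\<in>carrier SD. Y \<oplus>\<^bsub>SD\<^esub> X = \<zero>\<^bsub>SD\<^esub>" by blast
  qed (auto simp: W_add W_zero M.a_ac add_ac)
  then have "Module.module (class_ring :: 'f ring) SD"
    by (intro moduleI class_cring.cring_axioms)
       (auto simp: W_scale smult_add smult_add_scalars smult_smult fun_eq_iff algebra_simps)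
  then show ?thesis using vectorspace_axioms by (simp add: vectorspace_def)
qed

lemma lie_algebra_SD: "lie_algebra SD"
proof -
  interpret S: field_vectorspace SD using vectorspace_SD by (simp add: field_vectorspace_def)
  obtain S where S: "finite S" "\<forall>w\<in>W. (\<forall>s\<in>S. w s = 0) \<longrightarrow> w = 0"
    using W_finite by (elim exE conjE)
  obtain \<Phi> where \<Phi>: "finite \<Phi>" "\<And>\<phi>. \<phi> \<in> \<Phi> \<Longrightarrow> linear_functional L \<phi>"
    "\<And>x. \<lbrakk>x \<in> carrier L; \<And>\<phi>. \<phi> \<in> \<Phi> \<Longrightarrow> \<phi> x = 0\<rbrakk> \<Longrightarrow> x = \<zero>\<^bsub>L\<^esub>"
    using finite_separating_functionals[OF finite_dimensional] by blast
  define \<Psi> where "\<Psi> = (\<lambda>s (w :: nat \<Rightarrow> 'f, x :: 'a). w s) ` S \<union> (\<lambda>\<phi> (w :: nat \<Rightarrow> 'f, x). \<phi> x) ` \<Phi>"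
  have "S.fin_dim"
  proof (rule S.fin_dim_if_separating)
    show "finite \<Psi>" using S(1) \<Phi>(1) by (simp add: \<Psi>_def)
    show "linear_functional SD \<psi>" if "\<psi> \<in> \<Psi>" for \<psi>
      using that \<Phi>(2) by (auto simp: \<Psi>_def linear_functional_def)
    fix X assume X: "X \<in> carrier SD" and zero: "\<And>\<psi>. \<psi> \<in> \<Psi> \<Longrightarrow> \<psi> X = 0"
    obtain w x where wx: "X = (w, x)" "w \<in> W" "x \<in> carrier L" using X by auto
    have "w s = 0" if "s \<in> S" for s
      using zero[of "\<lambda>(w, x). w s"] that by (simp add: \<Psi>_def wx(1))
    moreover have "\<phi> x = 0" if "\<phi> \<in> \<Phi>" for \<phi>
      using zero[of "\<lambda>(w, x). \<phi> x"] that by (simp add: \<Psi>_def wx(1))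
    ultimately show "X = \<zero>\<^bsub>SD\<^esub>" using S(2) \<Phi>(3)[of x] wx by simp
  qed
  then show ?thesis
  proof (intro lie_algebra.intro lie_algebra_axioms.intro vectorspace_SD)
    fix X Y Z :: "(nat \<Rightarrow> 'f) \<times> 'a"
    assume "X \<in> carrier SD" "Y \<in> carrier SD" "Z \<in> carrier SD"
    then show "X \<otimes>\<^bsub>SD\<^esub> (Y \<otimes>\<^bsub>SD\<^esub> Z) \<oplus>\<^bsub>SD\<^esub> Y \<otimes>\<^bsub>SD\<^esub> (Z \<otimes>\<^bsub>SD\<^esub> X) \<oplus>\<^bsub>SD\<^esub> Z \<otimes>\<^bsub>SD\<^esub> (X \<otimes>\<^bsub>SD\<^esub> Y) = \<zero>\<^bsub>SD\<^esub>"
      using jacobi by (auto simp: act_minus act_mem bracket_act bracket_closed)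
  qed (auto simp: W_minus act_mem bracket_closed act_add add_act act_scale smult_act
        bracket_add_left bracket_add_right bracket_smult_left bracket_smult_right bracket_self
        fun_eq_iff algebra_simps)
qed

lemma lie_hom_snd: "lie_hom SD L snd"
  by (auto simp: lie_hom_iff)

lemma snd_SD: "snd ` carrier SD = carrier L"
  using W_zero by force

text \<open>
  Along the chief factors of the semidirect product below \<open>W\<close>, the coordinate \<open>s\<close> vanishes on the lower ideal by
  induction. An element that centralises the factor maps the upper ideal into the lower one, while it
  leaves the coordinate unchanged.
\<close>

lemma chief_centraliser_SD:
  assumes X: "(v, x) \<in> chief_centraliser SD" and s: "\<And>w. w \<in> W \<Longrightarrow> \<tau> x w s = w s"
    and w: "w \<in> W"
  shows "w s = 0"
proof -
  interpret S: lie_algebra SD by (rule lie_algebra_SD)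
  have vx: "v \<in> W" "x \<in> carrier L" using X by (auto simp: chief_centraliser_def)
  have "H \<subseteq> W \<times> {\<zero>\<^bsub>L\<^esub>} \<longrightarrow> (\<forall>u z. (u, z) \<in> H \<longrightarrow> u s = 0)" if "lie_ideal SD H" for H
    using that
  proof (induction rule: S.lie_ideal_chief_induct)
    case zero
    then show ?case by simp
  next
    case (chief H K)
    show ?case
    proof (intro impI allI)
      fix u z assume H: "H \<subseteq> W \<times> {\<zero>\<^bsub>L\<^esub>}" and u: "(u, z) \<in> H"
      then have uW: "u \<in> W" and z: "z = \<zero>\<^bsub>L\<^esub>" by auto
      have "(v, x) \<in> factor_centraliser SD H K" using X chief(1) by (auto simp: chief_centraliser_def)
      then have "(v, x) \<otimes>\<^bsub>SD\<^esub> (u, z) \<in> K" using u by (auto simp: factor_centraliser_def)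
      then have "(\<tau> x u, \<zero>\<^bsub>L\<^esub>) \<in> K" using vx by (simp add: z zero_act)
      moreover have "K \<subseteq> H" using chief(1) by (auto simp: chief_factor_def)
      ultimately have "\<tau> x u s = 0" using chief.IH H by blast
      then show "u s = 0" using s[OF uW] by simp
    qed
  qed
  moreover have "lie_ideal SD (W \<times> {\<zero>\<^bsub>L\<^esub>})"
    by (auto simp: S.lie_ideal_iff W_zero W_add W_scale act_mem zero_act)
  ultimately show ?thesis using w by blast
qed

end

section \<open>Formations\<close>

lemma soluble_if_abelian_kernel:
  assumes L: "lie_algebra L" and M: "lie_algebra M" and f: "lie_hom L M f"
    and soluble: "soluble M"
    and abelian: "\<And>a b. \<lbrakk>a \<in> lie_kernel L M f; b \<in> lie_kernel L M f\<rbrakk> \<Longrightarrow> a \<otimes>\<^bsub>L\<^esub> b = \<zero>\<^bsub>L\<^esub>"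
  shows "soluble L"
proof -
  interpret L: lie_algebra L by fact
  interpret M: lie_algebra M by fact
  have map: "f x \<in> derived_series M n" if "x \<in> derived_series L n" for x n
    using that
  proof (induction n arbitrary: x)
    case 0
    then show ?case using f by (auto simp: lie_hom_iff)
  next
    case (Suc n)
    let ?N = "{x \<in> carrier L. f x \<in> derived_series M (Suc n)}"
    have "submodule class_ring ?N L"
      using f lie_hom_zero[OF L M f] M.derived_series_submodule[of "Suc n"]
      by (auto simp: L.submodule_iff M.submodule_iff lie_hom_iff)
    moreover have "a \<otimes>\<^bsub>L\<^esub> b \<in> ?N" if ab: "a \<in> derived_series L n" "b \<in> derived_series L n" for a b
    proof -
      have abL: "a \<in> carrier L" "b \<in> carrier L" using ab L.derived_series_carrier by blast+
      then have "f (a \<otimes>\<^bsub>L\<^esub> b) = f a \<otimes>\<^bsub>M\<^esub> f b" using f by (simp add: lie_hom_iff)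
      then show ?thesis
        using abL L.bracket_closed M.derived_series_bracket[OF Suc.IH[OF ab(1)] Suc.IH[OF ab(2)]] by simp
    qed
    ultimately have "derived_series L (Suc n) \<subseteq> ?N"
      unfolding derived_series.simps(2) by (rule L.bracket_space_least)
    then show ?case using Suc.prems by blast
  qed
  obtain n where n: "derived_series M n = {\<zero>\<^bsub>M\<^esub>}" using soluble by (auto simp: soluble_def)
  then have "derived_series L n \<subseteq> lie_kernel L M f"
    using map L.derived_series_carrier by (fastforce simp: lie_kernel_def)
  then have "derived_series L (Suc n) \<subseteq> {\<zero>\<^bsub>L\<^esub>}"
    using abelian L.lie_ideal_submodule[OF L.lie_ideal_zero]
    unfolding derived_series.simps(2) by (intro L.bracket_space_least) auto
  moreover have "\<zero>\<^bsub>L\<^esub> \<in> derived_series L (Suc n)"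
    using L.derived_series_submodule[of "Suc n"] by (simp only: L.submodule_iff)
  ultimately show ?thesis unfolding soluble_def by blast
qed

lemma in_lie_class_isomorphic:
  "\<lbrakk>lie_isomorphic L M; in_lie_class M \<KK>\<rbrakk> \<Longrightarrow> in_lie_class L \<KK>"
  unfolding in_lie_class_def using lie_isomorphic_trans by blast

context
  fixes \<KK> :: "('f::field) lie_class"
  assumes \<KK>: "soluble_formation \<KK>"
begin

lemma formation_lie_algebra: "L \<in> \<KK> \<Longrightarrow> lie_algebra L"
  and formation_soluble: "L \<in> \<KK> \<Longrightarrow> soluble L"
  using \<KK> by (auto simp: soluble_formation_def)

lemma mem_formation_iff:
  assumes M: "lie_algebra M" shows "M \<in> \<KK> \<longleftrightarrow> in_lie_class M \<KK>"
proof
  show "in_lie_class M \<KK>" if "M \<in> \<KK>" using that lie_isomorphic_refl by (auto simp: in_lie_class_def)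
  assume "in_lie_class M \<KK>"
  then obtain P where P: "P \<in> \<KK>" "lie_isomorphic M P" by (auto simp: in_lie_class_def)
  then have "lie_isomorphic P M" using lie_isomorphic_sym[OF M] formation_lie_algebra by blast
  then show "M \<in> \<KK>" using \<KK> P(1) M unfolding soluble_formation_def by blast
qed

text \<open>
  The quotient \<open>L/A\<close> is also the quotient of \<open>M\<close> by the image of \<open>A\<close>, and formations are closed under quotients.
\<close>

lemma formation_quotient_of_image:
  assumes L: "lie_algebra L" and M: "M \<in> \<KK>" and f: "lie_hom L M f" and surj: "f ` carrier L = carrier M"
    and A: "lie_ideal L A" and ker: "lie_kernel L M f \<subseteq> A"
  shows "in_lie_class (lie_quotient L A) \<KK>"
proof -
  have lM: "lie_algebra M" by (rule formation_lie_algebra[OF M])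
  interpret L: lie_algebra L by fact
  interpret M: lie_algebra M by fact
  have fA: "lie_ideal M (f ` A)" by (rule lie_ideal_image[OF L lM f surj A])
  note pr = M.lie_quotient_projection[OF fA]
  let ?g = "(\<lambda>x. f ` A +>\<^bsub>M\<^esub> x) \<circ> f"
  have "lie_kernel L (lie_quotient M (f ` A)) ?g = {x \<in> carrier L. f x \<in> lie_kernel M (lie_quotient M (f ` A)) (\<lambda>x. f ` A +>\<^bsub>M\<^esub> x)}"
    using surj by (auto simp: lie_kernel_def)
  also have "\<dots> = A" unfolding pr(3) by (rule vimage_image_lie_ideal[OF L lM f A ker])
  finally have ker_g: "lie_kernel L (lie_quotient M (f ` A)) ?g = A" .
  have "?g ` carrier L = carrier (lie_quotient M (f ` A))"
    unfolding image_comp[symmetric] surj by (rule pr(2))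
  then have "lie_isomorphic (lie_quotient L A) (lie_quotient M (f ` A))"
    using lie_isomorphic_quotient_kernel[OF L M.lie_algebra_lie_quotient[OF fA] lie_hom_comp[OF f pr(1)]]
    unfolding ker_g by blast
  moreover have "in_lie_class (lie_quotient M (f ` A)) \<KK>"
    using \<KK> M fA unfolding soluble_formation_def by blast
  ultimately show ?thesis by (rule in_lie_class_isomorphic)
qed

lemma formation_quotient_mono:
  assumes L: "lie_algebra L" and B: "lie_ideal L B" "in_lie_class (lie_quotient L B) \<KK>"
    and A: "lie_ideal L A" "B \<subseteq> A"
  shows "in_lie_class (lie_quotient L A) \<KK>"
proof -
  interpret L: lie_algebra L by fact
  note pr = L.lie_quotient_projection[OF B(1)]
  have Q: "lie_algebra (lie_quotient L B)" by (rule L.lie_algebra_lie_quotient[OF B(1)])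
  obtain P f where P: "P \<in> \<KK>" "lie_hom (lie_quotient L B) P f"
      "bij_betw f (carrier (lie_quotient L B)) (carrier P)"
    using B(2) by (auto simp: in_lie_class_def lie_isomorphic_iff_hom)
  let ?g = "f \<circ> (\<lambda>x. B +>\<^bsub>L\<^esub> x)"
  have g: "lie_hom L P ?g" by (rule lie_hom_comp[OF pr(1) P(2)])
  have surj: "?g ` carrier L = carrier P"
    unfolding image_comp[symmetric] pr(2) using P(3) by (simp add: bij_betw_def)
  have "lie_kernel L P ?g \<subseteq> lie_kernel L (lie_quotient L B) (\<lambda>x. B +>\<^bsub>L\<^esub> x)"
  proof
    interpret Q: lie_algebra "lie_quotient L B" by (rule Q)
    fix x assume "x \<in> lie_kernel L P ?g"
    then have x: "x \<in> carrier L" "f (B +>\<^bsub>L\<^esub> x) = \<zero>\<^bsub>P\<^esub>" by (auto simp: lie_kernel_def)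
    have "B +>\<^bsub>L\<^esub> x \<in> carrier (lie_quotient L B)" using pr(2) x(1) by blast
    then have "B +>\<^bsub>L\<^esub> x = \<zero>\<^bsub>lie_quotient L B\<^esub>"
      using x(2) lie_hom_zero[OF Q formation_lie_algebra[OF P(1)] P(2)] P(3)
        inj_onD[of f "carrier (lie_quotient L B)"] Q.M.zero_closed by (metis bij_betw_imp_inj_on)
    then show "x \<in> lie_kernel L (lie_quotient L B) (\<lambda>x. B +>\<^bsub>L\<^esub> x)" using x(1) by (simp add: lie_kernel_def)
  qed
  then have "lie_kernel L P ?g \<subseteq> A" using pr(3) A(2) by simp
  then show ?thesis by (rule formation_quotient_of_image[OF L P(1) g surj A(1)])
qed

lemma formation_quotient_carrier:
  assumes L: "lie_algebra L"
  shows "in_lie_class (lie_quotient L (carrier L)) \<KK>"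
proof -
  obtain M where M: "M \<in> \<KK>" using \<KK> by (auto simp: soluble_formation_def)
  have lM: "lie_algebra M" by (rule formation_lie_algebra[OF M])
  interpret L: lie_algebra L by fact
  interpret M: lie_algebra M by fact
  note prL = L.lie_quotient_projection[OF L.lie_ideal_carrier]
  note prM = M.lie_quotient_projection[OF M.lie_ideal_carrier]
  let ?Q = "lie_quotient M (carrier M)"
  interpret Q: lie_algebra ?Q by (rule M.lie_algebra_lie_quotient[OF M.lie_ideal_carrier])
  have "carrier ?Q = {\<zero>\<^bsub>?Q\<^esub>}"
    using prM(2,3) Q.M.zero_closed by (auto simp: lie_kernel_def)
  moreover have "lie_hom L ?Q (\<lambda>_. \<zero>\<^bsub>?Q\<^esub>)" by (simp add: lie_hom_iff)
  moreover have "lie_kernel L ?Q (\<lambda>_. \<zero>\<^bsub>?Q\<^esub>) = carrier L" by (simp add: lie_kernel_def)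
  ultimately have "lie_isomorphic (lie_quotient L (carrier L)) ?Q"
    using lie_isomorphic_quotient_kernel[OF L Q.lie_algebra_axioms, of "\<lambda>_. \<zero>\<^bsub>?Q\<^esub>"] L.M.zero_closed
    by (metis image_constant)
  moreover have "in_lie_class ?Q \<KK>"
    using \<KK> M M.lie_ideal_carrier unfolding soluble_formation_def by blast
  ultimately show ?thesis by (rule in_lie_class_isomorphic)
qed

text \<open>
  Among the ideals \<open>B\<close> with \<open>L/B\<close> in \<open>\<KK>\<close> one of least rank is contained in every centraliser \<open>C\<close> of a chief
  factor, as otherwise \<open>B \<inter> C\<close> would be smaller. Hence \<open>B\<close> is contained in the nil radical and in \<open>A\<close>.
\<close>

theorem quotient_by_nilpotent_Loc_subset: "quotient_by_nilpotent (Loc \<KK>) \<subseteq> \<KK>"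
proof
  fix M assume "M \<in> quotient_by_nilpotent (Loc \<KK>)"
  then obtain L A where M: "lie_algebra M" and L: "L \<in> Loc \<KK>" and A: "lie_ideal L A" "nil_radical L \<subseteq> A"
    and iso: "lie_isomorphic M (lie_quotient L A)"
    by (auto simp: quotient_by_nilpotent_def)
  have lL: "lie_algebra L" using L by (simp add: Loc_def)
  interpret L: lie_algebra L by fact
  obtain r :: "'f vec set \<Rightarrow> nat" where
    r: "\<And>A B. \<lbrakk>lie_ideal L A; lie_ideal L B; A \<subset> B\<rbrakk> \<Longrightarrow> r A < r B"
    using L.lie_ideal_rank by blast
  define P where "P B \<longleftrightarrow> lie_ideal L B \<and> in_lie_class (lie_quotient L B) \<KK>" for B
  have "P (carrier L)"
    using formation_quotient_carrier[OF lL] L.lie_ideal_carrier by (simp add: P_def)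
  then obtain B where B: "P B" and min: "\<And>C. P C \<Longrightarrow> r B \<le> r C"
    using ex_has_least_nat[of P "carrier L" r] by blast
  have "B \<subseteq> factor_centraliser L H K" if HK: "chief_factor L H K" for H K
  proof -
    let ?C = "factor_centraliser L H K"
    have "lie_ideal L ?C"
      using HK by (intro L.lie_ideal_factor_centraliser) (auto simp: chief_factor_def)
    then have "P ?C" using L HK by (simp add: P_def Loc_def)
    then have "P (B \<inter> ?C)"
      using \<KK> B lL L.lie_ideal_Int unfolding P_def soluble_formation_def by blast
    then show ?thesis using min[of "B \<inter> ?C"] r[of "B \<inter> ?C" B] B unfolding P_def by fastforce
  qed
  then have "B \<subseteq> nil_radical L"
    using B unfolding L.nil_radical_eq_chief_centraliser
    by (auto simp: chief_centraliser_def P_def L.lie_ideal_iff)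
  then have "in_lie_class (lie_quotient L A) \<KK>"
    using formation_quotient_mono[OF lL _ _ A(1)] B A(2) by (auto simp: P_def)
  then show "M \<in> \<KK>" using mem_formation_iff[OF M] in_lie_class_isomorphic[OF iso] by blast
qed

end

definition abelian_extension :: "('f::field, 'a) module \<Rightarrow> ('f, 'b) module \<Rightarrow> ('a \<Rightarrow> 'b) \<Rightarrow> bool" where
  "abelian_extension L K \<pi> \<longleftrightarrow> lie_algebra L \<and> lie_hom L K \<pi> \<and> \<pi> ` carrier L = carrier K \<and>
     (\<forall>a\<in>lie_kernel L K \<pi>. \<forall>b\<in>lie_kernel L K \<pi>. a \<otimes>\<^bsub>L\<^esub> b = \<zero>\<^bsub>L\<^esub>)"

text \<open>
  The kernel is an abelian ideal, hence nilpotent, and so is contained in the centraliser of every chief factor.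
  The quotients of \<open>L\<close> by these centralisers are therefore quotients of \<open>K\<close>.
\<close>

lemma abelian_extension_in_Loc:
  fixes L :: "('f::field, 'f vec) module"
  assumes \<KK>: "soluble_formation \<KK>" and K: "K \<in> \<KK>" and ext: "abelian_extension L K \<pi>"
  shows "L \<in> Loc \<KK>"
proof -
  have lK: "lie_algebra K" and sK: "soluble K" using formation_lie_algebra formation_soluble \<KK> K by auto
  have L: "lie_algebra L" and \<pi>: "lie_hom L K \<pi>" and surj: "\<pi> ` carrier L = carrier K"
    and abelian: "\<And>a b. \<lbrakk>a \<in> lie_kernel L K \<pi>; b \<in> lie_kernel L K \<pi>\<rbrakk> \<Longrightarrow> a \<otimes>\<^bsub>L\<^esub> b = \<zero>\<^bsub>L\<^esub>"
    using ext by (auto simp: abelian_extension_def)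
  interpret L: lie_algebra L by fact
  have "nilpotent_ideal L (lie_kernel L K \<pi>)"
    using L.nilpotent_ideal_if_abelian lie_ideal_kernel[OF L lK \<pi>] abelian by blast
  then have "in_lie_class (lie_quotient L (factor_centraliser L H C)) \<KK>" if "chief_factor L H C" for H C
    using that L.nilpotent_ideal_subset_factor_centraliser[OF _ that]
    by (intro formation_quotient_of_image[OF \<KK> L K \<pi> surj] L.lie_ideal_factor_centraliser)
       (auto simp: chief_factor_def)
  then show ?thesis
    using L soluble_if_abelian_kernel[OF L lK \<pi> sK abelian] by (simp add: Loc_def)
qed

text \<open>
  The new extension is the semidirect product of \<open>L\<close> with a \<open>K\<close>-module on which \<open>x\<close> does not act nilpotently, taken
  in a copy on the type \<open>'f vec\<close>, in which the members of classes of Lie algebras live. Its kernel stays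
  abelian because the kernel of \<open>\<pi>\<close> acts as zero on the module.
\<close>

lemma exists_smaller_extension:
  fixes K :: "('f::field, 'a) module" and L :: "('f, 'b) module"
  assumes p: "CHAR('f) \<noteq> 0" and K: "lie_algebra K" "soluble K" and ext: "abelian_extension L K \<pi>"
    and x: "x \<in> carrier K" "x \<noteq> \<zero>\<^bsub>K\<^esub>"
  shows "\<exists>(L' :: ('f, 'f vec) module) \<pi>'. abelian_extension L' K \<pi>' \<and>
    \<pi>' ` chief_centraliser L' \<subseteq> \<pi> ` chief_centraliser L \<and> x \<notin> \<pi>' ` chief_centraliser L'"
proof -
  interpret K: lie_algebra K by fact
  have L: "lie_algebra L" and \<pi>: "lie_hom L K \<pi>" and surj: "\<pi> ` carrier L = carrier K"
    and abelian: "\<And>a b. \<lbrakk>a \<in> lie_kernel L K \<pi>; b \<in> lie_kernel L K \<pi>\<rbrakk> \<Longrightarrow> a \<otimes>\<^bsub>L\<^esub> b = \<zero>\<^bsub>L\<^esub>"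
    using ext by (auto simp: abelian_extension_def)
  obtain W \<rho> s w\<^sub>0 where rep: "lie_representation K (carrier K) W \<rho>"
    and s: "\<And>w. w \<in> W \<Longrightarrow> \<rho> x w s = w s" and w\<^sub>0: "w\<^sub>0 \<in> W" "w\<^sub>0 s \<noteq> 0"
    using K.exists_representation_with_eigenvalue_one[OF p K(2) x] by blast
  interpret S: lie_module L W "\<lambda>l. \<rho> (\<pi> l)"
    unfolding lie_module_def by (rule lie_representation_pullback[OF rep L \<pi>])
  interpret SD: lie_algebra S.SD by (rule S.lie_algebra_SD)
  obtain L' :: "('f, 'f vec) module" where L': "lie_algebra L'" "lie_isomorphic S.SD L'"
    using SD.exists_isomorphic_lie_model by blast
  interpret L': lie_algebra L' by (rule L')
  obtain h where h: "lie_hom L' S.SD h" "bij_betw h (carrier L') (carrier S.SD)"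
    using lie_isomorphic_sym[OF S.lie_algebra_SD L'] by (auto simp: lie_isomorphic_iff_hom)
  have h_surj: "h ` carrier L' = carrier S.SD" and h_inj: "inj_on h (carrier L')"
    using h(2) by (auto simp: bij_betw_def)
  define g where "g = snd \<circ> h"
  have g: "lie_hom L' L g" unfolding g_def by (rule lie_hom_comp[OF h(1) S.lie_hom_snd])
  have g_surj: "g ` carrier L' = carrier L" unfolding g_def image_comp[symmetric] h_surj by (rule S.snd_SD)
  define \<pi>' where "\<pi>' = \<pi> \<circ> g"
  have \<pi>': "lie_hom L' K \<pi>'" unfolding \<pi>'_def by (rule lie_hom_comp[OF g \<pi>])
  have \<pi>'_surj: "\<pi>' ` carrier L' = carrier K" unfolding \<pi>'_def image_comp[symmetric] g_surj by (rule surj)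
  have "a \<otimes>\<^bsub>L'\<^esub> b = \<zero>\<^bsub>L'\<^esub>" if ab: "a \<in> lie_kernel L' K \<pi>'" "b \<in> lie_kernel L' K \<pi>'" for a b
  proof -
    have abL: "a \<in> carrier L'" "b \<in> carrier L'" using ab by (auto simp: lie_kernel_def)
    obtain v l w m where v: "h a = (v, l)" and w: "h b = (w, m)" by fastforce
    have "(v, l) \<in> carrier S.SD" "(w, m) \<in> carrier S.SD" using h_surj abL v w by (metis image_eqI)+
    then have mem: "v \<in> W" "l \<in> carrier L" "w \<in> W" "m \<in> carrier L" by auto
    have zero: "\<pi> l = \<zero>\<^bsub>K\<^esub>" "\<pi> m = \<zero>\<^bsub>K\<^esub>"
      using ab v w by (auto simp: lie_kernel_def \<pi>'_def g_def)
    have "\<pi> \<zero>\<^bsub>L\<^esub> = \<zero>\<^bsub>K\<^esub>" by (rule lie_hom_zero[OF L K(1) \<pi>])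
    then have "\<rho> \<zero>\<^bsub>K\<^esub> u = 0" if "u \<in> W" for u using S.zero_act[OF that] by simp
    moreover have "l \<otimes>\<^bsub>L\<^esub> m = \<zero>\<^bsub>L\<^esub>" using abelian zero mem by (simp add: lie_kernel_def)
    ultimately have "h (a \<otimes>\<^bsub>L'\<^esub> b) = \<zero>\<^bsub>S.SD\<^esub>"
      using h(1) abL mem by (simp add: lie_hom_iff v w zero)
    then show ?thesis
      using inj_onD[OF h_inj, of "a \<otimes>\<^bsub>L'\<^esub> b" "\<zero>\<^bsub>L'\<^esub>"] lie_hom_zero[OF L'(1) S.lie_algebra_SD h(1)]
        L'.bracket_closed abL by simp
  qed
  then have "abelian_extension L' K \<pi>'"
    using L'(1) \<pi>' \<pi>'_surj by (simp add: abelian_extension_def)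
  moreover have "\<pi>' ` chief_centraliser L' \<subseteq> \<pi> ` chief_centraliser L"
    using chief_centraliser_image[OF L'(1) L g g_surj] by (auto simp: \<pi>'_def)
  moreover have "x \<notin> \<pi>' ` chief_centraliser L'"
  proof
    assume "x \<in> \<pi>' ` chief_centraliser L'"
    then obtain a where a: "a \<in> chief_centraliser L'" "x = \<pi>' a" by blast
    have "h a \<in> chief_centraliser S.SD"
      using chief_centraliser_image[OF L'(1) S.lie_algebra_SD h(1) h_surj] a(1) by blast
    moreover have "h a = (fst (h a), g a)" by (simp add: g_def)
    ultimately have "w\<^sub>0 s = 0"
      using S.chief_centraliser_SD[of "fst (h a)" "g a" s w\<^sub>0] s w\<^sub>0(1) a(2) by (simp add: \<pi>'_def)
    then show False using w\<^sub>0(2) by simp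
  qed
  ultimately show ?thesis by blast
qed

text \<open>
  By \<open>exists_smaller_extension\<close>, an abelian extension for which the image of the nil radical in \<open>K\<close> has least rank
  has image zero.
\<close>

theorem exists_extension_nil_radical_in_kernel:
  fixes K :: "('f::field, 'f vec) module"
  assumes p: "CHAR('f) \<noteq> 0" and K: "lie_algebra K" "soluble K"
  obtains L :: "('f, 'f vec) module" and \<pi> where "abelian_extension L K \<pi>"
    "nil_radical L \<subseteq> lie_kernel L K \<pi>"
proof -
  interpret K: lie_algebra K by fact
  obtain r :: "'f vec set \<Rightarrow> nat" where
    r: "\<And>A B. \<lbrakk>lie_ideal K A; lie_ideal K B; A \<subset> B\<rbrakk> \<Longrightarrow> r A < r B"
    using K.lie_ideal_rank by blast
  define I where "I = (\<lambda>(L :: ('f, 'f vec) module, \<pi> :: 'f vec \<Rightarrow> 'f vec). \<pi> ` chief_centraliser L)"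
  define P where "P = (\<lambda>(L :: ('f, 'f vec) module, \<pi>). abelian_extension L K \<pi>)"
  have "abelian_extension K K id"
    using K(1) lie_hom_id by (auto simp: abelian_extension_def lie_kernel_def K.bracket_self)
  then have "P (K, id)" by (simp add: P_def)
  then obtain X where X: "P X" and min: "\<And>Y. P Y \<Longrightarrow> r (I X) \<le> r (I Y)"
    using ex_has_least_nat[of P "(K, id)" "\<lambda>X. r (I X)"] by blast
  have ideal: "lie_ideal K (I Y)" if "P Y" for Y
    using that lie_ideal_image[OF _ K(1)] lie_algebra.lie_ideal_chief_centraliser
    by (auto simp: P_def I_def abelian_extension_def)
  obtain L \<pi> where Lp: "X = (L, \<pi>)" by fastforce
  have ext: "abelian_extension L K \<pi>" using X Lp by (simp add: P_def)
  have zero: "x = \<zero>\<^bsub>K\<^esub>" if x: "x \<in> I X" for x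
  proof (rule ccontr)
    assume "x \<noteq> \<zero>\<^bsub>K\<^esub>"
    moreover have "x \<in> carrier K" using ideal[OF X] x by (auto simp: K.lie_ideal_iff)
    ultimately obtain L' :: "('f, 'f vec) module" and \<pi>' where "abelian_extension L' K \<pi>'"
      "\<pi>' ` chief_centraliser L' \<subseteq> I X" "x \<notin> \<pi>' ` chief_centraliser L'"
      using exists_smaller_extension[OF p K ext, of x] Lp by (auto simp: I_def)
    then have "P (L', \<pi>')" "I (L', \<pi>') \<subset> I X" using x by (auto simp: P_def I_def)
    then show False using r[OF ideal ideal[OF X]] min by fastforce
  qed
  interpret L: lie_algebra L using ext by (simp add: abelian_extension_def)
  have "nil_radical L \<subseteq> lie_kernel L K \<pi>"
    using zero unfolding L.nil_radical_eq_chief_centraliser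
    by (auto simp: lie_kernel_def chief_centraliser_def I_def Lp)
  then show ?thesis using that ext by blast
qed

theorem theorem3p3:
  fixes \<KK> \<FF> :: "('f::field) lie_class"
  assumes "CHAR('f) \<noteq> 0"
    and "soluble_formation \<KK>"
    and "\<FF> = Loc \<KK>"
  shows "\<KK> = quotient_by_nilpotent \<FF>"
proof (intro equalityI subsetI)
  show "M \<in> \<KK>" if "M \<in> quotient_by_nilpotent \<FF>" for M
    using that quotient_by_nilpotent_Loc_subset[OF assms(2)] assms(3) by blast
next
  fix K assume K: "K \<in> \<KK>"
  have lK: "lie_algebra K" and sK: "soluble K"
    using formation_lie_algebra formation_soluble assms(2) K by auto
  obtain L :: "('f, 'f vec) module" and \<pi> where
    ext: "abelian_extension L K \<pi>" and nil: "nil_radical L \<subseteq> lie_kernel L K \<pi>"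
    using exists_extension_nil_radical_in_kernel[OF assms(1) lK sK] by blast
  have L: "lie_algebra L" and \<pi>: "lie_hom L K \<pi>" and surj: "\<pi> ` carrier L = carrier K"
    using ext by (auto simp: abelian_extension_def)
  interpret L: lie_algebra L by fact
  have A: "lie_ideal L (lie_kernel L K \<pi>)" by (rule lie_ideal_kernel[OF L lK \<pi>])
  have "lie_isomorphic K (lie_quotient L (lie_kernel L K \<pi>))"
    using lie_isomorphic_sym[OF L.lie_algebra_lie_quotient[OF A] lK]
      lie_isomorphic_quotient_kernel[OF L lK \<pi> surj] by blast
  moreover have "L \<in> \<FF>"
    using abelian_extension_in_Loc[OF assms(2) K ext] assms(3) by simp
  ultimately show "K \<in> quotient_by_nilpotent \<FF>"
    using lK A nil unfolding quotient_by_nilpotent_def by blast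
qed

end
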